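(* Let $p$ be any prime (including $p=2$), and for $n\ge 1$ let $\rho_n(p)$ denote the probability that a quadratic form in $n$ variables over $\mathbb{Z}_p$ is isotropic. Then $$\rho_1(p)=0,\qquad \rho_2(p)=\frac12,\qquad \rho_3(p)=1-\frac{p}{2(p+1)^2},\qquad \rho_4(p)=1-\frac{p^3}{4(p+1)^2(p^4+p^3+p^2+p+1)},$$ and $\rho_n(p)=1$ for all $n\ge 5$.
   Context: A quadratic form in $n$ variables over $\mathbb{Z}_p$ is $Q(x_1,\dots,x_n)=\sum_{1\le i\le j\le n}c_{ij}x_ix_j$ with all $c_{ij}\in\mathbb{Z}_p$, identified with its coefficient vector in $\mathbb{Z}_p^{n(n+1)/2}$. It is isotropic if there is a nonzero $k\in\mathbb{Z}_p^n$ with $Q(k)=0$. Probability is with respect to the additive Haar measure on $\mathbb{Z}_p^{n(n+1)/2}$ normalized to have total mass $1$. *)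

theory Defs
  imports
    "HOL-Probability.Probability"
    "HOL-Computational_Algebra.Primes"
    "HOL-Algebra.Ring"
    "HOL-Algebra.Product_Groups"
begin

section \<open>The ring of p-adic integers\<close>

text \<open>
  The ring is the inverse limit of the rings of integers modulo \<open>p ^ k\<close>: an element is the
  compatible sequence of its canonical residues, so \<open>x k\<close> is the reduction of \<open>x\<close> modulo \<open>p ^ k\<close>.
\<close>

definition Zp :: "nat \<Rightarrow> (nat \<Rightarrow> int) ring" where
  "Zp p =
     \<lparr>carrier = {x. \<forall>k. x k \<in> {0..<int p ^ k} \<and> x (Suc k) mod int p ^ k = x k},
      mult = (\<lambda>x y k. (x k * y k) mod int p ^ k),
      one = (\<lambda>k. 1 mod int p ^ k),
      zero = (\<lambda>k. 0),
      add = (\<lambda>x y k. (x k + y k) mod int p ^ k)\<rparr>"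

definition Zp_topology :: "nat \<Rightarrow> (nat \<Rightarrow> int) topology" where
  "Zp_topology p =
     subtopology (product_topology (\<lambda>k. discrete_topology {0..<int p ^ k}) UNIV) (carrier (Zp p))"

definition Zp_power :: "nat \<Rightarrow> 'i set \<Rightarrow> ('i \<Rightarrow> nat \<Rightarrow> int) monoid" where
  "Zp_power p I = product_group I (\<lambda>_. add_monoid (Zp p))"

definition Zp_power_topology :: "nat \<Rightarrow> 'i set \<Rightarrow> ('i \<Rightarrow> nat \<Rightarrow> int) topology" where
  "Zp_power_topology p I = product_topology (\<lambda>_. Zp_topology p) I"


section \<open>Normalized Haar measure\<close>

text \<open>
  This is used for compact metrizable groups only, where every finite Borel measure is Radon;
  therefore no regularity condition is listed. For \<open>p > 0\<close> and finite \<open>I\<close> the description in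
  \<open>Zp_haar\<close> below is proper; see \<open>normalized_haar_Zp_haar\<close>. The event in \<open>isotropic_prob\<close> is
  measurable; see \<open>isotropic_measurable\<close>.
\<close>

definition normalized_haar_measure ::
    "('a, 'b) monoid_scheme \<Rightarrow> 'a topology \<Rightarrow> 'a measure \<Rightarrow> bool" where
  "normalized_haar_measure G T M \<longleftrightarrow>
     space M = topspace T \<and>
     sets M = sigma_sets (topspace T) {U. openin T U} \<and>
     emeasure M (space M) = 1 \<and>
     (\<forall>g\<in>carrier G. \<forall>A\<in>sets M. g <#\<^bsub>G\<^esub> A \<in> sets M \<and> emeasure M (g <#\<^bsub>G\<^esub> A) = emeasure M A)"

definition Zp_haar :: "nat \<Rightarrow> 'i set \<Rightarrow> ('i \<Rightarrow> nat \<Rightarrow> int) measure" where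
  "Zp_haar p I = (THE M. normalized_haar_measure (Zp_power p I) (Zp_power_topology p I) M)"


section \<open>Quadratic forms\<close>

definition form_index :: "nat \<Rightarrow> (nat \<times> nat) set" where
  "form_index n = {(i, j). 1 \<le> i \<and> i \<le> j \<and> j \<le> n}"

definition quadratic_forms :: "nat \<Rightarrow> nat \<Rightarrow> (nat \<times> nat \<Rightarrow> nat \<Rightarrow> int) set" where
  "quadratic_forms p n = form_index n \<rightarrow>\<^sub>E carrier (Zp p)"

definition form_eval ::
    "nat \<Rightarrow> nat \<Rightarrow> (nat \<times> nat \<Rightarrow> nat \<Rightarrow> int) \<Rightarrow> (nat \<Rightarrow> nat \<Rightarrow> int) \<Rightarrow> nat \<Rightarrow> int" where
  "form_eval p n c x =
     finsum (Zp p) (\<lambda>(i, j). c (i, j) \<otimes>\<^bsub>Zp p\<^esub> x i \<otimes>\<^bsub>Zp p\<^esub> x j) (form_index n)"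

definition isotropic :: "nat \<Rightarrow> nat \<Rightarrow> (nat \<times> nat \<Rightarrow> nat \<Rightarrow> int) \<Rightarrow> bool" where
  "isotropic p n c \<longleftrightarrow>
     (\<exists>x \<in> {1..n} \<rightarrow>\<^sub>E carrier (Zp p).
        x \<noteq> (\<lambda>i\<in>{1..n}. \<zero>\<^bsub>Zp p\<^esub>) \<and> form_eval p n c x = \<zero>\<^bsub>Zp p\<^esub>)"

definition isotropic_prob :: "nat \<Rightarrow> nat \<Rightarrow> real" where
  "isotropic_prob p n = measure (Zp_haar p (form_index n)) {c \<in> quadratic_forms p n. isotropic p n c}"


section \<open>Well-definedness\<close>

lemma Zp_simps [simp]:
  "x \<otimes>\<^bsub>Zp p\<^esub> y = (\<lambda>k. (x k * y k) mod int p ^ k)"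
  "x \<oplus>\<^bsub>Zp p\<^esub> y = (\<lambda>k. (x k + y k) mod int p ^ k)"
  "\<one>\<^bsub>Zp p\<^esub> = (\<lambda>k. 1 mod int p ^ k)"
  "\<zero>\<^bsub>Zp p\<^esub> = (\<lambda>k. 0)"
  by (simp_all add: Zp_def)

lemma Zp_carrier_iff:
  "x \<in> carrier (Zp p) \<longleftrightarrow> (\<forall>k. 0 \<le> x k \<and> x k < int p ^ k \<and> x (Suc k) mod int p ^ k = x k)"
  by (auto simp: Zp_def)

lemma Zp_mod_self: "x \<in> carrier (Zp p) \<Longrightarrow> x k mod int p ^ k = x k"
  by (simp add: Zp_carrier_iff)

lemma Zp_mod_le:
  assumes "x \<in> carrier (Zp p)" "j \<le> k"
  shows "x k mod int p ^ j = x j"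
  using assms(2)
proof (induction k rule: dec_induct)
  case base
  then show ?case using assms by (simp add: Zp_mod_self)
next
  case (step k)
  have "x (Suc k) mod int p ^ j = (x (Suc k) mod int p ^ k) mod int p ^ j"
    using step by (simp add: mod_mod_cancel le_imp_power_dvd)
  also have "x (Suc k) mod int p ^ k = x k"
    using assms(1) by (simp add: Zp_carrier_iff)
  finally show ?case using step by simp
qed

lemma Zp_mod_carrierI:
  assumes "p > 0" "\<And>k. x (Suc k) mod int p ^ k = x k mod int p ^ k"
  shows "(\<lambda>k. x k mod int p ^ k) \<in> carrier (Zp p)"
  using assms by (auto simp: Zp_carrier_iff mod_mod_cancel)

lemma Zp_Suc: "x \<in> carrier (Zp p) \<Longrightarrow> x (Suc k) mod int p ^ k = x k"
  by (simp add: Zp_carrier_iff)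

lemma Zp_add_closed:
  assumes "p > 0" "x \<in> carrier (Zp p)" "y \<in> carrier (Zp p)"
  shows "(\<lambda>k. (x k + y k) mod int p ^ k) \<in> carrier (Zp p)"
  by (rule Zp_mod_carrierI) (use assms in \<open>simp_all add: Zp_Suc flip: mod_add_eq[of "x (Suc _)"]\<close>)

lemma Zp_mult_closed:
  assumes "p > 0" "x \<in> carrier (Zp p)" "y \<in> carrier (Zp p)"
  shows "(\<lambda>k. (x k * y k) mod int p ^ k) \<in> carrier (Zp p)"
  by (rule Zp_mod_carrierI) (use assms in \<open>simp_all add: Zp_Suc flip: mod_mult_eq[of "x (Suc _)"]\<close>)

lemma Zp_uminus_closed:
  assumes "p > 0" "x \<in> carrier (Zp p)"
  shows "(\<lambda>k. (- x k) mod int p ^ k) \<in> carrier (Zp p)"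
  by (rule Zp_mod_carrierI) (use assms in \<open>simp_all add: Zp_Suc flip: mod_minus_eq[of "x (Suc _)"]\<close>)

lemma Zp_cring:
  assumes "p > 0"
  shows "cring (Zp p)"
proof (rule cringI)
  show "abelian_group (Zp p)"
  proof (rule abelian_groupI)
    fix x y z assume *: "x \<in> carrier (Zp p)" "y \<in> carrier (Zp p)" "z \<in> carrier (Zp p)"
    show "x \<oplus>\<^bsub>Zp p\<^esub> y \<in> carrier (Zp p)"
      using * assms by (simp add: Zp_add_closed)
    show "x \<oplus>\<^bsub>Zp p\<^esub> y \<oplus>\<^bsub>Zp p\<^esub> z = x \<oplus>\<^bsub>Zp p\<^esub> (y \<oplus>\<^bsub>Zp p\<^esub> z)"
      by (simp add: mod_simps add_ac)
    show "x \<oplus>\<^bsub>Zp p\<^esub> y = y \<oplus>\<^bsub>Zp p\<^esub> x"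
      by (simp add: add_ac)
  next
    fix x assume *: "x \<in> carrier (Zp p)"
    show "\<zero>\<^bsub>Zp p\<^esub> \<oplus>\<^bsub>Zp p\<^esub> x = x"
      using * by (simp add: Zp_mod_self)
    show "\<exists>y\<in>carrier (Zp p). y \<oplus>\<^bsub>Zp p\<^esub> x = \<zero>\<^bsub>Zp p\<^esub>"
      by (rule bexI[OF _ Zp_uminus_closed[OF assms *]]) (simp add: mod_simps)
  qed (use assms in \<open>auto simp: Zp_carrier_iff\<close>)
next
  show "comm_monoid (Zp p)"
  proof (rule comm_monoidI)
    fix x y z assume *: "x \<in> carrier (Zp p)" "y \<in> carrier (Zp p)" "z \<in> carrier (Zp p)"
    show "x \<otimes>\<^bsub>Zp p\<^esub> y \<in> carrier (Zp p)"
      using * assms by (simp add: Zp_mult_closed)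
    show "x \<otimes>\<^bsub>Zp p\<^esub> y \<otimes>\<^bsub>Zp p\<^esub> z = x \<otimes>\<^bsub>Zp p\<^esub> (y \<otimes>\<^bsub>Zp p\<^esub> z)"
      by (simp add: mod_simps mult_ac)
    show "x \<otimes>\<^bsub>Zp p\<^esub> y = y \<otimes>\<^bsub>Zp p\<^esub> x"
      by (simp add: mult_ac)
  next
    fix x assume *: "x \<in> carrier (Zp p)"
    show "\<one>\<^bsub>Zp p\<^esub> \<otimes>\<^bsub>Zp p\<^esub> x = x"
      using * by (simp add: Zp_mod_self mod_simps)
  next
    show "\<one>\<^bsub>Zp p\<^esub> \<in> carrier (Zp p)"
      using Zp_mod_carrierI[OF assms, of "\<lambda>_. 1"] by simp
  qed
next
  fix x y z
  show "(x \<oplus>\<^bsub>Zp p\<^esub> y) \<otimes>\<^bsub>Zp p\<^esub> z = x \<otimes>\<^bsub>Zp p\<^esub> z \<oplus>\<^bsub>Zp p\<^esub> y \<otimes>\<^bsub>Zp p\<^esub> z"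
    by (simp add: mod_simps algebra_simps)
qed

lemma finite_form_index [simp]: "finite (form_index n)"
  by (rule finite_subset[of _ "{..n} \<times> {..n}"]) (auto simp: form_index_def)

lemma Zp_finsum:
  assumes "p > 0" "finite A" "f \<in> A \<rightarrow> carrier (Zp p)"
  shows "(\<Oplus>\<^bsub>Zp p\<^esub>a\<in>A. f a) = (\<lambda>k. (\<Sum>a\<in>A. f a k) mod int p ^ k)"
proof -
  interpret cring "Zp p" by (rule Zp_cring) fact
  show ?thesis
    using assms(2,3)
  proof (induction A rule: finite_induct)
    case (insert a A)
    then show ?case by (simp add: finsum_insert mod_simps)
  qed simp
qed

lemma form_eval_eq:
  assumes "p > 0" "c \<in> quadratic_forms p n" "x \<in> {1..n} \<rightarrow>\<^sub>E carrier (Zp p)"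
  shows "form_eval p n c x =
    (\<lambda>k. (\<Sum>(i, j)\<in>form_index n. c (i, j) k * x i k * x j k) mod int p ^ k)"
proof -
  interpret cring "Zp p" by (rule Zp_cring) fact
  have x: "x i \<in> carrier (Zp p)" if "i \<in> {1..n}" for i
    using assms(3) that by auto
  have c: "c ij \<in> carrier (Zp p)" if "ij \<in> form_index n" for ij
    using assms(2) that by (auto simp: quadratic_forms_def)
  have "form_eval p n c x =
     (\<lambda>k. (\<Sum>ij\<in>form_index n. (case ij of (i, j) \<Rightarrow> c (i, j) \<otimes>\<^bsub>Zp p\<^esub> x i \<otimes>\<^bsub>Zp p\<^esub> x j) k) mod int p ^ k)"
    unfolding form_eval_def
  proof (rule Zp_finsum)
    show "(\<lambda>(i, j). c (i, j) \<otimes>\<^bsub>Zp p\<^esub> x i \<otimes>\<^bsub>Zp p\<^esub> x j) \<in> form_index n \<rightarrow> carrier (Zp p)"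
    proof safe
      fix i j assume ij: "(i, j) \<in> form_index n"
      then have "i \<in> {1..n}" "j \<in> {1..n}" by (auto simp: form_index_def)
      then show "c (i, j) \<otimes>\<^bsub>Zp p\<^esub> x i \<otimes>\<^bsub>Zp p\<^esub> x j \<in> carrier (Zp p)"
        using x c[OF ij] by (intro m_closed) auto
    qed
  qed (use assms in simp_all)
  also have "\<dots> = (\<lambda>k. (\<Sum>ij\<in>form_index n.
      ((case ij of (i, j) \<Rightarrow> c (i, j) k * x i k * x j k) mod int p ^ k)) mod int p ^ k)"
    by (intro ext arg_cong2[of _ _ _ _ "(mod)"] sum.cong refl) (auto simp: mod_simps)
  also have "\<dots> = (\<lambda>k. (\<Sum>(i, j)\<in>form_index n. c (i, j) k * x i k * x j k) mod int p ^ k)"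
    by (simp add: mod_sum_eq)
  finally show ?thesis .
qed

lemma topspace_Zp_topology [simp]: "topspace (Zp_topology p) = carrier (Zp p)"
  by (auto simp: Zp_topology_def Zp_carrier_iff)

lemma topspace_Zp_power_topology [simp]:
  "topspace (Zp_power_topology p I) = I \<rightarrow>\<^sub>E carrier (Zp p)"
  by (simp add: Zp_power_topology_def)

lemma carrier_Zp_power [simp]: "carrier (Zp_power p I) = I \<rightarrow>\<^sub>E carrier (Zp p)"
  by (simp add: Zp_power_def)

lemma mult_Zp_power [simp]:
  "x \<otimes>\<^bsub>Zp_power p I\<^esub> y = (\<lambda>i\<in>I. \<lambda>k. (x i k + y i k) mod int p ^ k)"
  by (simp add: Zp_power_def)

lemma group_Zp_power:
  assumes "p > 0"
  shows "Group.group (Zp_power p I)"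
proof -
  interpret cring "Zp p" by (rule Zp_cring) fact
  show ?thesis unfolding Zp_power_def by (rule product_group) (rule a_group)
qed

subsection \<open>Cylinder sets\<close>

definition cylinder :: "nat \<Rightarrow> 'i set \<Rightarrow> nat \<Rightarrow> ('i \<Rightarrow> int) \<Rightarrow> ('i \<Rightarrow> nat \<Rightarrow> int) set" where
  "cylinder p I k f = {x \<in> I \<rightarrow>\<^sub>E carrier (Zp p). \<forall>i\<in>I. x i k = f i}"

definition residues :: "nat \<Rightarrow> 'i set \<Rightarrow> nat \<Rightarrow> ('i \<Rightarrow> int) set" where
  "residues p I k = I \<rightarrow>\<^sub>E {0..<int p ^ k}"

definition cylinders :: "nat \<Rightarrow> 'i set \<Rightarrow> ('i \<Rightarrow> nat \<Rightarrow> int) set set" where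
  "cylinders p I = insert {} (\<Union>k. cylinder p I k ` residues p I k)"

lemma finite_residues: "finite I \<Longrightarrow> finite (residues p I k)"
  by (simp add: residues_def finite_PiE)

lemma countable_cylinders: "finite I \<Longrightarrow> countable (cylinders p I)"
  by (simp add: cylinders_def countable_finite finite_residues)

lemma cylinder_subset: "cylinder p I k f \<subseteq> I \<rightarrow>\<^sub>E carrier (Zp p)"
  by (auto simp: cylinder_def)

lemma residue_of_mem: "x \<in> I \<rightarrow>\<^sub>E carrier (Zp p) \<Longrightarrow> (\<lambda>i\<in>I. x i k) \<in> residues p I k"
  by (auto simp: residues_def Zp_carrier_iff PiE_iff)

lemma cylinder_of_mem:
  assumes "x \<in> I \<rightarrow>\<^sub>E carrier (Zp p)"
  shows "cylinder p I k (\<lambda>i\<in>I. x i k) \<in> cylinders p I" "x \<in> cylinder p I k (\<lambda>i\<in>I. x i k)"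
proof -
  show "cylinder p I k (\<lambda>i\<in>I. x i k) \<in> cylinders p I"
    unfolding cylinders_def using residue_of_mem[OF assms, of k] by blast
  show "x \<in> cylinder p I k (\<lambda>i\<in>I. x i k)"
    using assms by (simp add: cylinder_def)
qed

lemma continuous_map_Zp_component:
  assumes "i \<in> I"
  shows "continuous_map (Zp_power_topology p I) (discrete_topology {0..<int p ^ k}) (\<lambda>x. x i k)"
proof -
  have 1: "continuous_map (Zp_power_topology p I) (Zp_topology p) (\<lambda>x. x i)"
    unfolding Zp_power_topology_def using assms by (rule continuous_map_product_projection)
  have 2: "continuous_map (Zp_topology p) (discrete_topology {0..<int p ^ k}) (\<lambda>y. y k)"
    unfolding Zp_topology_def
    by (intro continuous_map_from_subtopology continuous_map_product_projection) simp
  show ?thesis using continuous_map_compose[OF 1 2] by (simp add: o_def)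
qed

lemma openin_cylinder:
  assumes "finite I" "p > 0" "f \<in> residues p I k"
  shows "openin (Zp_power_topology p I) (cylinder p I k f)"
proof (cases "I = {}")
  case True
  then have "cylinder p I k f = topspace (Zp_power_topology p I)"
    by (auto simp: cylinder_def)
  then show ?thesis by (simp only: openin_topspace)
next
  case False
  have "openin (Zp_power_topology p I) (\<Inter>i\<in>I. {x \<in> topspace (Zp_power_topology p I). x i k \<in> {f i}})"
    using assms False
    by (intro openin_INT2 openin_continuous_map_preimage[OF continuous_map_Zp_component])
       (auto simp: residues_def)
  also have "(\<Inter>i\<in>I. {x \<in> topspace (Zp_power_topology p I). x i k \<in> {f i}}) = cylinder p I k f"
    using False by (auto simp: cylinder_def)
  finally show ?thesis .
qed

lemma Zp_open_ball:
  assumes "openin (Zp_topology p) V" "y \<in> V"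
  obtains k where "\<And>z. z \<in> carrier (Zp p) \<Longrightarrow> z k = y k \<Longrightarrow> z \<in> V"
proof -
  from assms(1) obtain W where W: "V = W \<inter> carrier (Zp p)"
    "openin (product_topology (\<lambda>k. discrete_topology {0..<int p ^ k}) UNIV) W"
    unfolding Zp_topology_def openin_subtopology by blast
  with assms(2) obtain U where U: "finite {m. U m \<noteq> {0..<int p ^ m}}" "y \<in> Pi\<^sub>E UNIV U" "Pi\<^sub>E UNIV U \<subseteq> W"
    unfolding openin_product_topology_alt by force
  then obtain k where k: "m \<le> k" if "U m \<noteq> {0..<int p ^ m}" for m
    using finite_nat_set_iff_bounded_le by auto
  show ?thesis
  proof (rule that[of k])
    fix z assume z: "z \<in> carrier (Zp p)" "z k = y k"
    have "z m \<in> U m" for m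
    proof (cases "m \<le> k")
      case True
      have y: "y \<in> carrier (Zp p)" using assms W by auto
      have "z m = y m"
        using Zp_mod_le[OF z(1) True] Zp_mod_le[OF y True] z(2) by simp
      then show ?thesis using U by auto
    next
      case False
      then have "U m = {0..<int p ^ m}" using k by blast
      then show ?thesis using z by (simp add: Zp_carrier_iff)
    qed
    then show "z \<in> V" using W U z by auto
  qed
qed

lemma Zp_power_open_cylinder:
  assumes "finite I" "openin (Zp_power_topology p I) U" "x \<in> U"
  shows "\<exists>k. cylinder p I k (\<lambda>i\<in>I. x i k) \<subseteq> U"
proof -
  from assms(2,3) obtain V where V: "\<forall>i\<in>I. openin (Zp_topology p) (V i)" "x \<in> Pi\<^sub>E I V" "Pi\<^sub>E I V \<subseteq> U"
    unfolding Zp_power_topology_def openin_product_topology_alt by blast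
  have "\<exists>k. \<forall>z\<in>carrier (Zp p). z k = x i k \<longrightarrow> z \<in> V i" if "i \<in> I" for i
    using V that Zp_open_ball[of p "V i" "x i"] by (metis PiE_mem)
  then obtain K where K: "\<And>i z. i \<in> I \<Longrightarrow> z \<in> carrier (Zp p) \<Longrightarrow> z (K i) = x i (K i) \<Longrightarrow> z \<in> V i"
    by metis
  obtain k where k: "\<And>i. i \<in> I \<Longrightarrow> K i \<le> k"
    using finite_nat_set_iff_bounded_le[of "K ` I"] assms(1) by auto
  have x: "x i \<in> carrier (Zp p)" if "i \<in> I" for i
    using V that openin_subset[of "Zp_topology p" "V i"] by auto
  have "cylinder p I k (\<lambda>i\<in>I. x i k) \<subseteq> Pi\<^sub>E I V"
  proof
    fix z assume z: "z \<in> cylinder p I k (\<lambda>i\<in>I. x i k)"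
    have "z i \<in> V i" if i: "i \<in> I" for i
    proof (rule K[OF i])
      show zi: "z i \<in> carrier (Zp p)" using z i by (auto simp: cylinder_def)
      have "z i k = x i k" using z i by (auto simp: cylinder_def)
      then show "z i (K i) = x i (K i)"
        using Zp_mod_le[OF zi k[OF i]] Zp_mod_le[OF x[OF i] k[OF i]] by simp
    qed
    then show "z \<in> Pi\<^sub>E I V" using z by (auto simp: cylinder_def PiE_iff)
  qed
  with V show ?thesis by blast
qed

lemma sigma_sets_cylinders:
  assumes "finite I" "p > 0"
  shows "sigma_sets (I \<rightarrow>\<^sub>E carrier (Zp p)) {U. openin (Zp_power_topology p I) U} =
         sigma_sets (I \<rightarrow>\<^sub>E carrier (Zp p)) (cylinders p I)"
proof (rule sigma_sets_eqI)
  fix U assume "U \<in> {U. openin (Zp_power_topology p I) U}"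
  then have U: "openin (Zp_power_topology p I) U" by simp
  have "U = \<Union>{A \<in> cylinders p I. A \<subseteq> U}"
  proof (intro equalityI subsetI)
    fix x assume x: "x \<in> U"
    obtain k where "cylinder p I k (\<lambda>i\<in>I. x i k) \<subseteq> U"
      using Zp_power_open_cylinder[OF assms(1) U x] by blast
    moreover have "x \<in> I \<rightarrow>\<^sub>E carrier (Zp p)" using openin_subset[OF U] x by auto
    ultimately show "x \<in> \<Union>{A \<in> cylinders p I. A \<subseteq> U}"
      using cylinder_of_mem[of x I p k] by blast
  qed auto
  also have "\<dots> \<in> sigma_sets (I \<rightarrow>\<^sub>E carrier (Zp p)) (cylinders p I)"
    by (rule sigma_sets_UNION) (auto intro: countable_subset[OF _ countable_cylinders[OF assms(1)]])
  finally show "U \<in> sigma_sets (I \<rightarrow>\<^sub>E carrier (Zp p)) (cylinders p I)" .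
next
  fix A assume "A \<in> cylinders p I"
  then have "openin (Zp_power_topology p I) A"
    by (auto simp: cylinders_def openin_cylinder[OF assms])
  then show "A \<in> sigma_sets (I \<rightarrow>\<^sub>E carrier (Zp p)) {U. openin (Zp_power_topology p I) U}"
    by auto
qed

lemma Int_stable_cylinders: "Int_stable (cylinders p I)"
proof -
  have *: "cylinder p I k f \<inter> cylinder p I l g \<in> cylinders p I"
    if "k \<le> l" "g \<in> residues p I l" for k l f g
  proof (cases "cylinder p I k f \<inter> cylinder p I l g = {}")
    case False
    then obtain x where x: "x \<in> cylinder p I k f" "x \<in> cylinder p I l g" by auto
    have "y \<in> cylinder p I k f" if y: "y \<in> cylinder p I l g" for y
    proof -
      have "y i k = x i k" if "i \<in> I" for i
      proof -
        have "x i \<in> carrier (Zp p)" "y i \<in> carrier (Zp p)" "x i l = y i l"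
          using x y that by (auto simp: cylinder_def)
        then show ?thesis using Zp_mod_le[OF _ \<open>k \<le> l\<close>] by metis
      qed
      then show ?thesis using x y by (auto simp: cylinder_def)
    qed
    then have "cylinder p I k f \<inter> cylinder p I l g = cylinder p I l g" by blast
    then show ?thesis using that by (auto simp: cylinders_def)
  qed (simp add: cylinders_def)
  show ?thesis
  proof (rule Int_stableI)
    fix A B assume AB: "A \<in> cylinders p I" "B \<in> cylinders p I"
    show "A \<inter> B \<in> cylinders p I"
    proof (cases "A = {} \<or> B = {}")
      case True
      then show ?thesis by (auto simp: cylinders_def)
    next
      case False
      with AB obtain k f l g where
        "A = cylinder p I k f" "f \<in> residues p I k" "B = cylinder p I l g" "g \<in> residues p I l"
        by (auto simp: cylinders_def)
      then show ?thesis
        using *[of k l g f] *[of l k f g] by (metis Int_commute nle_le)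
    qed
  qed
qed

lemma l_coset_cylinder:
  assumes "p > 0" "t \<in> I \<rightarrow>\<^sub>E carrier (Zp p)" "f \<in> residues p I k"
  shows "t <#\<^bsub>Zp_power p I\<^esub> cylinder p I k f = cylinder p I k (\<lambda>i\<in>I. (t i k + f i) mod int p ^ k)"
proof (intro equalityI subsetI)
  interpret G: Group.group "Zp_power p I" using assms(1) by (rule group_Zp_power)
  fix y assume "y \<in> t <#\<^bsub>Zp_power p I\<^esub> cylinder p I k f"
  then obtain x where x: "x \<in> cylinder p I k f" "y = t \<otimes>\<^bsub>Zp_power p I\<^esub> x"
    by (auto simp: l_coset_def)
  have "y \<in> carrier (Zp_power p I)"
    unfolding x(2) using assms x by (intro G.m_closed) (auto simp: cylinder_def)
  moreover have "y i k = (t i k + f i) mod int p ^ k" if "i \<in> I" for i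
    using x that by (simp add: cylinder_def)
  ultimately show "y \<in> cylinder p I k (\<lambda>i\<in>I. (t i k + f i) mod int p ^ k)"
    by (simp add: cylinder_def)
next
  interpret G: Group.group "Zp_power p I" using assms(1) by (rule group_Zp_power)
  fix y assume y: "y \<in> cylinder p I k (\<lambda>i\<in>I. (t i k + f i) mod int p ^ k)"
  have t: "t \<in> carrier (Zp_power p I)" and yc: "y \<in> carrier (Zp_power p I)"
    using assms y by (auto simp: cylinder_def)
  define x where "x = inv\<^bsub>Zp_power p I\<^esub> t \<otimes>\<^bsub>Zp_power p I\<^esub> y"
  have xc: "x \<in> carrier (Zp_power p I)" unfolding x_def using t yc by blast
  have tx: "t \<otimes>\<^bsub>Zp_power p I\<^esub> x = y" unfolding x_def using t yc by (simp add: G.inv_solve_left del: carrier_Zp_power mult_Zp_power flip: G.m_assoc)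
  have "x i k = f i" if i: "i \<in> I" for i
  proof -
    have "(t i k + x i k) mod int p ^ k = (t i k + f i) mod int p ^ k"
      using tx y i by (auto simp: cylinder_def)
    then have "x i k mod int p ^ k = f i mod int p ^ k"
      by (metis add_diff_cancel_left' mod_diff_left_eq)
    moreover have "f i mod int p ^ k = f i" using assms(3) i by (force simp: residues_def PiE_iff)
    moreover have "x i k mod int p ^ k = x i k" using xc i by (auto intro!: Zp_mod_self)
    ultimately show ?thesis by simp
  qed
  then have "x \<in> cylinder p I k f" using xc by (simp add: cylinder_def)
  then show "y \<in> t <#\<^bsub>Zp_power p I\<^esub> cylinder p I k f"
    unfolding l_coset_def using tx by blast
qed

lemma cylinder_translate:
  assumes "p > 0" "f \<in> residues p I k" "g \<in> residues p I k"
  shows "\<exists>t\<in>I \<rightarrow>\<^sub>E carrier (Zp p). t <#\<^bsub>Zp_power p I\<^esub> cylinder p I k f = cylinder p I k g"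
proof (rule bexI)
  let ?t = "\<lambda>i\<in>I. \<lambda>j. (g i - f i) mod int p ^ j"
  show t: "?t \<in> I \<rightarrow>\<^sub>E carrier (Zp p)"
    using Zp_mod_carrierI[OF assms(1), of "\<lambda>_. g _ - f _"] by auto
  have "(\<lambda>i\<in>I. (?t i k + f i) mod int p ^ k) = g"
    using assms(3) by (intro ext) (auto simp: residues_def mod_simps PiE_iff extensional_def)
  then show "?t <#\<^bsub>Zp_power p I\<^esub> cylinder p I k f = cylinder p I k g"
    using l_coset_cylinder[OF assms(1) t assms(2)] by simp
qed

lemma normalized_haar_cylinder:
  assumes "finite I" "p > 0" and f: "f \<in> residues p I k"
    and M: "normalized_haar_measure (Zp_power p I) (Zp_power_topology p I) M"
  shows "emeasure M (cylinder p I k f) = ennreal (1 / real p ^ (k * card I))"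
proof -
  have spM: "space M = I \<rightarrow>\<^sub>E carrier (Zp p)"
    and one: "emeasure M (space M) = 1"
    and inv: "\<And>g A. g \<in> I \<rightarrow>\<^sub>E carrier (Zp p) \<Longrightarrow> A \<in> sets M \<Longrightarrow>
                emeasure M (g <#\<^bsub>Zp_power p I\<^esub> A) = emeasure M A"
    and sets: "\<And>U. openin (Zp_power_topology p I) U \<Longrightarrow> U \<in> sets M"
    using M by (auto simp: normalized_haar_measure_def)
  interpret prob_space M by (rule prob_spaceI) (rule one)
  have cyl: "cylinder p I k g \<in> sets M" if "g \<in> residues p I k" for g
    using openin_cylinder[OF assms(1,2) that] by (rule sets)
  have same: "emeasure M (cylinder p I k g) = emeasure M (cylinder p I k f)" if "g \<in> residues p I k" for g
    using cylinder_translate[OF assms(2) f that] inv[OF _ cyl[OF f]] by metis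
  have "(\<Sum>g\<in>residues p I k. emeasure M (cylinder p I k g)) = emeasure M (\<Union>g\<in>residues p I k. cylinder p I k g)"
  proof (rule sum_emeasure)
    show "disjoint_family_on (cylinder p I k) (residues p I k)"
      by (auto simp: disjoint_family_on_def cylinder_def residues_def PiE_iff extensional_def fun_eq_iff)
         metis
  qed (use cyl finite_residues assms in auto)
  also have "(\<Union>g\<in>residues p I k. cylinder p I k g) = space M"
  proof (intro equalityI subsetI)
    fix x assume "x \<in> (\<Union>g\<in>residues p I k. cylinder p I k g)"
    then show "x \<in> space M" unfolding spM using cylinder_subset by blast
  next
    fix x assume "x \<in> space M"
    then have x: "x \<in> I \<rightarrow>\<^sub>E carrier (Zp p)" unfolding spM .
    show "x \<in> (\<Union>g\<in>residues p I k. cylinder p I k g)"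
    proof (rule UN_I)
      show "(\<lambda>i\<in>I. x i k) \<in> residues p I k" using x by (rule residue_of_mem)
      show "x \<in> cylinder p I k (\<lambda>i\<in>I. x i k)" using x by (rule cylinder_of_mem)
    qed
  qed
  also note one
  also have "(\<Sum>g\<in>residues p I k. emeasure M (cylinder p I k g)) =
      ennreal (real (card (residues p I k)) * measure M (cylinder p I k f))"
  proof -
    have "(\<Sum>g\<in>residues p I k. emeasure M (cylinder p I k g)) =
        of_nat (card (residues p I k)) * emeasure M (cylinder p I k f)"
      by (simp add: same cong: sum.cong del: emeasure_eq_measure)
    then show ?thesis
      by (simp add: emeasure_eq_measure ennreal_mult ennreal_of_nat_eq_real_of_nat)
  qed
  finally have "real (card (residues p I k)) * measure M (cylinder p I k f) = 1"
    by (simp flip: ennreal_1)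
  moreover have "card (residues p I k) = p ^ (k * card I)"
    using assms(1) by (simp add: residues_def card_PiE nat_power_eq power_mult)
  ultimately show ?thesis
    using assms(2) by (simp add: emeasure_eq_measure field_simps)
qed

lemma cylinders_measure_eqI:
  assumes "finite I" "p > 0"
    and "sets M = sigma_sets (I \<rightarrow>\<^sub>E carrier (Zp p)) (cylinders p I)"
    and "sets N = sigma_sets (I \<rightarrow>\<^sub>E carrier (Zp p)) (cylinders p I)"
    and "\<And>k f. f \<in> residues p I k \<Longrightarrow> emeasure M (cylinder p I k f) = emeasure N (cylinder p I k f)"
    and "finite_measure M"
  shows "M = N"
proof (rule measure_eqI_generator_eq[OF Int_stable_cylinders _ _ assms(3,4)])
  interpret finite_measure M by fact
  show "cylinders p I \<subseteq> Pow (I \<rightarrow>\<^sub>E carrier (Zp p))"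
    by (auto simp: cylinders_def cylinder_def)
  show "emeasure M X = emeasure N X" if "X \<in> cylinders p I" for X
    using that assms(5) by (auto simp: cylinders_def)
  let ?A = "cylinder p I 0 (\<lambda>i\<in>I. 0)"
  have "?A = I \<rightarrow>\<^sub>E carrier (Zp p)"
  proof -
    have "y 0 = 0" if "y \<in> carrier (Zp p)" for y
      using Zp_mod_self[OF that, of 0] by simp
    then show ?thesis unfolding cylinder_def by (auto dest: PiE_mem)
  qed
  moreover have "?A \<in> cylinders p I"
    unfolding cylinders_def by (intro insertI2 UN_I[of 0] imageI) (auto simp: residues_def)
  ultimately show "range (\<lambda>_::nat. I \<rightarrow>\<^sub>E carrier (Zp p)) \<subseteq> cylinders p I" "(\<Union>i::nat. I \<rightarrow>\<^sub>E carrier (Zp p)) = I \<rightarrow>\<^sub>E carrier (Zp p)"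
    by auto
  show "emeasure M (I \<rightarrow>\<^sub>E carrier (Zp p)) \<noteq> \<infinity>" by (simp add: less_top)
qed

lemma normalized_haar_unique:
  assumes "finite I" "p > 0"
    and M: "normalized_haar_measure (Zp_power p I) (Zp_power_topology p I) M"
    and N: "normalized_haar_measure (Zp_power p I) (Zp_power_topology p I) N"
  shows "M = N"
proof (rule cylinders_measure_eqI[OF assms(1,2)])
  show "sets M = sigma_sets (I \<rightarrow>\<^sub>E carrier (Zp p)) (cylinders p I)"
    "sets N = sigma_sets (I \<rightarrow>\<^sub>E carrier (Zp p)) (cylinders p I)"
    using M N by (simp_all add: normalized_haar_measure_def sigma_sets_cylinders[OF assms(1,2)])
  show "emeasure M (cylinder p I k f) = emeasure N (cylinder p I k f)" if "f \<in> residues p I k" for k f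
    using normalized_haar_cylinder[OF assms(1,2) that] M N by simp
  have "emeasure M (space M) = 1" using M unfolding normalized_haar_measure_def by blast
  then show "finite_measure M" by (intro finite_measureI) simp
qed

subsection \<open>Existence, by choosing p-adic digits independently and uniformly\<close>

lemma digit_sum_bounds:
  fixes d :: "nat \<Rightarrow> int"
  assumes "\<And>m. 0 \<le> d m \<and> d m < int p"
  shows "0 \<le> (\<Sum>m<k. d m * int p ^ m) \<and> (\<Sum>m<k. d m * int p ^ m) < int p ^ k"
proof (induction k)
  case (Suc k)
  have "d k * int p ^ k \<le> (int p - 1) * int p ^ k"
    using assms[of k] by (intro mult_right_mono) auto
  then show ?case using Suc assms[of k] by (simp add: algebra_simps)
qed simp

lemma digit_sum_eq_iff:
  fixes d :: "nat \<Rightarrow> int"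
  assumes d: "\<And>m. 0 \<le> d m \<and> d m < int p" and "0 \<le> f" "f < int p ^ k"
  shows "(\<Sum>m<k. d m * int p ^ m) = f \<longleftrightarrow> (\<forall>m<k. d m = f div int p ^ m mod int p)"
  using assms(2,3)
proof (induction k arbitrary: f)
  case (Suc k)
  let ?S = "\<Sum>m<k. d m * int p ^ m"
  have S: "0 \<le> ?S" "?S < int p ^ k" using digit_sum_bounds[of d p k] d by auto
  have p: "int p ^ k > 0" using S by linarith
  have fp: "f div int p ^ k < int p"
  proof (rule ccontr)
    assume "\<not> f div int p ^ k < int p"
    then have "int p * int p ^ k \<le> f div int p ^ k * int p ^ k"
      using p by (intro mult_right_mono) auto
    also have "\<dots> \<le> f" using p by (simp add: minus_mod_eq_div_mult [symmetric])
    finally show False using Suc.prems(2) by simp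
  qed
  have f0: "f div int p ^ k \<ge> 0" using Suc.prems p by (simp add: pos_imp_zdiv_nonneg_iff)
  have "?S + d k * int p ^ k = f \<longleftrightarrow> ?S = f mod int p ^ k \<and> d k = f div int p ^ k"
  proof
    assume "?S + d k * int p ^ k = f"
    then have "f = ?S + int p ^ k * d k" by (simp add: mult.commute)
    with S p show "?S = f mod int p ^ k \<and> d k = f div int p ^ k" by simp
  next
    assume "?S = f mod int p ^ k \<and> d k = f div int p ^ k"
    then show "?S + d k * int p ^ k = f"
      by (metis mod_div_mult_eq)
  qed
  also have "?S = f mod int p ^ k \<longleftrightarrow> (\<forall>m<k. d m = (f mod int p ^ k) div int p ^ m mod int p)"
    using p by (intro Suc.IH) auto
  also have "\<dots> \<longleftrightarrow> (\<forall>m<k. d m = f div int p ^ m mod int p)"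
  proof -
    have "(f mod int p ^ k) div int p ^ m mod int p = f div int p ^ m mod int p" if "m < k" for m
    proof -
      have pm: "int p ^ m \<noteq> 0" using p that by auto
      have k: "int p ^ k = int p ^ m * int p ^ (k - m)" using that by (simp flip: power_add)
      have "(f mod int p ^ k) div int p ^ m = f div int p ^ m mod int p ^ (k - m)"
        unfolding k using pm by (simp add: zmod_zmult2_eq)
      moreover have "int p dvd int p ^ (k - m)" using that by (simp add: dvd_power)
      ultimately show ?thesis by (simp add: mod_mod_cancel)
    qed
    then show ?thesis by auto
  qed
  also have "d k = f div int p ^ k \<longleftrightarrow> d k = f div int p ^ k mod int p"
    using f0 fp by simp
  finally show ?case by (auto simp: less_Suc_eq)
qed simp

lemma normalized_haar_exists:
  fixes I :: "'i set"
  assumes I: "finite I" and p: "p > 0"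
  shows "\<exists>M. normalized_haar_measure (Zp_power p I) (Zp_power_topology p I) M"
proof -
  let ?C = "I \<rightarrow>\<^sub>E carrier (Zp p)"
  define U where "U = uniform_count_measure {0..<int p}"
  have spU: "space U = {0..<int p}" and setsU: "sets U = Pow {0..<int p}"
    by (simp_all add: U_def space_uniform_count_measure sets_uniform_count_measure)
  interpret U: prob_space U
    unfolding U_def using p by (intro prob_space_uniform_count_measure) auto
  define D where "D = PiM (I \<times> (UNIV :: nat set)) (\<lambda>_. U)"
  interpret P: product_prob_space "\<lambda>_. U" "I \<times> (UNIV :: nat set)" ..
  have D: "prob_space D" unfolding D_def by (rule prob_space_PiM) unfold_locales
  define X where "X = (\<lambda>d :: 'i \<times> nat \<Rightarrow> int. \<lambda>i\<in>I. \<lambda>k. \<Sum>m<k. d (i, m) * int p ^ m)"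
  have dD: "0 \<le> d (i, m) \<and> d (i, m) < int p" if "d \<in> space D" "i \<in> I" for d i m
    using that by (force simp: D_def space_PiM spU PiE_iff)
  have X_space: "X d \<in> ?C" if d: "d \<in> space D" for d
  proof -
    have "(\<lambda>k. \<Sum>m<k. d (i, m) * int p ^ m) \<in> carrier (Zp p)" if "i \<in> I" for i
      using digit_sum_bounds[of "\<lambda>m. d (i, m)" p] dD[OF d that] by (auto simp: Zp_carrier_iff)
    then show ?thesis by (auto simp: X_def)
  qed
  have X_cyl: "X -` cylinder p I k f \<inter> space D =
      {d \<in> space D. \<forall>(i, m) \<in> I \<times> {..<k}. d (i, m) \<in> {f i div int p ^ m mod int p}}"
    if "f \<in> residues p I k" for k f
  proof -
    have "X d \<in> cylinder p I k f \<longleftrightarrow> (\<forall>i\<in>I. \<forall>m<k. d (i, m) = f i div int p ^ m mod int p)"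
      if d: "d \<in> space D" for d
    proof -
      have "X d \<in> cylinder p I k f \<longleftrightarrow> (\<forall>i\<in>I. (\<Sum>m<k. d (i, m) * int p ^ m) = f i)"
        using X_space[OF d] by (auto simp: cylinder_def X_def)
      also have "\<dots> \<longleftrightarrow> (\<forall>i\<in>I. \<forall>m<k. d (i, m) = f i div int p ^ m mod int p)"
        using \<open>f \<in> residues p I k\<close> dD[OF d]
        by (intro ball_cong refl digit_sum_eq_iff) (auto simp: residues_def)
      finally show ?thesis .
    qed
    then show ?thesis by auto
  qed
  have X_emeasure: "X -` cylinder p I k f \<inter> space D \<in> sets D \<and>
      emeasure D (X -` cylinder p I k f \<inter> space D) = ennreal (1 / real p) ^ card (I \<times> {..<k})"
    if "f \<in> residues p I k" for k f
  proof -
    let ?Y = "\<lambda>(i, m). {f i div int p ^ m mod int p}"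
    have eq: "X -` cylinder p I k f \<inter> space D = {d \<in> space D. \<forall>im \<in> I \<times> {..<k}. d im \<in> ?Y im}"
      unfolding X_cyl[OF that] by auto
    have Y: "?Y im \<in> sets U" for im
      using p by (auto simp: setsU split: prod.split)
    have 1: "{d \<in> space D. \<forall>im \<in> I \<times> {..<k}. d im \<in> ?Y im} \<in> sets D"
      unfolding D_def
    proof (rule sets.sets_Collect_finite_All)
      fix im assume "im \<in> I \<times> {..<k}"
      then have "im \<in> I \<times> UNIV" by auto
      moreover have "{x \<in> space U. x \<in> ?Y im} \<in> sets U" using spU setsU by auto
      ultimately show "{d \<in> space (PiM (I \<times> UNIV) (\<lambda>_. U)). d im \<in> ?Y im} \<in> sets (PiM (I \<times> UNIV) (\<lambda>_. U))"
        by (rule sets_Collect_single')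
    qed (use I in simp)
    have "emeasure U (?Y im) = ennreal (1 / real p)" for im
      using p by (auto simp: U_def emeasure_uniform_count_measure split: prod.split)
    then have "emeasure D {d \<in> space D. \<forall>im \<in> I \<times> {..<k}. d im \<in> ?Y im} = ennreal (1 / real p) ^ card (I \<times> {..<k})"
      unfolding D_def using I Y by (subst P.emeasure_PiM_Collect) (simp_all only: prod_constant, auto)
    with 1 eq show ?thesis by simp
  qed
  define S where "S = sigma ?C (cylinders p I)"
  have cyl_Pow: "cylinders p I \<subseteq> Pow ?C" by (auto simp: cylinders_def cylinder_def)
  have S: "space S = ?C" "sets S = sigma_sets ?C (cylinders p I)"
    using cyl_Pow by (simp_all add: S_def)
  have X: "X \<in> measurable D S"
  proof (rule measurable_sigma_sets[OF S(2) cyl_Pow])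
    show "X \<in> space D \<rightarrow> ?C" using X_space by blast
    show "X -` A \<inter> space D \<in> sets D" if "A \<in> cylinders p I" for A
      using that X_emeasure by (auto simp: cylinders_def)
  qed
  define M where "M = distr D S X"
  have M: "space M = ?C" "sets M = sigma_sets ?C (cylinders p I)" by (simp_all add: M_def S)
  have cylM: "cylinder p I k f \<in> sets M" if "f \<in> residues p I k" for k f
    unfolding M using that by (intro sigma_sets.Basic) (auto simp: cylinders_def)
  have M_cyl: "emeasure M (cylinder p I k f) = ennreal (1 / real p) ^ card (I \<times> {..<k})"
    if "f \<in> residues p I k" for k f
    unfolding M_def using X_emeasure[OF that] cylM[OF that] X by (subst emeasure_distr) (auto simp: M_def)
  interpret M: prob_space M
    unfolding M_def using D X by (rule prob_space.prob_space_distr)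
  interpret G: Group.group "Zp_power p I" using p by (rule group_Zp_power)
  have inv: "g <#\<^bsub>Zp_power p I\<^esub> A \<in> sets M \<and> emeasure M (g <#\<^bsub>Zp_power p I\<^esub> A) = emeasure M A"
    if g: "g \<in> carrier (Zp_power p I)" and A: "A \<in> sets M" for g A
  proof -
    let ?h = "\<lambda>x. inv\<^bsub>Zp_power p I\<^esub> g \<otimes>\<^bsub>Zp_power p I\<^esub> x"
    have space: "space M = carrier (Zp_power p I)" by (simp add: M)
    have pre: "?h -` B \<inter> space M = g <#\<^bsub>Zp_power p I\<^esub> B" if "B \<subseteq> carrier (Zp_power p I)" for B
    proof (intro equalityI subsetI)
      fix x assume x: "x \<in> ?h -` B \<inter> space M"
      then have "x = g \<otimes>\<^bsub>Zp_power p I\<^esub> ?h x"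
        using g unfolding space by (metis G.inv_closed G.inv_solve_left' G.m_closed IntD2)
      then show "x \<in> g <#\<^bsub>Zp_power p I\<^esub> B" using x unfolding l_coset_def by blast
    next
      fix x assume "x \<in> g <#\<^bsub>Zp_power p I\<^esub> B"
      then obtain b where b: "b \<in> B" "x = g \<otimes>\<^bsub>Zp_power p I\<^esub> b" unfolding l_coset_def by blast
      then have bc: "b \<in> carrier (Zp_power p I)" using that by blast
      then have "?h x = b" unfolding b(2) using g by (metis G.inv_closed G.l_inv G.l_one G.m_assoc)
      moreover have "x \<in> carrier (Zp_power p I)" unfolding b(2) using g bc by (rule G.m_closed)
      ultimately show "x \<in> ?h -` B \<inter> space M" using b unfolding space by simp
    qed
    have shift: "\<exists>f'\<in>residues p I k. g <#\<^bsub>Zp_power p I\<^esub> cylinder p I k f = cylinder p I k f'"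
      if "f \<in> residues p I k" for k f
    proof -
      have "(\<lambda>i\<in>I. (g i k + f i) mod int p ^ k) \<in> residues p I k"
        using p by (auto simp: residues_def)
      then show ?thesis using l_coset_cylinder[OF p _ that] g by auto
    qed
    have h: "?h \<in> measurable M M"
    proof (rule measurable_sigma_sets[OF M(2) cyl_Pow])
      show "?h \<in> space M \<rightarrow> ?C"
        unfolding space using g by (metis G.inv_closed G.m_closed Pi_I carrier_Zp_power)
      show "?h -` B \<inter> space M \<in> sets M" if B: "B \<in> cylinders p I" for B
      proof (cases "B = {}")
        case False
        with B obtain k f where kf: "B = cylinder p I k f" "f \<in> residues p I k"
          by (auto simp: cylinders_def)
        have "B \<subseteq> carrier (Zp_power p I)" using kf cylinder_subset by simp
        then have "?h -` B \<inter> space M = g <#\<^bsub>Zp_power p I\<^esub> B" by (rule pre)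
        then show ?thesis using shift[OF kf(2)] cylM unfolding kf(1) by metis
      qed simp
    qed
    have "distr M M ?h = M"
    proof (rule cylinders_measure_eqI[OF I p])
      fix k f assume f: "f \<in> residues p I k"
      have "cylinder p I k f \<subseteq> carrier (Zp_power p I)" using cylinder_subset by simp
      then have "emeasure (distr M M ?h) (cylinder p I k f) = emeasure M (g <#\<^bsub>Zp_power p I\<^esub> cylinder p I k f)"
        using h cylM[OF f] by (subst emeasure_distr) (simp_all only: pre)
      also have "\<dots> = emeasure M (cylinder p I k f)"
        using shift[OF f] M_cyl f by auto
      finally show "emeasure (distr M M ?h) (cylinder p I k f) = emeasure M (cylinder p I k f)" .
    next
      show "finite_measure (distr M M ?h)"
        using M.prob_space_distr[OF h] by (simp add: prob_space_def)
    qed (use M in auto)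
    moreover have "A \<subseteq> carrier (Zp_power p I)"
      using sets.sets_into_space[OF A] unfolding space .
    ultimately show ?thesis
      using emeasure_distr[OF h A] measurable_sets[OF h A] pre by metis
  qed
  have "normalized_haar_measure (Zp_power p I) (Zp_power_topology p I) M"
    unfolding normalized_haar_measure_def
    using inv M M.emeasure_space_1 by (auto simp: sigma_sets_cylinders[OF I p])
  then show ?thesis ..
qed

theorem normalized_haar_Zp_haar:
  assumes "finite I" "p > 0"
  shows "normalized_haar_measure (Zp_power p I) (Zp_power_topology p I) (Zp_haar p I)"
  unfolding Zp_haar_def
  by (rule theI') (use normalized_haar_exists[OF assms] normalized_haar_unique[OF assms] in blast)

lemma prob_space_Zp_haar:
  assumes "finite I" "p > 0"
  shows "prob_space (Zp_haar p I)"
proof (rule prob_spaceI)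
  show "emeasure (Zp_haar p I) (space (Zp_haar p I)) = 1"
    using normalized_haar_Zp_haar[OF assms] unfolding normalized_haar_measure_def by blast
qed

lemma space_Zp_haar_forms: "p > 0 \<Longrightarrow> space (Zp_haar p (form_index n)) = quadratic_forms p n"
  using normalized_haar_Zp_haar[of "form_index n" p]
  by (simp add: normalized_haar_measure_def quadratic_forms_def)

subsection \<open>Measurability of the set of isotropic forms\<close>

lemma compact_Zp_topology: "compact_space (Zp_topology p)"
proof -
  let ?X = "product_topology (\<lambda>k. discrete_topology {0..<int p ^ k}) UNIV"
  have *: "closedin ?X {x \<in> topspace ?X. x (Suc k) mod int p ^ k = x k}" for k
  proof -
    have cont: "continuous_map ?X (discrete_topology {0..<int p ^ k}) (\<lambda>x. x k)" for k
      by (intro continuous_map_product_projection) simp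
    have "openin ?X {x \<in> topspace ?X. x (Suc k) mod int p ^ k \<noteq> x k}"
    proof -
      have "{x \<in> topspace ?X. x (Suc k) mod int p ^ k \<noteq> x k} =
         (\<Union>a\<in>{0..<int p ^ Suc k}. {x \<in> topspace ?X. x (Suc k) \<in> {a}} \<inter>
             {x \<in> topspace ?X. x k \<in> {0..<int p ^ k} - {a mod int p ^ k}})"
        by (auto simp: PiE_iff simp del: power_Suc)
      also have "openin ?X \<dots>"
      proof (rule openin_Union, clarify)
        fix a assume "a \<in> {0..<int p ^ Suc k}"
        then show "openin ?X ({x \<in> topspace ?X. x (Suc k) \<in> {a}} \<inter>
             {x \<in> topspace ?X. x k \<in> {0..<int p ^ k} - {a mod int p ^ k}})"
          by (intro openin_Int openin_continuous_map_preimage[OF cont])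
             (auto simp del: power_Suc)
      qed
      finally show ?thesis .
    qed
    moreover have "topspace ?X - {x \<in> topspace ?X. x (Suc k) mod int p ^ k = x k} =
        {x \<in> topspace ?X. x (Suc k) mod int p ^ k \<noteq> x k}" by blast
    ultimately show ?thesis unfolding closedin_def by auto
  qed
  have "carrier (Zp p) = (\<Inter>k. {x \<in> topspace ?X. x (Suc k) mod int p ^ k = x k})"
    by (auto simp: Zp_carrier_iff PiE_iff)
  then have "closedin ?X (carrier (Zp p))" using * by (metis (no_types, lifting) closedin_INT UNIV_not_empty)
  moreover have "compact_space ?X"
    by (simp add: compact_space_product_topology compact_space_discrete_topology)
  ultimately show ?thesis
    unfolding Zp_topology_def by (intro compact_space_subtopology closedin_compact_space)
qed

lemma compact_Zp_power_topology: "compact_space (Zp_power_topology p I)"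
  by (simp add: Zp_power_topology_def compact_space_product_topology compact_Zp_topology)

lemma continuous_map_discrete_iff:
  "continuous_map X (discrete_topology UNIV) f \<longleftrightarrow> (\<forall>v. openin X {x \<in> topspace X. f x = v})"
proof
  assume *: "\<forall>v. openin X {x \<in> topspace X. f x = v}"
  have "openin X {x \<in> topspace X. f x \<in> V}" for V
  proof -
    have "{x \<in> topspace X. f x \<in> V} = (\<Union>v\<in>V. {x \<in> topspace X. f x = v})" by auto
    also have "openin X \<dots>" using * by (intro openin_Union) auto
    finally show ?thesis .
  qed
  then show "continuous_map X (discrete_topology UNIV) f" by (simp add: continuous_map_def)
next
  assume *: "continuous_map X (discrete_topology UNIV) f"
  show "\<forall>v. openin X {x \<in> topspace X. f x = v}"
    using openin_continuous_map_preimage[OF *, of "{_}"] by simp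
qed

lemma continuous_map_discrete_op:
  assumes "continuous_map X (discrete_topology UNIV) f" "continuous_map X (discrete_topology UNIV) g"
  shows "continuous_map X (discrete_topology UNIV) (\<lambda>x. h (f x) (g x))"
  unfolding continuous_map_discrete_iff
proof
  fix v
  have "{x \<in> topspace X. h (f x) (g x) = v} =
    (\<Union>(a, b)\<in>{(a, b). h a b = v}. {x \<in> topspace X. f x = a} \<inter> {x \<in> topspace X. g x = b})"
    by auto
  also have "openin X \<dots>"
    using assms unfolding continuous_map_discrete_iff by (intro openin_Union) auto
  finally show "openin X {x \<in> topspace X. h (f x) (g x) = v}" .
qed

lemma continuous_map_discrete_sum:
  fixes f :: "'b \<Rightarrow> 'a \<Rightarrow> int"
  assumes "finite A" "\<And>a. a \<in> A \<Longrightarrow> continuous_map X (discrete_topology UNIV) (f a)"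
  shows "continuous_map X (discrete_topology UNIV) (\<lambda>x. \<Sum>a\<in>A. f a x)"
  using assms
proof (induction A rule: finite_induct)
  case (insert a A)
  have "continuous_map X (discrete_topology UNIV) (\<lambda>x. f a x + (\<Sum>a\<in>A. f a x))"
    using insert by (intro continuous_map_discrete_op[where h = "(+)"]) auto
  then show ?case using insert by simp
qed simp

lemma closedin_discrete_preimage:
  assumes "continuous_map X (discrete_topology UNIV) f"
  shows "closedin X {x \<in> topspace X. P (f x)}"
  using closedin_continuous_map_preimage[OF assms, of "Collect P"] by simp

lemma continuous_map_Zp_component_UNIV:
  assumes "i \<in> I"
  shows "continuous_map (Zp_power_topology p I) (discrete_topology UNIV) (\<lambda>x. x i k)"
  using continuous_map_compose[OF continuous_map_Zp_component[OF assms, of p k], of "discrete_topology UNIV" "\<lambda>a. a"]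
  by (simp add: o_def)

theorem isotropic_measurable:
  assumes p: "p > 0"
  shows "{c \<in> quadratic_forms p n. isotropic p n c} \<in> sets (Zp_haar p (form_index n))"
proof -
  let ?I = "form_index n" and ?J = "{1..n}"
  let ?T = "Zp_power_topology p ?I" and ?S = "Zp_power_topology p ?J"
  let ?Z = "prod_topology ?T ?S"
  have comp: "continuous_map ?Z (discrete_topology UNIV) (\<lambda>z. fst z ij k)" if "ij \<in> ?I" for ij k
    using continuous_map_compose[OF continuous_map_fst continuous_map_Zp_component_UNIV[OF that]]
    by (simp add: o_def)
  have comp': "continuous_map ?Z (discrete_topology UNIV) (\<lambda>z. snd z i k)" if "i \<in> ?J" for i k
    using continuous_map_compose[OF continuous_map_snd continuous_map_Zp_component_UNIV[OF that]]
    by (simp add: o_def)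
  define E :: "nat \<Rightarrow> (nat \<times> nat \<Rightarrow> nat \<Rightarrow> int) \<times> (nat \<Rightarrow> nat \<Rightarrow> int) \<Rightarrow> int" where
    "E = (\<lambda>k z. \<Sum>ij\<in>?I. fst z ij k * snd z (fst ij) k * snd z (snd ij) k)"
  have E: "continuous_map ?Z (discrete_topology UNIV) (E k)" for k
    unfolding E_def
  proof (intro continuous_map_discrete_sum finite_form_index)
    fix ij assume ij: "ij \<in> ?I"
    then have "fst ij \<in> ?J" "snd ij \<in> ?J" by (auto simp: form_index_def)
    then show "continuous_map ?Z (discrete_topology UNIV)
        (\<lambda>z. fst z ij k * snd z (fst ij) k * snd z (snd ij) k)"
      using comp[OF ij] comp' by (intro continuous_map_discrete_op[where h = "\<lambda>a b. a * b"]) auto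
  qed
  define K where "K = (\<lambda>i m. {z \<in> topspace ?Z. snd z i m \<noteq> 0} \<inter>
      (\<Inter>k. {z \<in> topspace ?Z. E k z mod int p ^ k = 0}))"
  have "closedin ?Z (K i m)" if "i \<in> ?J" for i m
    unfolding K_def using that
    by (intro closedin_Int closedin_INT closedin_discrete_preimage[OF E] closedin_discrete_preimage[OF comp']) auto
  then have closed: "closedin ?T (fst ` K i m)" if "i \<in> ?J" for i m
    using closed_map_fst[OF compact_Zp_power_topology] that unfolding closed_map_def by blast
  have "fst ` K i m \<in> sets (Zp_haar p ?I)" if "i \<in> ?J" for i m
  proof -
    have haar: "space (Zp_haar p ?I) = topspace ?T"
      "sets (Zp_haar p ?I) = sigma_sets (topspace ?T) {U. openin ?T U}"
      using normalized_haar_Zp_haar[OF finite_form_index p, of n]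
      by (auto simp: normalized_haar_measure_def)
    have "openin ?T (topspace ?T - fst ` K i m)" using closed[OF that] by blast
    then have "topspace ?T - fst ` K i m \<in> sets (Zp_haar p ?I)" unfolding haar by blast
    then have "space (Zp_haar p ?I) - (topspace ?T - fst ` K i m) \<in> sets (Zp_haar p ?I)" by blast
    moreover have "fst ` K i m \<subseteq> topspace ?T" using closed[OF that] closedin_subset by blast
    ultimately show ?thesis unfolding haar(1) by (simp add: double_diff)
  qed
  then have "(\<Union>i\<in>?J. \<Union>m. fst ` K i m) \<in> sets (Zp_haar p ?I)"
    by (intro sets.finite_UN sets.countable_UN) auto
  also have "(\<Union>i\<in>?J. \<Union>m. fst ` K i m) = {c \<in> quadratic_forms p n. isotropic p n c}"
  proof -
    have nz: "x \<noteq> (\<lambda>i\<in>?J. \<zero>\<^bsub>Zp p\<^esub>) \<longleftrightarrow> (\<exists>i\<in>?J. \<exists>m. x i m \<noteq> 0)" if "x \<in> ?J \<rightarrow>\<^sub>E carrier (Zp p)" for x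
    proof -
      have "x = (\<lambda>i\<in>?J. \<zero>\<^bsub>Zp p\<^esub>) \<longleftrightarrow> (\<forall>i\<in>?J. x i = (\<lambda>_. 0))"
      proof
        assume "\<forall>i\<in>?J. x i = (\<lambda>_. 0)"
        then show "x = (\<lambda>i\<in>?J. \<zero>\<^bsub>Zp p\<^esub>)"
          using that by (intro ext) (auto simp: PiE_iff extensional_def)
      next
        assume "x = (\<lambda>i\<in>?J. \<zero>\<^bsub>Zp p\<^esub>)"
        then show "\<forall>i\<in>?J. x i = (\<lambda>_. 0)" by simp
      qed
      then show ?thesis by (auto simp: fun_eq_iff)
    qed
    have ev: "form_eval p n c x = \<zero>\<^bsub>Zp p\<^esub> \<longleftrightarrow> (\<forall>k. E k (c, x) mod int p ^ k = 0)"
      if "c \<in> quadratic_forms p n" "x \<in> ?J \<rightarrow>\<^sub>E carrier (Zp p)" for c x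
      unfolding form_eval_eq[OF p that] by (simp add: E_def fun_eq_iff case_prod_unfold)
    have "c \<in> (\<Union>i\<in>?J. \<Union>m. fst ` K i m) \<longleftrightarrow> c \<in> {c \<in> quadratic_forms p n. isotropic p n c}" for c
    proof
      assume "c \<in> (\<Union>i\<in>?J. \<Union>m. fst ` K i m)"
      then obtain i m x where "i \<in> ?J" "(c, x) \<in> K i m" by auto
      then have "i \<in> ?J" "c \<in> quadratic_forms p n" "x \<in> ?J \<rightarrow>\<^sub>E carrier (Zp p)" "x i m \<noteq> 0"
        "\<forall>k. E k (c, x) mod int p ^ k = 0"
        by (auto simp: K_def quadratic_forms_def)
      then show "c \<in> {c \<in> quadratic_forms p n. isotropic p n c}"
        using nz ev unfolding isotropic_def by blast
    next
      assume "c \<in> {c \<in> quadratic_forms p n. isotropic p n c}"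
      then obtain x where x: "c \<in> quadratic_forms p n" "x \<in> ?J \<rightarrow>\<^sub>E carrier (Zp p)"
        "x \<noteq> (\<lambda>i\<in>?J. \<zero>\<^bsub>Zp p\<^esub>)" "form_eval p n c x = \<zero>\<^bsub>Zp p\<^esub>"
        unfolding isotropic_def by blast
      then obtain i m where im: "i \<in> ?J" "x i m \<noteq> 0" using nz by blast
      have "(c, x) \<in> K i m"
        using x im ev by (auto simp: K_def quadratic_forms_def)
      then show "c \<in> (\<Union>i\<in>?J. \<Union>m. fst ` K i m)" using im by force
    qed
    then show ?thesis by blast
  qed
  finally show ?thesis .
qed

end

theory Submission
  imports Defs "HOL-Number_Theory.Cong"
begin

text \<open>
  Reduce the form modulo \<open>p\<close>. By Hensel's lemma a smooth zero of the reduction lifts, so only forms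
  whose reduction is an anisotropic form in at most two variables matter, after a unimodular change of
  variables. All zeros are then divisible by \<open>p\<close> in these variables \<open>V\<close>; rescaling them and dividing
  the form by \<open>p\<close> makes the form on the remaining variables uniformly distributed again, while the
  anisotropic block survives as \<open>p\<close> times an anisotropic form. Iterating, the probability that a form
  is anisotropic depends only on the sizes of two anisotropic blocks \<open>U\<close> and \<open>V\<close> and of the rest, and it
  satisfies a finite linear system. The reduction is exposed one variable \<open>w\<close> at a time: \<open>W\<close> contains
  the variables not yet exposed and \<open>R\<close> those found in the radical. If \<open>|V| = s\<close>, then among the
  \<open>p ^ (s + 1)\<close> extensions of the block to \<open>w\<close> exactly \<open>p ^ s\<close> are degenerate, and the share of
  anisotropic ones is \<open>1 - 1/p\<close>, \<open>(p - 1)/(2p)\<close>, \<open>0\<close> for \<open>s = 0, 1, 2\<close>. These numbers do not distinguish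
  \<open>p = 2\<close>. With at least five variables the recursion never terminates in an anisotropic form.

  Everything is done with integer coefficients modulo \<open>p ^ k\<close>; anisotropy over the \<open>p\<close>-adic integers is
  the absence of primitive zeros modulo some \<open>p ^ k\<close>.
\<close>

section \<open>Quadratic forms with integer coefficients\<close>

text \<open>The recursion can return to a state that it has left: if every exposed variable is
  degenerate, all of \<open>W\<close> ends up in \<open>R\<close>, and rescaling merely swaps the
  blocks. Induction on the number of variables therefore cannot compute the values; they are
  identified as the only bounded solution of the system, since each variable that goes to
  \<open>R\<close> costs a factor of at least \<open>p\<close>.

  Rescaling divides the form by \<open>p\<close> and so consumes one digit: precision
  \<open>k + 1\<close> on one side corresponds to precision \<open>k\<close> on the other. Hence the
  recursion closes up only for the limits of the proportions as \<open>k\<close> grows.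

  Two blocks occur because \<open>V\<close> turns into \<open>p\<close> times an anisotropic form
  and must then be known modulo \<open>p^2\<close>, while the old \<open>U\<close>, divided by
  \<open>p\<close>, takes its place and can be extended again. Each has at most two variables, the
  maximum for an anisotropic form over the residue field.

  At finite precision every change of variables is a map between finite boxes of residues, injective
  or with fibres of constant size, so counting suffices; Haar measure enters only when the initial
  limit is identified.\<close>

definition upairs :: "nat set \<Rightarrow> (nat \<times> nat) set" where
  "upairs I = {(i, j). i \<in> I \<and> j \<in> I \<and> i \<le> j}"

definition qf :: "nat set \<Rightarrow> (nat \<times> nat \<Rightarrow> int) \<Rightarrow> (nat \<Rightarrow> int) \<Rightarrow> int" where
  "qf I c x = (\<Sum>(i, j)\<in>upairs I. c (i, j) * x i * x j)"

text \<open>The bilinear form \<open>Q(x + y) - Q(x) - Q(y)\<close>, not halved, so that it also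
  serves for \<open>p = 2\<close>; on the diagonal it is \<open>2 * Q(x)\<close>.\<close>

definition polar :: "nat set \<Rightarrow> (nat \<times> nat \<Rightarrow> int) \<Rightarrow> (nat \<Rightarrow> int) \<Rightarrow> (nat \<Rightarrow> int) \<Rightarrow> int" where
  "polar I c x y = (\<Sum>(i, j)\<in>upairs I. c (i, j) * (x i * y j + y i * x j))"

definition unit_vec :: "nat \<Rightarrow> nat \<Rightarrow> int" where
  "unit_vec i = (\<lambda>k. if k = i then 1 else 0)"

text \<open>Coefficients are indexed by pairs with the smaller index first. The row of a newly
  exposed variable \<open>w\<close> mixes smaller and larger indices; \<open>upair w\<close>
  addresses it uniformly.\<close>

definition upair :: "nat \<Rightarrow> nat \<Rightarrow> nat \<times> nat" where
  "upair w i = (min i w, max i w)"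

lemma finite_upairs [simp]: "finite I \<Longrightarrow> finite (upairs I)"
  by (rule finite_subset[of _ "I \<times> I"]) (auto simp: upairs_def)

lemma upairs_mono: "A \<subseteq> B \<Longrightarrow> upairs A \<subseteq> upairs B"
  by (auto simp: upairs_def)

lemma form_index_upairs: "form_index n = upairs {1..n}"
  by (auto simp: form_index_def upairs_def)

lemma upairs_empty [simp]: "upairs {} = {}"
  by (simp add: upairs_def)

lemma upair_commute: "upair w i = upair i w"
  by (auto simp: upair_def)

lemma inj_upair: "inj (upair w)"
  by (auto simp: inj_on_def upair_def min_def max_def split: if_splits)

lemma upairs_insert: "upairs (insert w A) = upairs A \<union> upair w ` insert w A"
proof (intro equalityI subsetI)
  fix ij assume "ij \<in> upairs (insert w A)"
  then obtain i j where ij: "ij = (i, j)" "i \<in> insert w A" "j \<in> insert w A" "i \<le> j"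
    by (auto simp: upairs_def)
  have "ij = upair w j \<or> ij = upair w i \<or> ij \<in> upairs A"
    using ij by (auto simp: upairs_def upair_def)
  then show "ij \<in> upairs A \<union> upair w ` insert w A" using ij by blast
qed (auto simp: upairs_def upair_def min_def max_def split: if_splits)

lemma upair_in_upairs_iff: "upair w i \<in> upairs A \<longleftrightarrow> w \<in> A \<and> i \<in> A"
  by (auto simp: upairs_def upair_def min_def max_def split: if_splits)

lemma upair_in_image_iff: "upair w i \<in> upair w ` A \<longleftrightarrow> i \<in> A"
  using inj_upair by (auto simp: inj_on_def)

lemma qf_empty [simp]: "qf {} c x = 0"
  by (simp add: qf_def)

lemma qf_insert:
  assumes "finite A" "w \<notin> A"
  shows "qf (insert w A) c x = qf A c x + c (upair w w) * x w ^ 2 + (\<Sum>i\<in>A. c (upair w i) * x w * x i)"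
proof -
  have "qf (insert w A) c x = qf A c x + (\<Sum>(i, j)\<in>upair w ` insert w A. c (i, j) * x i * x j)"
    unfolding qf_def upairs_insert using assms
    by (intro sum.union_disjoint) (auto simp: upair_in_upairs_iff inj_eq[OF inj_upair])
  also have "(\<Sum>(i, j)\<in>upair w ` insert w A. c (i, j) * x i * x j) = (\<Sum>i\<in>insert w A. c (upair w i) * x w * x i)"
    using inj_on_subset[OF inj_upair[of w]]
    by (subst sum.reindex) (auto simp: upair_def min_def max_def intro!: sum.cong split: if_splits)
  also have "\<dots> = c (upair w w) * x w ^ 2 + (\<Sum>i\<in>A. c (upair w i) * x w * x i)"
    using assms by (simp add: power2_eq_square mult.assoc)
  finally show ?thesis by simp
qed

lemma polar_insert:
  assumes "finite A" "w \<notin> A"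
  shows "polar (insert w A) c x y =
    polar A c x y + 2 * c (upair w w) * x w * y w + (\<Sum>i\<in>A. c (upair w i) * (x w * y i + y w * x i))"
proof -
  have "polar (insert w A) c x y =
      polar A c x y + (\<Sum>(i, j)\<in>upair w ` insert w A. c (i, j) * (x i * y j + y i * x j))"
    unfolding polar_def upairs_insert using assms
    by (intro sum.union_disjoint) (auto simp: upair_in_upairs_iff inj_eq[OF inj_upair])
  also have "(\<Sum>(i, j)\<in>upair w ` insert w A. c (i, j) * (x i * y j + y i * x j)) =
      (\<Sum>i\<in>insert w A. c (upair w i) * (x w * y i + y w * x i))"
    using inj_on_subset[OF inj_upair[of w]]
    by (subst sum.reindex) (auto simp: upair_def min_def max_def algebra_simps intro!: sum.cong split: if_splits)
  also have "\<dots> = 2 * c (upair w w) * x w * y w + (\<Sum>i\<in>A. c (upair w i) * (x w * y i + y w * x i))"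
    using assms by (simp add: algebra_simps)
  finally show ?thesis by simp
qed

lemma qf_line: "qf I c (\<lambda>i. x i + t * y i) = qf I c x + t * polar I c x y + t\<^sup>2 * qf I c y"
  unfolding qf_def polar_def
  by (simp add: sum_distrib_left case_prod_unfold power2_eq_square algebra_simps flip: sum.distrib)

lemma qf_scale: "qf I c (\<lambda>i. t * y i) = t\<^sup>2 * qf I c y"
  unfolding qf_def by (simp add: sum_distrib_left case_prod_unfold power2_eq_square algebra_simps)

lemma qf_cong_args:
  assumes "\<And>i. i \<in> I \<Longrightarrow> x i = y i"
  shows "qf I c x = qf I c y"
  unfolding qf_def using assms by (intro sum.cong) (auto simp: upairs_def)

lemma qf_cong_mod:
  assumes "\<And>ij. ij \<in> upairs I \<Longrightarrow> [c ij = d ij] (mod m)" "\<And>i. i \<in> I \<Longrightarrow> [x i = y i] (mod m)"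
  shows "[qf I c x = qf I d y] (mod m)"
  unfolding qf_def using assms by (intro cong_sum) (auto simp: upairs_def intro!: cong_mult)

lemma polar_cong_mod:
  assumes "\<And>ij. ij \<in> upairs I \<Longrightarrow> [c ij = d ij] (mod m)"
    "\<And>i. i \<in> I \<Longrightarrow> [x i = x' i] (mod m)" "\<And>i. i \<in> I \<Longrightarrow> [y i = y' i] (mod m)"
  shows "[polar I c x y = polar I d x' y'] (mod m)"
  unfolding polar_def using assms by (intro cong_sum) (auto simp: upairs_def intro!: cong_mult cong_add)

lemma polar_commute: "polar I c x y = polar I c y x"
  unfolding polar_def by (simp add: add.commute)

lemma polar_lin: "polar I c (\<lambda>i. x i + t * x' i) y = polar I c x y + t * polar I c x' y"
  unfolding polar_def by (simp add: sum_distrib_left case_prod_unfold algebra_simps flip: sum.distrib)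

lemma polar_unit_vec_sum:
  assumes "finite I"
  shows "polar I c x y = (\<Sum>k\<in>I. x k * polar I c (unit_vec k) y)"
proof -
  have "(\<Sum>k\<in>I. x k * polar I c (unit_vec k) y) =
     (\<Sum>(i, j)\<in>upairs I. c (i, j) * ((\<Sum>k\<in>I. x k * unit_vec k i) * y j + y i * (\<Sum>k\<in>I. x k * unit_vec k j)))"
    unfolding polar_def sum_distrib_left
    by (subst sum.swap) (simp add: case_prod_unfold sum_distrib_left sum_distrib_right algebra_simps sum.distrib)
  also have "\<dots> = polar I c x y"
    unfolding polar_def using assms
    by (intro sum.cong) (auto simp: upairs_def unit_vec_def if_distrib[of "(*) _"] cong: if_cong)
  finally show ?thesis ..
qed

lemma qf_supported:
  assumes "finite I" "A \<subseteq> I" "\<And>i. i \<in> I - A \<Longrightarrow> x i = 0"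
  shows "qf I c x = qf A c x"
  unfolding qf_def
proof (rule sum.mono_neutral_right)
  show "\<forall>ij\<in>upairs I - upairs A. (case ij of (i, j) \<Rightarrow> c (i, j) * x i * x j) = 0"
    using assms(3) by (force simp: upairs_def)
qed (use assms upairs_mono in auto)

lemma polar_supported:
  assumes "finite I" "A \<subseteq> I" "\<And>i. i \<in> I - A \<Longrightarrow> x i = 0" "\<And>i. i \<in> I - A \<Longrightarrow> y i = 0"
  shows "polar I c x y = polar A c x y"
  unfolding polar_def
proof (rule sum.mono_neutral_right)
  show "\<forall>ij\<in>upairs I - upairs A. (case ij of (i, j) \<Rightarrow> c (i, j) * (x i * y j + y i * x j)) = 0"
    using assms(3,4) by (force simp: upairs_def)
qed (use assms upairs_mono in auto)

lemma qf_unit_vec: "finite I \<Longrightarrow> i \<in> I \<Longrightarrow> qf I c (unit_vec i) = c (i, i)"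
  by (subst qf_supported[of _ "{i}"]) (auto simp: unit_vec_def qf_insert upair_def)

lemma polar_unit_vecs:
  assumes "finite I" "i \<in> I" "w \<in> I" "i \<noteq> w"
  shows "polar I c (unit_vec w) (unit_vec i) = c (upair w i)"
proof -
  have "polar I c (unit_vec w) (unit_vec i) = polar {w, i} c (unit_vec w) (unit_vec i)"
    using assms by (intro polar_supported) (auto simp: unit_vec_def)
  also have "\<dots> = c (upair w i)"
    using assms by (simp add: polar_insert unit_vec_def) (simp add: polar_def)
  finally show ?thesis .
qed

text \<open>The values at \<open>e_i\<close> and \<open>e_i + e_j\<close> recover the coefficients.
  Substitutions can thus be compared through values, without formulas for the transformed
  coefficients.\<close>

lemma coeffs_cong_of_qf_cong:
  assumes "finite I" "\<And>x. [qf I c x = qf I d x] (mod m)" "ij \<in> upairs I"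
  shows "[c ij = d ij] (mod m)"
proof -
  obtain i j where ij: "ij = (i, j)" "i \<in> I" "j \<in> I" "i \<le> j" using assms(3) by (auto simp: upairs_def)
  show ?thesis
  proof (cases "i = j")
    case True
    then show ?thesis using assms(2)[of "unit_vec i"] ij by (simp add: qf_unit_vec assms)
  next
    case False
    \<comment> \<open>The factor 1 matches \<open>qf_line\<close> with \<open>t = 1\<close>; what
      remains is the polar form of two unit vectors.\<close>
    have *: "c ij = qf I c (\<lambda>k. unit_vec j k + 1 * unit_vec i k) - qf I c (unit_vec j) - qf I c (unit_vec i)" for c
      using ij False polar_unit_vecs[of I i j c] assms(1) unfolding qf_line by (auto simp: upair_def)
    show ?thesis unfolding * by (intro cong_diff assms)
  qed
qed

text \<open>The negation of \<open>aniso_mod p k I c\<close> says that there is a primitive zero modulo \<open>p ^ k\<close>.\<close>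

definition aniso_mod :: "nat \<Rightarrow> nat \<Rightarrow> nat set \<Rightarrow> (nat \<times> nat \<Rightarrow> int) \<Rightarrow> bool" where
  "aniso_mod p k I c \<longleftrightarrow> (\<forall>x. int p ^ k dvd qf I c x \<longrightarrow> (\<forall>i\<in>I. int p dvd x i))"

lemma aniso_mod_mono: "aniso_mod p k I c \<Longrightarrow> k \<le> l \<Longrightarrow> aniso_mod p l I c"
  unfolding aniso_mod_def by (meson dvd_trans le_imp_power_dvd)

lemma aniso_mod_cong:
  assumes "\<And>ij. ij \<in> upairs I \<Longrightarrow> [c ij = d ij] (mod int p ^ k)"
  shows "aniso_mod p k I c \<longleftrightarrow> aniso_mod p k I d"
  unfolding aniso_mod_def using cong_dvd_iff[OF qf_cong_mod[OF assms cong_refl]] by simp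

section \<open>Hensel lifting of smooth zeros\<close>

lemma hensel_quadratic:
  fixes a b g :: int
  assumes "prime p" "int p dvd a" "\<not> int p dvd b"
  shows "\<exists>t. int p dvd t \<and> int p ^ k dvd a + t * b + t\<^sup>2 * g"
proof (induction k)
  case 0
  then show ?case by (intro exI[of _ 0]) auto
next
  case (Suc k)
  then obtain t where t: "int p dvd t" "int p ^ k dvd a + t * b + t\<^sup>2 * g" by blast
  show ?case
  proof (cases "k = 0")
    case True
    then show ?thesis using assms(2) by (intro exI[of _ 0]) auto
  next
    case False
    obtain s where s: "a + t * b + t\<^sup>2 * g = int p ^ k * s" using t(2) by blast
    \<comment> \<open>The derivative at \<open>t\<close> stays a unit because \<open>p\<close>
      divides \<open>t\<close>, so the linearized equation for a correction \<open>p^k * v\<close>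
      is solvable modulo \<open>p\<close>. The quadratic error carries \<open>p^(2k)\<close>, which
      gains a digit only for \<open>k > 0\<close>.\<close>
    have "\<not> int p dvd b + 2 * t * g" using assms(3) t(1) by (simp add: dvd_add_left_iff)
    then have "coprime (b + 2 * t * g) (int p)"
      using assms(1) by (simp add: coprime_commute prime_imp_coprime)
    then obtain u where "[(b + 2 * t * g) * u = 1] (mod int p)"
      using cong_solve_coprime_int by blast
    then obtain v where v: "[(b + 2 * t * g) * v = - s] (mod int p)"
      using cong_scalar_right[of _ 1 "int p" "- s"] by (metis mult.assoc mult_1)
    have "a + (t + int p ^ k * v) * b + (t + int p ^ k * v)\<^sup>2 * g =
        int p ^ k * (s + (b + 2 * t * g) * v + int p ^ k * v\<^sup>2 * g)"
      using s by (simp add: power2_eq_square algebra_simps)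
    moreover have "int p dvd s + (b + 2 * t * g) * v + int p ^ k * v\<^sup>2 * g"
    proof -
      have "int p dvd (b + 2 * t * g) * v - (- s)" using v by (simp add: cong_iff_dvd_diff)
      moreover have "int p dvd int p ^ k * v\<^sup>2 * g" using False by (simp add: dvd_power)
      ultimately show ?thesis
        using dvd_add[of "int p" "(b + 2 * t * g) * v - (- s)" "int p ^ k * v\<^sup>2 * g"] by (simp add: algebra_simps)
    qed
    ultimately have "int p ^ Suc k dvd a + (t + int p ^ k * v) * b + (t + int p ^ k * v)\<^sup>2 * g"
      by (simp add: mult.commute[of "int p"] mult_dvd_mono)
    moreover have "int p dvd t + int p ^ k * v" using t(1) False by (simp add: dvd_power)
    ultimately show ?thesis by blast
  qed
qed

text \<open>On the line \<open>x + t * y\<close> the form is a quadratic polynomial in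
  \<open>t\<close> whose linear coefficient is a unit, so Hensel's lemma finds a root
  \<open>t\<close> divisible by \<open>p\<close>. The resulting zero is congruent to
  \<open>x\<close>, which is primitive because its polar form with \<open>y\<close> does not vanish
  modulo \<open>p\<close>.\<close>

lemma smooth_zero_not_aniso:
  assumes "prime p" "finite I" "int p dvd qf I c x" "\<not> int p dvd polar I c x y"
  shows "\<not> aniso_mod p k I c"
proof -
  obtain t where t: "int p dvd t" "int p ^ k dvd qf I c x + t * polar I c x y + t\<^sup>2 * qf I c y"
    using hensel_quadratic assms by metis
  have "\<exists>i\<in>I. \<not> int p dvd x i"
  proof (rule ccontr)
    assume "\<not> ?thesis"
    then have "[polar I c x y = polar I c (\<lambda>_. 0) y] (mod int p)"
      by (intro polar_cong_mod) (auto simp: cong_0_iff)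
    then show False using assms(4) by (simp add: polar_def cong_0_iff)
  qed
  then show ?thesis
    using t unfolding aniso_mod_def by (metis qf_line dvd_add_left_iff dvd_mult2)
qed

section \<open>Proportions of anisotropic forms modulo prime powers\<close>

text \<open>Finite model of a p-adic integer whose residue modulo \<open>p^e\<close> is known, seen
  to precision \<open>k\<close>; \<open>e = 0\<close> leaves it free.\<close>

definition res_class :: "nat \<Rightarrow> nat \<Rightarrow> int \<Rightarrow> nat \<Rightarrow> int set" where
  "res_class p k b e = {y \<in> {0..<int p ^ k}. [y = b] (mod int p ^ e)}"

lemma res_class_cong: "[b = b'] (mod int p ^ e) \<Longrightarrow> res_class p k b e = res_class p k b' e"
  unfolding res_class_def by (auto intro: cong_trans cong_sym)

lemma finite_res_class [simp]: "finite (res_class p k b e)"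
  by (rule finite_subset[of _ "{0..<int p ^ k}"]) (auto simp: res_class_def)

lemma res_class_0: "res_class p k b 0 = {0..<int p ^ k}"
  by (auto simp: res_class_def)

lemma mod_in_res_class: "p > 0 \<Longrightarrow> e \<le> k \<Longrightarrow> [y = b] (mod int p ^ e) \<Longrightarrow> y mod int p ^ k \<in> res_class p k b e"
  by (simp add: res_class_def cong_def mod_mod_cancel le_imp_power_dvd)

lemma card_res_class:
  assumes "p > 0" "e \<le> k"
  shows "card (res_class p k b e) = p ^ (k - e)"
proof -
  let ?b = "b mod int p ^ e" and ?P = "int p ^ e"
  have P: "?P > 0" using assms by simp
  have k: "int p ^ k = ?P * int p ^ (k - e)" using assms by (simp flip: power_add)
  have b: "0 \<le> ?b" "?b < ?P" using P by auto
  have "bij_betw (\<lambda>t. ?b + ?P * t) {0..<int p ^ (k - e)} (res_class p k b e)"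
  proof (intro bij_betw_imageI equalityI subsetI)
    fix y assume "y \<in> (\<lambda>t. ?b + ?P * t) ` {0..<int p ^ (k - e)}"
    then obtain t where t: "0 \<le> t" "t < int p ^ (k - e)" "y = ?b + ?P * t" by auto
    have "?P * (t + 1) \<le> int p ^ k" unfolding k using t P by (intro mult_left_mono) auto
    then have "y < int p ^ k" using b t(3) by (simp add: algebra_simps)
    moreover have "0 \<le> y" using b t P by simp
    ultimately show "y \<in> res_class p k b e" unfolding res_class_def t(3) by (simp add: cong_def)
  next
    fix y assume "y \<in> res_class p k b e"
    then have y: "0 \<le> y" "y < int p ^ k" "y mod ?P = ?b" by (auto simp: res_class_def cong_def)
    have "y = ?b + ?P * (y div ?P)" using y(3) by (metis mod_mult_div_eq)
    moreover have "y div ?P < int p ^ (k - e)"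
    proof (rule ccontr)
      assume "\<not> ?thesis"
      then have "int p ^ k \<le> ?P * (y div ?P)" unfolding k using P by (intro mult_left_mono) auto
      also have "\<dots> \<le> y" using P y by (simp add: minus_mod_eq_mult_div [symmetric])
      finally show False using y by simp
    qed
    moreover have "0 \<le> y div ?P" using P y by (simp add: pos_imp_zdiv_nonneg_iff)
    ultimately show "y \<in> (\<lambda>t. ?b + ?P * t) ` {0..<int p ^ (k - e)}" by auto
  qed (use P in \<open>auto simp: inj_on_def\<close>)
  then have "card (res_class p k b e) = card {0..<int p ^ (k - e)}" by (metis bij_betw_same_card)
  then show ?thesis by (simp add: nat_power_eq)
qed

definition coeff_box ::
    "nat \<Rightarrow> nat \<Rightarrow> nat set \<Rightarrow> (nat \<times> nat \<Rightarrow> int) \<Rightarrow> (nat \<times> nat \<Rightarrow> nat) \<Rightarrow> (nat \<times> nat \<Rightarrow> int) set" where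
  "coeff_box p k I b e = (\<Pi>\<^sub>E ij\<in>upairs I. res_class p k (b ij) (e ij))"

definition aniso_frac ::
    "nat \<Rightarrow> nat \<Rightarrow> nat set \<Rightarrow> (nat \<times> nat \<Rightarrow> int) \<Rightarrow> (nat \<times> nat \<Rightarrow> nat) \<Rightarrow> real" where
  "aniso_frac p k I b e =
     card {c \<in> coeff_box p k I b e. aniso_mod p k I c} / card (coeff_box p k I b e)"

lemma finite_coeff_box [simp]: "finite I \<Longrightarrow> finite (coeff_box p k I b e)"
  by (simp add: coeff_box_def finite_PiE)

lemma card_coeff_box:
  assumes "p > 0" "finite I" "\<And>ij. ij \<in> upairs I \<Longrightarrow> e ij \<le> k"
  shows "card (coeff_box p k I b e) = (\<Prod>ij\<in>upairs I. p ^ (k - e ij))"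
  unfolding coeff_box_def using assms by (simp add: card_PiE card_res_class)

lemma card_coeff_box_pos:
  assumes "p > 0" "finite I" "\<And>ij. ij \<in> upairs I \<Longrightarrow> e ij \<le> k"
  shows "card (coeff_box p k I b e) > 0"
  using assms by (simp add: card_coeff_box)

lemma coeff_boxD:
  assumes "c \<in> coeff_box p k I b e" "ij \<in> upairs I"
  shows "[c ij = b ij] (mod int p ^ e ij)"
  using PiE_mem[of c "upairs I" "\<lambda>ij. res_class p k (b ij) (e ij)" ij] assms
  by (auto simp: coeff_box_def res_class_def)

lemma coeff_box_cong:
  assumes "\<And>ij. ij \<in> upairs I \<Longrightarrow> e ij = e' ij"
    "\<And>ij. ij \<in> upairs I \<Longrightarrow> [b ij = b' ij] (mod int p ^ e' ij)"
  shows "coeff_box p k I b e = coeff_box p k I b' e'"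
  unfolding coeff_box_def using assms res_class_cong by (intro PiE_cong) auto

lemma aniso_frac_cong:
  assumes "\<And>ij. ij \<in> upairs I \<Longrightarrow> e ij = e' ij"
    "\<And>ij. ij \<in> upairs I \<Longrightarrow> [b ij = b' ij] (mod int p ^ e' ij)"
  shows "aniso_frac p k I b e = aniso_frac p k I b' e'"
  unfolding aniso_frac_def using coeff_box_cong[OF assms] by simp

lemma aniso_frac_nonneg: "0 \<le> aniso_frac p k I b e"
  by (simp add: aniso_frac_def)

lemma aniso_frac_le_1: "finite I \<Longrightarrow> aniso_frac p k I b e \<le> 1"
  unfolding aniso_frac_def by (simp add: divide_le_eq_1 card_mono card_gt_0_iff)

lemma aniso_frac_eq_0:
  assumes "\<And>c. c \<in> coeff_box p k I b e \<Longrightarrow> \<not> aniso_mod p k I c"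
  shows "aniso_frac p k I b e = 0"
proof -
  have "{c \<in> coeff_box p k I b e. aniso_mod p k I c} = {}" using assms by blast
  then show ?thesis unfolding aniso_frac_def by (simp only: card.empty of_nat_0 div_0)
qed

lemma aniso_frac_eq_1:
  assumes "p > 0" "finite I" "\<And>ij. ij \<in> upairs I \<Longrightarrow> e ij \<le> k"
    and "\<And>c. c \<in> coeff_box p k I b e \<Longrightarrow> aniso_mod p k I c"
  shows "aniso_frac p k I b e = 1"
proof -
  have "{c \<in> coeff_box p k I b e. aniso_mod p k I c} = coeff_box p k I b e" using assms by blast
  moreover have "card (coeff_box p k I b e) > 0" by (rule card_coeff_box_pos) fact+
  ultimately show ?thesis unfolding aniso_frac_def by (simp only:) simp
qed

text \<open>Boxes with the same exponents have the same size, so injectivity already makes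
  \<open>\<phi>\<close> a bijection. This spares an explicit inverse for substitutions acting on
  coefficients.\<close>

lemma aniso_frac_transfer:
  assumes "p > 0" "finite I" "\<And>ij. ij \<in> upairs I \<Longrightarrow> e ij \<le> k"
    and \<phi>: "\<And>c. c \<in> coeff_box p k I b e \<Longrightarrow> \<phi> c \<in> coeff_box p k I b' e"
      "inj_on \<phi> (coeff_box p k I b e)"
      "\<And>c. c \<in> coeff_box p k I b e \<Longrightarrow> aniso_mod p k I (\<phi> c) \<longleftrightarrow> aniso_mod p k I c"
  shows "aniso_frac p k I b e = aniso_frac p k I b' e"
proof -
  have card: "card (coeff_box p k I b e) = card (coeff_box p k I b' e)"
    using assms by (simp add: card_coeff_box)
  have im: "\<phi> ` coeff_box p k I b e = coeff_box p k I b' e"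
    using assms card by (intro card_subset_eq) (auto simp: card_image)
  have "{c \<in> coeff_box p k I b' e. aniso_mod p k I c} = \<phi> ` {c \<in> coeff_box p k I b e. aniso_mod p k I c}"
    using \<phi>(3) by (auto simp flip: im)
  moreover have "inj_on \<phi> {c \<in> coeff_box p k I b e. aniso_mod p k I c}"
    using \<phi>(2) by (rule inj_on_subset) auto
  ultimately show ?thesis by (simp add: aniso_frac_def card card_image)
qed

text \<open>A coordinatewise map whose fibres have constant size in each coordinate pushes the
  uniform distribution to the uniform distribution. Both lowering the precision and rescaling have
  this form.\<close>

lemma frac_fibers:
  fixes A :: "'i \<Rightarrow> 'a set" and B :: "'i \<Rightarrow> 'b set"
  assumes J: "finite J" and A: "\<And>j. j \<in> J \<Longrightarrow> finite (A j)" and B: "\<And>j. j \<in> J \<Longrightarrow> finite (B j)"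
    and h: "\<And>j x. j \<in> J \<Longrightarrow> x \<in> A j \<Longrightarrow> h j x \<in> B j"
    and m: "\<And>j y. j \<in> J \<Longrightarrow> y \<in> B j \<Longrightarrow> card {x \<in> A j. h j x = y} = m j" "\<And>j. j \<in> J \<Longrightarrow> m j > 0"
    and P: "\<And>c. c \<in> PiE J A \<Longrightarrow> P c \<longleftrightarrow> P' (\<lambda>j\<in>J. h j (c j))"
  shows "real (card {c \<in> PiE J A. P c}) / card (PiE J A) = real (card {c \<in> PiE J B. P' c}) / card (PiE J B)"
proof -
  define H where "H = (\<lambda>c. \<lambda>j\<in>J. h j (c j))"
  have fib: "card {c \<in> PiE J A. H c = d} = (\<Prod>j\<in>J. m j)" if "d \<in> PiE J B" for d
  proof -
    have "H c = d \<longleftrightarrow> (\<forall>j\<in>J. h j (c j) = d j)" for c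
      using that unfolding H_def by (auto simp: PiE_iff extensional_def fun_eq_iff)
    then have "{c \<in> PiE J A. H c = d} = (\<Pi>\<^sub>E j\<in>J. {x \<in> A j. h j x = d j})"
      by (auto simp: PiE_iff extensional_def)
    then show ?thesis using that m J by (simp add: card_PiE PiE_iff)
  qed
  have fin: "finite (PiE J A)" "finite (PiE J B)" using J A B by (auto intro: finite_PiE)
  have *: "card {c \<in> PiE J A. Q (H c)} = card {d \<in> PiE J B. Q d} * (\<Prod>j\<in>J. m j)" for Q
  proof -
    have "{c \<in> PiE J A. Q (H c)} = (\<Union>d\<in>{d \<in> PiE J B. Q d}. {c \<in> PiE J A. H c = d})"
      using h by (auto simp: H_def intro!: h dest: PiE_mem)
    then have "card {c \<in> PiE J A. Q (H c)} = (\<Sum>d\<in>{d \<in> PiE J B. Q d}. card {c \<in> PiE J A. H c = d})"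
      using fin by (simp only:) (intro card_UN_disjoint, auto)
    then show ?thesis using fib by simp
  qed
  have "{c \<in> PiE J A. P c} = {c \<in> PiE J A. P' (H c)}" using P unfolding H_def by blast
  then have 1: "card {c \<in> PiE J A. P c} = card {d \<in> PiE J B. P' d} * (\<Prod>j\<in>J. m j)"
    using *[of P'] by simp
  have 2: "card (PiE J A) = card (PiE J B) * (\<Prod>j\<in>J. m j)"
    using *[of "\<lambda>_. True"] by simp
  have "(\<Prod>j\<in>J. m j) > 0" using m(2) by (intro prod_pos) auto
  then show ?thesis
    unfolding 1 2 of_nat_mult by (simp del: of_nat_prod)
qed

text \<open>Law of total probability over the residues \<open>z\<close> modulo \<open>p\<close> of
  the free coefficients in \<open>J\<close>. The classes are equally likely because the size of a
  box depends only on its exponents.\<close>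

lemma aniso_frac_split:
  assumes p: "p > 0" and I: "finite I" and k: "k \<ge> 1" "\<And>ij. ij \<in> upairs I \<Longrightarrow> e ij \<le> k"
    and J: "J \<subseteq> upairs I" "\<And>ij. ij \<in> J \<Longrightarrow> e ij = 0"
  shows "aniso_frac p k I b e =
    (\<Sum>z\<in>J \<rightarrow>\<^sub>E {0..<int p}. aniso_frac p k I (\<lambda>ij. if ij \<in> J then z ij else b ij)
       (\<lambda>ij. if ij \<in> J then 1 else e ij)) / real p ^ card J"
proof -
  let ?Z = "J \<rightarrow>\<^sub>E {0..<int p}"
  let ?e = "\<lambda>ij. if ij \<in> J then 1 else e ij" and ?b = "\<lambda>z ij. if ij \<in> J then z ij else b ij"
  let ?S = "\<lambda>z. coeff_box p k I (?b z) ?e"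
  have finJ: "finite J" using J(1) I by (metis finite_subset finite_upairs)
  have finZ: "finite ?Z" using finJ by (simp add: finite_PiE)
  have split: "coeff_box p k I b e = (\<Union>z\<in>?Z. ?S z)"
  proof (intro equalityI subsetI)
    fix c assume c: "c \<in> coeff_box p k I b e"
    define z where "z = (\<lambda>ij\<in>J. c ij mod int p)"
    have "z \<in> ?Z" using p by (auto simp: z_def)
    moreover have "c \<in> ?S z"
      using c by (auto simp: coeff_box_def res_class_def PiE_iff z_def cong_def)
    ultimately show "c \<in> (\<Union>z\<in>?Z. ?S z)" by blast
  next
    fix c assume "c \<in> (\<Union>z\<in>?Z. ?S z)"
    then obtain z where z: "z \<in> ?Z" "c \<in> ?S z" by blast
    show "c \<in> coeff_box p k I b e"
      unfolding coeff_box_def PiE_iff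
    proof (intro conjI ballI)
      fix ij assume ij: "ij \<in> upairs I"
      have "c ij \<in> res_class p k (?b z ij) (?e ij)" using PiE_mem[OF z(2)[unfolded coeff_box_def] ij] .
      then show "c ij \<in> res_class p k (b ij) (e ij)" using J(2) by (auto simp: res_class_def split: if_splits)
    qed (use z in \<open>auto simp: coeff_box_def PiE_iff\<close>)
  qed
  have disj: "?S z \<inter> ?S z' = {}" if z: "z \<in> ?Z" "z' \<in> ?Z" "z \<noteq> z'" for z z'
  proof (rule ccontr)
    assume "?S z \<inter> ?S z' \<noteq> {}"
    then obtain c where c: "c \<in> ?S z" "c \<in> ?S z'" by blast
    have "z ij = z' ij" if "ij \<in> J" for ij
    proof -
      have "[c ij = z ij] (mod int p)" "[c ij = z' ij] (mod int p)"
        using coeff_boxD[OF c(1), of ij] coeff_boxD[OF c(2), of ij] that J(1) by auto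
      then have "z ij mod int p = z' ij mod int p" by (simp add: cong_def)
      then show ?thesis using z that by (auto simp: PiE_iff)
    qed
    then show False using z by (metis PiE_ext)
  qed
  have cardS: "card (?S z) = card (?S (\<lambda>_. 0))" for z
    using k by (subst (1 2) card_coeff_box[OF p I]) auto
  have pos: "card (?S (\<lambda>_. 0)) > 0"
    using k by (intro card_coeff_box_pos[OF p I]) auto
  have cardZ: "card ?Z = p ^ card J" using finJ by (simp add: card_PiE)
  have c1: "card (coeff_box p k I b e) = p ^ card J * card (?S (\<lambda>_. 0))"
  proof -
    have "card (coeff_box p k I b e) = (\<Sum>z\<in>?Z. card (?S z))"
      unfolding split using finZ I disj by (intro card_UN_disjoint) auto
    also have "\<dots> = (\<Sum>z\<in>?Z. card (?S (\<lambda>_. 0)))" by (intro sum.cong refl cardS)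
    finally show ?thesis using cardZ by simp
  qed
  have canc: "x = x / real m * real m" if "m > 0" for x :: real and m :: nat
    using that by simp
  have "{c \<in> coeff_box p k I b e. aniso_mod p k I c} = (\<Union>z\<in>?Z. {c \<in> ?S z. aniso_mod p k I c})"
    unfolding split by blast
  also have "card \<dots> = (\<Sum>z\<in>?Z. card {c \<in> ?S z. aniso_mod p k I c})"
  proof (rule card_UN_disjoint[OF finZ]; intro ballI impI)
    show "finite {c \<in> ?S z. aniso_mod p k I c}" for z using I by simp
    show "{c \<in> ?S z. aniso_mod p k I c} \<inter> {c \<in> ?S z'. aniso_mod p k I c} = {}"
      if "z \<in> ?Z" "z' \<in> ?Z" "z \<noteq> z'" for z z'
      using disj[OF that] by blast
  qed
  finally have "real (card {c \<in> coeff_box p k I b e. aniso_mod p k I c}) =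
      (\<Sum>z\<in>?Z. real (card {c \<in> ?S z. aniso_mod p k I c}))" by (simp only: of_nat_sum)
  also have "(\<Sum>z\<in>?Z. real (card {c \<in> ?S z. aniso_mod p k I c})) =
      (\<Sum>z\<in>?Z. aniso_frac p k I (?b z) ?e * card (?S (\<lambda>_. 0)))"
  proof (intro sum.cong refl)
    fix z
    show "real (card {c \<in> ?S z. aniso_mod p k I c}) = aniso_frac p k I (?b z) ?e * card (?S (\<lambda>_. 0))"
      unfolding aniso_frac_def cardS[of z] by (rule canc) (rule pos)
  qed
  finally have eq: "real (card {c \<in> coeff_box p k I b e. aniso_mod p k I c}) =
      (\<Sum>z\<in>?Z. aniso_frac p k I (?b z) ?e) * card (?S (\<lambda>_. 0))"
    by (simp only: sum_distrib_right)
  have frac: "x * C / (P * C) = x / P" if "C \<noteq> 0" for x C P :: real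
    using that by simp
  show ?thesis
    unfolding aniso_frac_def[of p k I b e] c1 eq of_nat_mult of_nat_power
    using pos by (intro frac) (simp only: of_nat_eq_0_iff)
qed

text \<open>Reduction from precision \<open>k + 1\<close> to \<open>k\<close> has fibres of size
  \<open>p\<close> in each coordinate. The left side is therefore the share, among forms at
  precision \<open>k + 1\<close>, of those already seen to be anisotropic modulo \<open>p^k\<close>,
  and these stay anisotropic modulo \<open>p^(k+1)\<close>.\<close>

lemma aniso_frac_Suc_ge:
  assumes p: "p > 0" and I: "finite I" and k: "\<And>ij. ij \<in> upairs I \<Longrightarrow> e ij \<le> k"
  shows "aniso_frac p k I b e \<le> aniso_frac p (Suc k) I b e"
proof -
  let ?A = "\<lambda>k ij. res_class p k (b ij) (e ij)"
  have fib: "card {x \<in> ?A (Suc k) ij. x mod int p ^ k = y} = p"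
    if "ij \<in> upairs I" "y \<in> ?A k ij" for ij y
  proof -
    have y: "0 \<le> y" "y < int p ^ k" "[y = b ij] (mod int p ^ e ij)" using that by (auto simp: res_class_def)
    have "{x \<in> ?A (Suc k) ij. x mod int p ^ k = y} = res_class p (Suc k) y k"
      using y k[OF that(1)] cong_dvd_modulus[OF _ le_imp_power_dvd, of _ y "int p" k "e ij"]
      by (auto simp: res_class_def cong_def)
    then show ?thesis using card_res_class[OF p, of k "Suc k"] by simp
  qed
  have "aniso_frac p k I b e =
     real (card {c \<in> coeff_box p (Suc k) I b e. aniso_mod p k I c}) / card (coeff_box p (Suc k) I b e)"
    unfolding aniso_frac_def coeff_box_def
  proof (rule frac_fibers[symmetric, where h = "\<lambda>_ x. x mod int p ^ k" and m = "\<lambda>_. p"])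
    show "x mod int p ^ k \<in> ?A k ij" if "ij \<in> upairs I" "x \<in> ?A (Suc k) ij" for ij x
      using that k p by (intro mod_in_res_class) (auto simp: res_class_def)
    show "aniso_mod p k I c \<longleftrightarrow> aniso_mod p k I (\<lambda>ij\<in>upairs I. c ij mod int p ^ k)" for c
      by (rule aniso_mod_cong) (simp add: cong_def)
  qed (use I p fib in auto)
  also have "\<dots> \<le> aniso_frac p (Suc k) I b e"
    unfolding aniso_frac_def using I aniso_mod_mono[of p k I _ "Suc k"]
    by (intro divide_right_mono) (auto intro!: card_mono)
  finally show ?thesis .
qed

section \<open>States of the reduction\<close>

text \<open>
  In a state, the coefficients on \<open>U\<close> form \<open>p\<close> times an anisotropic form, hence are prescribed modulo
  \<open>p\<^sup>2\<close>. Those on \<open>V\<close> are prescribed modulo \<open>p\<close>. Those involving \<open>W\<close> but not \<open>U\<close> are arbitrary, and all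
  others are arbitrary multiples of \<open>p\<close>. The exponent of the prescribed modulus is \<open>type_exp\<close>.
\<close>

definition type_exp :: "nat set \<Rightarrow> nat set \<Rightarrow> nat \<times> nat \<Rightarrow> nat" where
  "type_exp U W = (\<lambda>(i, j). if i \<in> U \<and> j \<in> U then 2
     else if (i \<in> W \<or> j \<in> W) \<and> i \<notin> U \<and> j \<notin> U then 0 else 1)"

lemma type_exp_le_2: "type_exp U W ij \<le> 2"
  by (simp add: type_exp_def split: prod.split)

text \<open>The divisibility clause covers the pairs inside \<open>U\<close>. Together with
  \<open>aniso_mod p 2 U b\<close> it says that the block on \<open>U\<close>, divided by
  \<open>p\<close>, is anisotropic modulo \<open>p\<close>.\<close>

definition is_state ::
    "nat \<Rightarrow> nat set \<Rightarrow> nat set \<Rightarrow> nat set \<Rightarrow> nat set \<Rightarrow> (nat \<times> nat \<Rightarrow> int) \<Rightarrow> bool" where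
  "is_state p U V R W b \<longleftrightarrow>
     finite (U \<union> V \<union> R \<union> W) \<and>
     U \<inter> V = {} \<and> U \<inter> R = {} \<and> U \<inter> W = {} \<and> V \<inter> R = {} \<and> V \<inter> W = {} \<and> R \<inter> W = {} \<and>
     aniso_mod p 2 U b \<and> aniso_mod p 1 V b \<and>
     (\<forall>ij \<in> upairs (U \<union> V \<union> R \<union> W) - upairs V. type_exp U W ij \<noteq> 0 \<longrightarrow> int p dvd b ij)"

abbreviation state_frac ::
    "nat \<Rightarrow> nat \<Rightarrow> nat set \<Rightarrow> nat set \<Rightarrow> nat set \<Rightarrow> nat set \<Rightarrow> (nat \<times> nat \<Rightarrow> int) \<Rightarrow> real" where
  "state_frac p k U V R W b \<equiv> aniso_frac p k (U \<union> V \<union> R \<union> W) b (type_exp U W)"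

section \<open>Zeros of the forms in a state\<close>

lemma qf_dvd_restrict:
  assumes "finite I" "A \<subseteq> I" "\<And>ij. ij \<in> upairs I - upairs A \<Longrightarrow> m dvd c ij * x (fst ij) * x (snd ij)"
  shows "m dvd qf I c x \<longleftrightarrow> m dvd qf A c x"
proof -
  have "qf I c x = (\<Sum>(i, j)\<in>upairs I - upairs A. c (i, j) * x i * x j) + qf A c x"
    unfolding qf_def using assms upairs_mono[OF assms(2)] by (intro sum.subset_diff) auto
  moreover have "m dvd (\<Sum>(i, j)\<in>upairs I - upairs A. c (i, j) * x i * x j)"
    using assms(3) by (intro dvd_sum) auto
  ultimately show ?thesis by (simp add: dvd_add_right_iff)
qed

context
  fixes p :: nat and U V R W :: "nat set" and b c :: "nat \<times> nat \<Rightarrow> int" and k :: nat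
  assumes st: "is_state p U V R W b"
    and c: "c \<in> coeff_box p k (U \<union> V \<union> R \<union> W) b (type_exp U W)"
begin

lemma state_coeff_dvd:
  assumes "ij \<in> upairs (U \<union> V \<union> R \<union> W) - upairs V" "type_exp U W ij \<noteq> 0"
  shows "int p dvd c ij"
proof -
  have "[c ij = b ij] (mod int p ^ type_exp U W ij)" using coeff_boxD[OF c] assms by blast
  then have "[c ij = b ij] (mod int p)"
    using assms(2) cong_dvd_modulus[of "c ij" "b ij" "int p ^ type_exp U W ij" "int p"] by (simp add: dvd_power)
  then show ?thesis using st assms cong_dvd_iff unfolding is_state_def by blast
qed

lemma state_aniso_V: "aniso_mod p 1 V c"
proof -
  have "[c ij = b ij] (mod int p ^ 1)" if "ij \<in> upairs V" for ij
  proof -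
    have "ij \<in> upairs (U \<union> V \<union> R \<union> W)" "type_exp U W ij = 1"
      using that st by (auto simp: upairs_def type_exp_def is_state_def)
    then show ?thesis using coeff_boxD[OF c, of ij] by simp
  qed
  then show ?thesis using st aniso_mod_cong unfolding is_state_def by blast
qed

lemma state_aniso_U: "aniso_mod p 2 U c"
proof -
  have "[c ij = b ij] (mod int p ^ 2)" if "ij \<in> upairs U" for ij
  proof -
    have "ij \<in> upairs (U \<union> V \<union> R \<union> W)" "type_exp U W ij = 2"
      using that by (auto simp: upairs_def type_exp_def)
    then show ?thesis using coeff_boxD[OF c, of ij] by simp
  qed
  then show ?thesis using st aniso_mod_cong unfolding is_state_def by blast
qed

lemma state_zero_dvd_V:
  assumes "W = {}" "int p dvd qf (U \<union> V \<union> R \<union> W) c x" "i \<in> V"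
  shows "int p dvd x i"
proof -
  have "int p dvd c ij" if "ij \<in> upairs (U \<union> V \<union> R \<union> W) - upairs V" for ij
    using state_coeff_dvd[OF that] assms(1) by (auto simp: type_exp_def split: prod.split)
  then have "int p dvd qf V c x"
    using assms(2) st by (subst (asm) qf_dvd_restrict[where A = V]) (auto simp: is_state_def)
  then show ?thesis using state_aniso_V assms(3) by (simp add: aniso_mod_def)
qed

text \<open>Modulo \<open>p\<close> only the block \<open>V\<close> is visible, which forces the
  entries on \<open>V\<close> to be divisible by \<open>p\<close>. All terms meeting
  \<open>V\<close> then vanish modulo \<open>p^2\<close>: inside \<open>V\<close> from the two
  entries, elsewhere from one entry and the coefficient. What is left modulo \<open>p^2\<close> is
  the block \<open>U\<close>.\<close>

lemma state_terminal:
  assumes "R = {}" "W = {}" "k \<ge> 2"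
  shows "aniso_mod p k (U \<union> V \<union> R \<union> W) c"
proof (rule aniso_mod_mono[OF _ assms(3)])
  let ?I = "U \<union> V \<union> R \<union> W"
  have fin: "finite ?I" using st by (simp add: is_state_def)
  show "aniso_mod p 2 ?I c"
    unfolding aniso_mod_def
  proof (intro allI impI)
    fix x assume x: "int p ^ 2 dvd qf ?I c x"
    then have "int p dvd qf ?I c x" by (metis dvd_power dvd_trans zero_less_numeral)
    then have V: "int p dvd x i" if "i \<in> V" for i using state_zero_dvd_V assms that by blast
    have "int p ^ 2 dvd qf U c x"
    proof (rule iffD1[OF qf_dvd_restrict x])
      fix ij assume ij: "ij \<in> upairs ?I - upairs U"
      then have one: "fst ij \<in> V \<or> snd ij \<in> V" and sub: "fst ij \<in> U \<union> V" "snd ij \<in> U \<union> V"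
        using assms by (auto simp: upairs_def)
      show "int p ^ 2 dvd c ij * x (fst ij) * x (snd ij)"
      proof (cases "ij \<in> upairs V")
        case True
        then have "int p dvd x (fst ij)" "int p dvd x (snd ij)" using V by (auto simp: upairs_def)
        then have "int p * int p dvd c ij * (x (fst ij) * x (snd ij))" by (intro dvd_mult mult_dvd_mono)
        then show ?thesis by (simp add: power2_eq_square mult.assoc)
      next
        case False
        then have "int p dvd c ij"
          using ij assms by (intro state_coeff_dvd) (auto simp: type_exp_def split: prod.split)
        moreover have "int p dvd x (fst ij) * x (snd ij)" using one V by auto
        ultimately have "int p * int p dvd c ij * (x (fst ij) * x (snd ij))" by (intro mult_dvd_mono)
        then show ?thesis by (simp add: power2_eq_square mult.assoc)
      qed
    qed (use fin in auto)
    then have "int p dvd x i" if "i \<in> U" for i using state_aniso_U that by (auto simp: aniso_mod_def)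
    then show "\<forall>i\<in>?I. int p dvd x i" using V assms by blast
  qed
qed

end

lemma state_frac_terminal:
  assumes "p > 0" "is_state p U V {} {} b" "k \<ge> 2"
  shows "state_frac p k U V {} {} b = 1"
proof (rule aniso_frac_eq_1)
  show "finite (U \<union> V \<union> {} \<union> {})" using assms(2) by (simp add: is_state_def)
  show "type_exp U {} ij \<le> k" for ij using type_exp_le_2[of U "{}" ij] assms(3) by simp
qed (use state_terminal assms in blast)+

text \<open>
  Every zero of a state without unprocessed variables is divisible by \<open>p\<close> on \<open>V\<close>.
  Substituting \<open>p x\<^sub>i\<close> for \<open>x\<^sub>i\<close> with \<open>i \<in> V\<close> and dividing the form by \<open>p\<close>
  interchanges the roles of \<open>U\<close> and \<open>V\<close>, and the coefficients on \<open>R\<close> become arbitrary.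
\<close>

definition rescale :: "nat \<Rightarrow> nat set \<Rightarrow> (nat \<times> nat \<Rightarrow> int) \<Rightarrow> nat \<times> nat \<Rightarrow> int" where
  "rescale p V c = (\<lambda>(i, j). (if i \<in> V then int p else 1) * (if j \<in> V then int p else 1) * c (i, j) div int p)"

lemma rescale_simps:
  "p > 0 \<Longrightarrow> fst ij \<in> V \<Longrightarrow> snd ij \<in> V \<Longrightarrow> rescale p V c ij = int p * c ij"
  "p > 0 \<Longrightarrow> (fst ij \<in> V) \<noteq> (snd ij \<in> V) \<Longrightarrow> rescale p V c ij = c ij"
  "p > 0 \<Longrightarrow> fst ij \<notin> V \<Longrightarrow> snd ij \<notin> V \<Longrightarrow> rescale p V c ij = c ij div int p"
  by (auto simp: rescale_def split: prod.split)

lemma qf_rescale: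
  assumes "p > 0" "\<And>ij. ij \<in> upairs I \<Longrightarrow> fst ij \<notin> V \<Longrightarrow> snd ij \<notin> V \<Longrightarrow> int p dvd c ij"
  shows "int p * qf I (rescale p V c) x = qf I c (\<lambda>i. (if i \<in> V then int p else 1) * x i)"
  unfolding qf_def sum_distrib_left
proof (intro sum.cong refl, clarify)
  fix i j assume ij: "(i, j) \<in> upairs I"
  then have "int p dvd (if i \<in> V then int p else 1) * (if j \<in> V then int p else 1) * c (i, j)"
    using assms(2)[OF ij] by auto
  then have "int p * rescale p V c (i, j) = (if i \<in> V then int p else 1) * (if j \<in> V then int p else 1) * c (i, j)"
    unfolding rescale_def by simp
  then show "int p * (rescale p V c (i, j) * x i * x j) =
    c (i, j) * ((if i \<in> V then int p else 1) * x i) * ((if j \<in> V then int p else 1) * x j)"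
    by (metis (no_types, lifting) mult.assoc mult.commute mult.left_commute)
qed

text \<open>On \<open>V\<close> the coefficients gain a factor \<open>p\<close>, on \<open>U\<close>
  they lose one, which exchanges anisotropy modulo \<open>p\<close> and modulo \<open>p^2\<close>.
  Coefficients between \<open>V\<close> and the other variables are unchanged and were already
  divisible by \<open>p\<close>.\<close>

lemma is_state_rescale:
  assumes p: "p > 0" and st: "is_state p U V R {} b"
  shows "is_state p V U {} R (rescale p V b)"
  unfolding is_state_def
proof (intro conjI ballI impI)
  have disj: "U \<inter> V = {}" "U \<inter> R = {}" "V \<inter> R = {}" using st by (auto simp: is_state_def)
  have bdvd: "int p dvd b ij" if "ij \<in> upairs (U \<union> V \<union> R)" "ij \<notin> upairs V" for ij
    using st that by (auto simp: is_state_def type_exp_def split: prod.splits if_splits)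
  have r: "rescale p V b ij = int p * b ij" if "ij \<in> upairs V" for ij
    using that p by (auto simp: rescale_simps upairs_def)
  have "qf V (rescale p V b) x = int p * qf V b x" for x
    unfolding qf_def sum_distrib_left by (intro sum.cong) (auto simp: r)
  then show "aniso_mod p 2 V (rescale p V b)"
    using st p by (simp add: is_state_def aniso_mod_def power2_eq_square)
  have "int p * qf U (rescale p V b) x = qf U b x" for x
  proof -
    have "int p * qf U (rescale p V b) x = qf U b (\<lambda>i. (if i \<in> V then int p else 1) * x i)"
      using disj by (intro qf_rescale p bdvd) (auto simp: upairs_def)
    also have "\<dots> = qf U b x" using disj by (intro qf_cong_args) auto
    finally show ?thesis .
  qed
  note Ueq = this
  have "int p dvd x i" if "int p dvd qf U (rescale p V b) x" "i \<in> U" for x i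
  proof -
    have "int p ^ 2 dvd qf U b x"
      unfolding Ueq[symmetric] power2_eq_square using that by (intro mult_dvd_mono) auto
    then show ?thesis using st that by (auto simp: is_state_def aniso_mod_def)
  qed
  then show "aniso_mod p 1 U (rescale p V b)" by (simp add: aniso_mod_def)
  fix ij assume ij: "ij \<in> upairs (V \<union> U \<union> {} \<union> R) - upairs U" "type_exp V R ij \<noteq> 0"
  then have V: "fst ij \<in> V \<or> snd ij \<in> V" using disj by (auto simp: upairs_def type_exp_def split: if_splits)
  show "int p dvd rescale p V b ij"
  proof (cases "ij \<in> upairs V")
    case True
    then show ?thesis by (simp add: r)
  next
    case False
    then have "int p dvd b ij" using ij(1) by (intro bdvd) (auto simp: upairs_def)
    moreover have "(fst ij \<in> V) \<noteq> (snd ij \<in> V)" using V False ij(1) by (auto simp: upairs_def)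
    then have "rescale p V b ij = b ij" using p by (simp add: rescale_simps)
    ultimately show ?thesis by simp
  qed
qed (use st in \<open>auto simp: is_state_def\<close>)

text \<open>The map acts on each coefficient separately, so \<open>frac_fibers\<close> applies once
  its fibres are counted; the lost digit of precision comes from dividing the form by
  \<open>p\<close>.\<close>

lemma state_frac_rescale:
  assumes p: "prime p" and st: "is_state p U V R {} b" and k: "k \<ge> 2"
  shows "state_frac p (Suc k) U V R {} b = state_frac p k V U {} R (rescale p V b)"
proof -
  have p0: "p > 0" using p prime_gt_0_nat by blast
  let ?I = "U \<union> V \<union> R"
  have fin: "finite ?I" using st by (simp add: is_state_def)
  have I: "U \<union> V \<union> R \<union> {} = ?I" "V \<union> U \<union> {} \<union> R = ?I" by auto
  define s where "s = (\<lambda>i. if i \<in> V then int p else 1)"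
  define h where "h = (\<lambda>ij x. (s (fst ij) * s (snd ij) * x div int p) mod int p ^ k)"
  have disj: "U \<inter> V = {}" "U \<inter> R = {}" "V \<inter> R = {}" using st by (auto simp: is_state_def)
  let ?e = "type_exp U {}" and ?e' = "type_exp V R" and ?b = "rescale p V b"
  \<comment> \<open>Fibre sizes as quotients of class sizes at precisions \<open>k + 1\<close> and
    \<open>k\<close>: inside \<open>V\<close> the prescribed exponent rises from 1 to 2, giving
    \<open>p^k / p^(k-2)\<close>; for mixed pairs it stays 1, giving \<open>p^k / p^(k-1)\<close>;
    away from \<open>V\<close> exponent and precision both drop by one, so the map is
    bijective.\<close>
  let ?m = "\<lambda>ij. if ij \<in> upairs V then p ^ 2 else if fst ij \<in> V \<or> snd ij \<in> V then p else 1"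
  have bdvd: "int p dvd b ij" if "ij \<in> upairs ?I" "ij \<notin> upairs V" for ij
    using st that by (auto simp: is_state_def type_exp_def split: prod.splits if_splits)
  have e_cases: "ij \<in> upairs V \<and> ?e ij = 1 \<and> ?e' ij = 2 \<and> (\<forall>c. rescale p V c ij = int p * c ij) \<and>
       s (fst ij) * s (snd ij) = int p * int p \<or>
     ij \<notin> upairs V \<and> (fst ij \<in> V) \<noteq> (snd ij \<in> V) \<and> ?e ij = 1 \<and> ?e' ij = 1 \<and> (\<forall>c. rescale p V c ij = c ij) \<and>
       s (fst ij) * s (snd ij) = int p \<or>
     fst ij \<notin> V \<and> snd ij \<notin> V \<and> ?e ij = Suc (?e' ij) \<and> (\<forall>c. rescale p V c ij = c ij div int p) \<and>
       s (fst ij) * s (snd ij) = 1"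
    if in_I: "ij \<in> upairs ?I" for ij
  proof -
    obtain i j where ij: "ij = (i, j)" "i \<in> ?I" "j \<in> ?I" "i \<le> j"
      using in_I by (cases ij) (simp add: upairs_def)
    consider "i \<in> V" "j \<in> V" | "(i \<in> V) \<noteq> (j \<in> V)" | "i \<notin> V" "j \<notin> V" by blast
    then show ?thesis
    proof cases
      case 1
      then show ?thesis using ij p0 disj by (auto simp: upairs_def type_exp_def rescale_simps s_def)
    next
      case 2
      then show ?thesis using ij p0 disj by (auto simp: upairs_def type_exp_def rescale_simps s_def)
    next
      case 3
      then have "?e ij = Suc (?e' ij)" using ij disj by (auto simp: type_exp_def)
      with 3 show ?thesis using ij p0 by (auto simp: upairs_def rescale_simps s_def)
    qed
  qed
  have maps: "h ij x \<in> res_class p k (?b ij) (?e' ij)" if ij: "ij \<in> upairs ?I" and x: "x \<in> res_class p (Suc k) (b ij) (?e ij)" for ij x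
  proof -
    have xb: "[x = b ij] (mod int p ^ ?e ij)" using x by (simp add: res_class_def)
    have "[s (fst ij) * s (snd ij) * x div int p = ?b ij] (mod int p ^ ?e' ij)"
      using e_cases[OF ij]
    proof (elim disjE conjE)
      assume *: "fst ij \<notin> V" "snd ij \<notin> V" "?e ij = Suc (?e' ij)" "\<forall>c. rescale p V c ij = c ij div int p" "s (fst ij) * s (snd ij) = 1"
      have "int p dvd b ij" using bdvd[OF ij] * by (cases ij) (auto simp: upairs_def)
      moreover have "[x = b ij] (mod int p)"
        using xb *(3) cong_dvd_modulus[of x "b ij" "int p ^ ?e ij" "int p"] by simp
      ultimately have "int p dvd x" using cong_dvd_iff by blast
      with \<open>int p dvd b ij\<close> obtain x' b' where "x = int p * x'" "b ij = int p * b'" by (auto elim!: dvdE)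
      then show ?thesis using xb * p0 by (simp add: cong_iff_dvd_diff flip: right_diff_distrib)
    next
      assume *: "?e ij = 1" "?e' ij = 2" "\<forall>c. rescale p V c ij = int p * c ij" "s (fst ij) * s (snd ij) = int p * int p"
      have "int p * int p dvd int p * (x - b ij)" using xb * by (intro mult_dvd_mono) (simp_all add: cong_iff_dvd_diff)
      moreover have "s (fst ij) * s (snd ij) * x div int p = int p * x" using p0 by (simp only: *(4) mult.assoc) simp
      ultimately show ?thesis using * by (simp add: cong_iff_dvd_diff power2_eq_square right_diff_distrib)
    next
      assume *: "?e ij = 1" "?e' ij = 1" "\<forall>c. rescale p V c ij = c ij" "s (fst ij) * s (snd ij) = int p"
      then show ?thesis using xb p0 by simp
    qed
    then show ?thesis unfolding h_def using p0 k type_exp_le_2[of V R ij] by (intro mod_in_res_class) auto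
  qed
  have fib: "card {x \<in> res_class p (Suc k) (b ij) (?e ij). h ij x = y} = ?m ij"
    if ij: "ij \<in> upairs ?I" and y: "y \<in> res_class p k (?b ij) (?e' ij)" for ij y
  proof -
    have y': "0 \<le> y" "y < int p ^ k" "[y = ?b ij] (mod int p ^ ?e' ij)" using y by (auto simp: res_class_def)
    show ?thesis using e_cases[OF ij]
    proof (elim disjE conjE)
      assume *: "ij \<in> upairs V" "?e ij = 1" "?e' ij = 2" "\<forall>c. rescale p V c ij = int p * c ij" "s (fst ij) * s (snd ij) = int p * int p"
      have m: "?m ij = p ^ 2" using * by simp
      have yb: "int p * int p dvd y - int p * b ij"
        using y'(3) unfolding *(3) spec[OF *(4)] by (simp only: cong_iff_dvd_diff power2_eq_square)
      then have "int p dvd (y - int p * b ij) + int p * b ij" by (intro dvd_add) (auto dest: dvd_mult_left)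
      then obtain y2 where y2: "y = int p * y2" by auto
      obtain l where l: "k = Suc l" "l \<ge> 1" using k by (cases k) auto
      have "int p * int p dvd int p * (y2 - b ij)" using yb unfolding y2 by (simp only: right_diff_distrib)
      then have y2b: "[y2 = b ij] (mod int p)" using p0 by (simp add: cong_iff_dvd_diff)
      have hx: "h ij x = y \<longleftrightarrow> [x = y2] (mod int p ^ l)" for x
      proof -
        have "s (fst ij) * s (snd ij) * x div int p = int p * x" using p0 by (simp only: *(5) mult.assoc) simp
        then have "h ij x = int p * (x mod int p ^ l)" by (simp only: h_def l power_Suc mult_mod_right)
        moreover have "y2 mod int p ^ l = y2" using y'(1,2) p0 by (simp add: y2 l zero_le_mult_iff)
        ultimately show ?thesis using p0 by (simp add: y2 cong_def)
      qed
      have "[x = b ij] (mod int p)" if "[x = y2] (mod int p ^ l)" for x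
        using cong_dvd_modulus[OF that, of "int p"] y2b l by (auto intro: cong_trans simp: dvd_power)
      then have "{x \<in> res_class p (Suc k) (b ij) (?e ij). h ij x = y} = res_class p (Suc k) y2 l"
        unfolding res_class_def hx *(2) by auto
      then show ?thesis using card_res_class[OF p0, of l "Suc k" y2] l m by simp
    next
      assume *: "ij \<notin> upairs V" "(fst ij \<in> V) \<noteq> (snd ij \<in> V)" "?e ij = 1" "?e' ij = 1" "\<forall>c. rescale p V c ij = c ij" "s (fst ij) * s (snd ij) = int p"
      have "h ij x = y \<longleftrightarrow> [x = y] (mod int p ^ k)" for x
        using y' p0 by (simp add: h_def * cong_def)
      moreover have "[x = b ij] (mod int p)" if "[x = y] (mod int p ^ k)" for x
        using that y'(3) k cong_dvd_modulus[OF that, of "int p"] * by (auto intro: cong_trans simp: dvd_power)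
      ultimately have "{x \<in> res_class p (Suc k) (b ij) (?e ij). h ij x = y} = res_class p (Suc k) y k"
        by (auto simp: res_class_def *)
      then show ?thesis using card_res_class[OF p0, of k "Suc k" y] * by simp
    next
      assume *: "fst ij \<notin> V" "snd ij \<notin> V" "?e ij = Suc (?e' ij)" "\<forall>c. rescale p V c ij = c ij div int p" "s (fst ij) * s (snd ij) = 1"
      have "int p dvd b ij" using bdvd[OF ij] * by (cases ij) (auto simp: upairs_def)
      then obtain b' where b': "b ij = int p * b'" by blast
      have m: "?m ij = 1" using * by (auto simp: upairs_def)
      have "{x \<in> res_class p (Suc k) (b ij) (?e ij). h ij x = y} = {int p * y}"
      proof (intro equalityI subsetI)
        fix x assume "x \<in> {x \<in> res_class p (Suc k) (b ij) (?e ij). h ij x = y}"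
        then have x: "0 \<le> x" "x < int p ^ Suc k" "[x = b ij] (mod int p ^ ?e ij)" "(x div int p) mod int p ^ k = y"
          by (auto simp: res_class_def h_def *)
        have "[x = b ij] (mod int p)"
          using x(3) *(3) cong_dvd_modulus[of x "b ij" "int p ^ ?e ij" "int p"] by simp
        then have "int p dvd x" using b' cong_dvd_iff by (metis dvd_triv_left)
        then obtain x' where x': "x = int p * x'" by blast
        then have "x' = y" using x p0 by (simp add: zero_le_mult_iff)
        then show "x \<in> {int p * y}" using x' by simp
      next
        fix x assume "x \<in> {int p * y}"
        then show "x \<in> {x \<in> res_class p (Suc k) (b ij) (?e ij). h ij x = y}"
          using y' p0 by (simp add: res_class_def h_def * b' cong_iff_dvd_diff flip: right_diff_distrib)
      qed
      then show ?thesis using m by simp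
    qed
  qed
  have aniso: "aniso_mod p (Suc k) ?I c \<longleftrightarrow> aniso_mod p k ?I (\<lambda>ij\<in>upairs ?I. h ij (c ij))"
    if c: "c \<in> coeff_box p (Suc k) ?I b ?e" for c
  proof -
    have cdvd: "int p dvd c ij" if "ij \<in> upairs ?I" "ij \<notin> upairs V" for ij
      using state_coeff_dvd[OF st, of c "Suc k" ij] c that
      by (auto simp: type_exp_def split: prod.splits if_splits)
    have zV: "int p dvd x i" if "int p dvd qf ?I c x" "i \<in> V" for x i
      using state_zero_dvd_V[OF st, of c "Suc k" x i] c that by simp
    have q: "int p * qf ?I (rescale p V c) x = qf ?I c (\<lambda>i. s i * x i)" for x
      unfolding s_def using p0 by (intro qf_rescale cdvd) (auto simp: upairs_def)
    have "aniso_mod p k ?I (\<lambda>ij\<in>upairs ?I. h ij (c ij)) \<longleftrightarrow> aniso_mod p k ?I (rescale p V c)"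
      by (rule aniso_mod_cong) (auto simp: h_def rescale_def cong_def s_def)
    also have "\<dots> \<longleftrightarrow> aniso_mod p (Suc k) ?I c"
    proof
      assume a: "aniso_mod p k ?I (rescale p V c)"
      show "aniso_mod p (Suc k) ?I c" unfolding aniso_mod_def
      proof (intro allI impI)
        fix x assume x: "int p ^ Suc k dvd qf ?I c x"
        then have "int p dvd qf ?I c x" by (metis dvd_mult_left power_Suc)
        then have V: "\<forall>i\<in>V. int p dvd x i" using zV by blast
        define y where "y = (\<lambda>i. x i div s i)"
        have sy: "s i * y i = x i" for i using V by (auto simp: y_def s_def)
        have "int p * int p ^ k dvd int p * qf ?I (rescale p V c) y"
          unfolding q sy using x by simp
        then have "int p ^ k dvd qf ?I (rescale p V c) y" using p0 by simp
        then have "\<forall>i\<in>?I. int p dvd y i" using a by (simp add: aniso_mod_def)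
        then show "\<forall>i\<in>?I. int p dvd x i" using sy by (metis dvd_mult)
      qed
    next
      assume a: "aniso_mod p (Suc k) ?I c"
      show "aniso_mod p k ?I (rescale p V c)" unfolding aniso_mod_def
      proof (intro allI impI)
        fix x assume x: "int p ^ k dvd qf ?I (rescale p V c) x"
        then have "int p * int p ^ k dvd qf ?I c (\<lambda>i. s i * x i)"
          unfolding q[symmetric] by (intro mult_dvd_mono) auto
        then have sx: "\<forall>i\<in>?I. int p dvd s i * x i"
          using spec[OF a[unfolded aniso_mod_def], of "\<lambda>i. s i * x i"] by simp
        \<comment> \<open>On \<open>V\<close> the divisibility of \<open>s i * x i\<close> by
          \<open>p\<close> is vacuous. Dividing these entries by \<open>p\<close> gives back
          \<open>x\<close> on \<open>V\<close>, and the rescaled form at \<open>x\<close> equals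
          \<open>p\<close> times the original form at \<open>y\<close>. Since
          \<open>k \<ge> 2\<close>, a factor \<open>p\<close> remains in the latter, and the block
          \<open>V\<close> forces divisibility once more.\<close>
        define y where "y = (\<lambda>i. s i * x i div int p)"
        have y: "int p * y i = s i * x i" if "i \<in> ?I" for i using sx that by (simp add: y_def)
        have "int p * qf ?I (rescale p V c) x = qf ?I c (\<lambda>i. int p * y i)"
          unfolding q by (rule qf_cong_args) (simp add: y)
        then have "qf ?I (rescale p V c) x = int p * qf ?I c y"
          using p0 by (simp add: qf_scale power2_eq_square)
        moreover have "int p ^ 2 dvd int p ^ k" using k by (rule le_imp_power_dvd)
        ultimately have "int p ^ 2 dvd int p * qf ?I c y" using x by (metis dvd_trans)
        then have "int p dvd qf ?I c y" using p0 by (simp add: power2_eq_square)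
        then have "int p dvd y i" if "i \<in> V" for i using zV that by blast
        moreover have "y i = x i" if "i \<in> V" for i using that p0 by (simp add: y_def s_def)
        moreover have "int p dvd x i" if "i \<in> ?I" "i \<notin> V" for i
          using bspec[OF sx that(1)] that(2) by (simp add: s_def)
        ultimately show "\<forall>i\<in>?I. int p dvd x i" by metis
      qed
    qed
    finally show ?thesis by blast
  qed
  show ?thesis
    unfolding aniso_frac_def coeff_box_def I
    by (rule frac_fibers[where h = h and m = ?m])
       (use fin maps fib aniso p0 in \<open>simp_all add: coeff_box_def\<close>)
qed

section \<open>Degenerate and smooth extensions\<close>

lemma upairs_meet_cases:
  assumes "ij \<in> upairs I" "fst ij = w \<or> snd ij = w"
  obtains i where "ij = upair w i" "i \<in> I"
proof (cases ij)
  case (Pair a b)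
  then have "a \<in> I" "b \<in> I" "a \<le> b" using assms(1) by (simp_all add: upairs_def)
  moreover have "ij = upair w (if a = w then b else a)"
    using assms(2) Pair \<open>a \<le> b\<close> by (auto simp: upair_def)
  ultimately show ?thesis using that by (metis (full_types))
qed

lemma type_exp_upair:
  "type_exp U W (upair w i) = (if w \<in> U \<and> i \<in> U then 2
     else if (w \<in> W \<or> i \<in> W) \<and> w \<notin> U \<and> i \<notin> U then 0 else 1)"
  by (auto simp: type_exp_def upair_def min_def max_def)

text \<open>The zero \<open>x\<close> is singular; shearing along it splits off the variable \<open>w\<close> modulo \<open>p\<close>.\<close>

definition degenerate_ext :: "nat \<Rightarrow> nat set \<Rightarrow> nat \<Rightarrow> (nat \<times> nat \<Rightarrow> int) \<Rightarrow> bool" where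
  "degenerate_ext p V w c \<longleftrightarrow>
     (\<exists>x. x w = 1 \<and> int p dvd qf (insert w V) c x \<and> (\<forall>i\<in>V. int p dvd polar (insert w V) c x (unit_vec i)))"

lemma aniso_not_degenerate_ext:
  assumes "prime p" "aniso_mod p 1 (insert w V) c"
  shows "\<not> degenerate_ext p V w c"
proof
  assume "degenerate_ext p V w c"
  then obtain x where x: "x w = 1" "int p dvd qf (insert w V) c x" by (auto simp: degenerate_ext_def)
  have "int p dvd x w" using spec[OF assms(2)[unfolded aniso_mod_def], of x] x(2) by simp
  then show False using x(1) prime_gt_1_nat[OF assms(1)] by simp
qed

text \<open>If the entry at \<open>w\<close> of a primitive zero were divisible by \<open>p\<close>,
  the zero would reduce to one of the anisotropic block \<open>V\<close>. It is thus a unit, and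
  scaling normalizes it to 1.\<close>

lemma ext_zero:
  assumes p: "prime p" and V: "finite V" "w \<notin> V" and an: "aniso_mod p 1 V c"
    and nan: "\<not> aniso_mod p 1 (insert w V) c"
  shows "\<exists>x. x w = 1 \<and> int p dvd qf (insert w V) c x"
proof -
  let ?V = "insert w V"
  obtain y where y: "int p dvd qf ?V c y" "\<exists>i\<in>?V. \<not> int p dvd y i"
    using nan by (auto simp: aniso_mod_def)
  have "\<not> int p dvd y w"
  proof
    assume w: "int p dvd y w"
    then have "int p dvd qf V c y"
      using y(1) V by (subst (asm) qf_insert) (auto simp: power2_eq_square dvd_add_left_iff dvd_sum)
    then have "\<forall>i\<in>V. int p dvd y i" using an by (simp add: aniso_mod_def)
    with w y(2) show False by blast
  qed
  then have "coprime (y w) (int p)"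
    using p by (simp add: coprime_commute prime_imp_coprime)
  then obtain u where u: "[y w * u = 1] (mod int p)" using cong_solve_coprime_int[of "y w" "int p"] by auto
  define x where "x = (\<lambda>i. if i = w then 1 else u * y i)"
  have "[qf ?V c x = qf ?V c (\<lambda>i. u * y i)] (mod int p)"
  proof (rule qf_cong_mod[OF cong_refl])
    show "[x i = u * y i] (mod int p)" for i
      using cong_sym[OF u] by (simp add: x_def mult.commute)
  qed
  moreover have "int p dvd qf ?V c (\<lambda>i. u * y i)" using y(1) by (simp add: qf_scale)
  ultimately have "int p dvd qf ?V c x" using cong_dvd_iff by blast
  moreover have "x w = 1" by (simp add: x_def)
  ultimately show ?thesis by blast
qed

text \<open>The normalized zero is singular or smooth. Testing against directions in
  \<open>V\<close> is enough: the polar form of \<open>x\<close> with itself is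
  \<open>2 * Q(x)\<close>, which vanishes modulo \<open>p\<close>, so with \<open>x w = 1\<close>
  the pairing with \<open>e_w\<close> is determined by the pairings with \<open>V\<close>.\<close>

lemma ext_cases:
  assumes "prime p" "finite V" "w \<notin> V" "aniso_mod p 1 V c"
  obtains "aniso_mod p 1 (insert w V) c" | "degenerate_ext p V w c"
    | x y where "int p dvd qf (insert w V) c x" "\<not> int p dvd polar (insert w V) c x y"
proof (cases "aniso_mod p 1 (insert w V) c")
  case False
  then obtain x where x: "x w = 1" "int p dvd qf (insert w V) c x"
    using ext_zero[OF assms] by blast
  show ?thesis
  proof (cases "\<forall>i\<in>V. int p dvd polar (insert w V) c x (unit_vec i)")
    case True
    with x have "degenerate_ext p V w c" unfolding degenerate_ext_def by blast
    then show ?thesis by (rule that(2))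
  next
    case False
    then obtain i where "\<not> int p dvd polar (insert w V) c x (unit_vec i)" by blast
    with x(2) show ?thesis by (rule that(3))
  qed
qed (rule that(1))

lemma smooth_zero_restrict_not_aniso:
  assumes "prime p" "finite I" "A \<subseteq> I" "int p dvd qf A c x" "\<not> int p dvd polar A c x y"
  shows "\<not> aniso_mod p k I c"
proof (rule smooth_zero_not_aniso[OF assms(1,2)])
  let ?x = "\<lambda>i. if i \<in> A then x i else 0" and ?y = "\<lambda>i. if i \<in> A then y i else 0"
  have "qf I c ?x = qf A c ?x" using assms by (intro qf_supported) auto
  also have "\<dots> = qf A c x" by (intro qf_cong_args) auto
  finally show "int p dvd qf I c ?x" using assms by simp
  have "polar I c ?x ?y = polar A c ?x ?y" using assms by (intro polar_supported) auto
  also have "\<dots> = polar A c x y" unfolding polar_def by (intro sum.cong) (auto simp: upairs_def)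
  finally show "\<not> int p dvd polar I c ?x ?y" using assms by simp
qed

text \<open>The coefficients of the form after the substitution of \<open>x + x\<^sub>w L\<close> for \<open>x\<close>.\<close>

definition shear :: "nat set \<Rightarrow> nat \<Rightarrow> (nat \<Rightarrow> int) \<Rightarrow> (nat \<times> nat \<Rightarrow> int) \<Rightarrow> nat \<times> nat \<Rightarrow> int" where
  "shear I w L c = (\<lambda>(i, j). c (i, j) +
     (if i = w \<and> j = w then polar I c (unit_vec w) L + qf I c L
      else if i = w then polar I c (unit_vec j) L
      else if j = w then polar I c (unit_vec i) L else 0))"

lemma shear_upair:
  "shear I w L c (upair w w) = c (upair w w) + polar I c (unit_vec w) L + qf I c L"
  "i \<noteq> w \<Longrightarrow> shear I w L c (upair w i) = c (upair w i) + polar I c (unit_vec i) L"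
  by (auto simp: shear_def upair_def min_def max_def)

lemma shear_other: "fst ij \<noteq> w \<Longrightarrow> snd ij \<noteq> w \<Longrightarrow> shear I w L c ij = c ij"
  by (auto simp: shear_def split: prod.split)

lemma qf_shear:
  assumes "finite I" "w \<in> I"
  shows "qf I (shear I w L c) x = qf I c (\<lambda>i. x i + x w * L i)"
proof -
  define A where "A = I - {w}"
  have A: "I = insert w A" "finite A" "w \<notin> A" using assms by (auto simp: A_def)
  have "qf A (shear I w L c) x = qf A c x"
    unfolding qf_def using A(3) by (intro sum.cong refl) (auto simp: upairs_def shear_def)
  then have "qf I (shear I w L c) x = qf A c x + (c (upair w w) + polar I c (unit_vec w) L + qf I c L) * (x w)\<^sup>2 +
      (\<Sum>i\<in>A. (c (upair w i) + polar I c (unit_vec i) L) * x w * x i)"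
  proof -
    have "(\<Sum>i\<in>A. shear I w L c (upair w i) * x w * x i) =
        (\<Sum>i\<in>A. (c (upair w i) + polar I c (unit_vec i) L) * x w * x i)"
      by (intro sum.cong refl) (metis A(3) shear_upair(2))
    then show ?thesis
      unfolding \<open>qf A _ x = _\<close>[symmetric] using qf_insert[OF A(2,3), of "shear I w L c" x] A(1)
      by (simp add: shear_upair)
  qed
  also have "\<dots> = qf I c x + x w * (\<Sum>i\<in>I. x i * polar I c (unit_vec i) L) + (x w)\<^sup>2 * qf I c L"
    unfolding A(1) using A by (simp add: qf_insert power2_eq_square algebra_simps sum.distrib sum_distrib_left)
  also have "\<dots> = qf I c (\<lambda>i. x i + x w * L i)"
    unfolding qf_line polar_unit_vec_sum[OF assms(1), of c x L] by simp
  finally show ?thesis .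
qed

text \<open>Since \<open>L w = 0\<close>, the substitution \<open>x - x_w * L\<close> undoes the
  shear; the values of the original form are recovered, and they determine the coefficients.\<close>

lemma shear_inj_mod:
  assumes I: "finite I" "w \<in> I" and L: "L w = 0" and ij: "ij \<in> upairs I"
    and eq: "\<And>ij. ij \<in> upairs I \<Longrightarrow> [shear I w L c ij = shear I w L d ij] (mod m)"
  shows "[c ij = d ij] (mod m)"
proof (rule coeffs_cong_of_qf_cong[OF I(1) _ ij])
  fix x
  have *: "qf I (shear I w L c) (\<lambda>i. x i - x w * L i) = qf I c x" for c
    using L by (simp add: qf_shear I)
  have "[qf I (shear I w L c) (\<lambda>i. x i - x w * L i) = qf I (shear I w L d) (\<lambda>i. x i - x w * L i)] (mod m)"
    using eq by (rule qf_cong_mod) simp_all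
  then show "[qf I c x = qf I d x] (mod m)" by (simp only: *)
qed

lemma aniso_mod_shear:
  assumes I: "finite I" "w \<in> I" and L: "L w = 0"
  shows "aniso_mod p k I (shear I w L c) \<longleftrightarrow> aniso_mod p k I c"
proof
  assume *: "aniso_mod p k I (shear I w L c)"
  show "aniso_mod p k I c" unfolding aniso_mod_def
  proof (intro allI impI)
    fix x assume "int p ^ k dvd qf I c x"
    then have "int p ^ k dvd qf I (shear I w L c) (\<lambda>i. x i - x w * L i)"
      using L by (simp add: qf_shear I)
    then have d: "int p dvd x i - x w * L i" if "i \<in> I" for i
      using spec[OF *[unfolded aniso_mod_def], of "\<lambda>i. x i - x w * L i"] that by simp
    have w: "int p dvd x w" using d[OF I(2)] L by simp
    show "\<forall>i\<in>I. int p dvd x i"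
    proof
      fix i assume "i \<in> I"
      then have "int p dvd (x i - x w * L i) + x w * L i" using d w by (intro dvd_add) auto
      then show "int p dvd x i" by simp
    qed
  qed
next
  assume *: "aniso_mod p k I c"
  show "aniso_mod p k I (shear I w L c)" unfolding aniso_mod_def
  proof (intro allI impI)
    fix x assume "int p ^ k dvd qf I (shear I w L c) x"
    then have d: "int p dvd x i + x w * L i" if "i \<in> I" for i
      using spec[OF *[unfolded aniso_mod_def], of "\<lambda>i. x i + x w * L i"] I that by (simp add: qf_shear)
    have w: "int p dvd x w" using d[OF I(2)] L by simp
    show "\<forall>i\<in>I. int p dvd x i"
    proof
      fix i assume "i \<in> I"
      then have "int p dvd (x i + x w * L i) - x w * L i" using d w by (intro dvd_diff) auto
      then show "int p dvd x i" by simp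
    qed
  qed
qed

text \<open>A state in which the residues modulo \<open>p\<close> of the coefficients of \<open>w\<close> with \<open>R\<close>, \<open>V\<close> and \<open>w\<close> are known.\<close>

definition is_prestate ::
    "nat \<Rightarrow> nat set \<Rightarrow> nat set \<Rightarrow> nat set \<Rightarrow> nat \<Rightarrow> nat set \<Rightarrow> (nat \<times> nat \<Rightarrow> int) \<Rightarrow> bool" where
  "is_prestate p U V R w W b \<longleftrightarrow>
     finite (U \<union> V \<union> R \<union> W) \<and> w \<notin> U \<union> V \<union> R \<union> W \<and>
     U \<inter> V = {} \<and> U \<inter> R = {} \<and> U \<inter> W = {} \<and> V \<inter> R = {} \<and> V \<inter> W = {} \<and> R \<inter> W = {} \<and>
     aniso_mod p 2 U b \<and> aniso_mod p 1 V b \<and>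
     (\<forall>ij \<in> upairs (insert w (U \<union> V \<union> R \<union> W)) - upairs (insert w V).
        type_exp U W ij \<noteq> 0 \<longrightarrow> int p dvd b ij)"

lemma is_prestate_aniso:
  assumes "is_prestate p U V R w W b" "aniso_mod p 1 (insert w V) b"
  shows "is_state p U (insert w V) R W b"
  using assms by (auto simp: is_prestate_def is_state_def)

lemma prestate_coeff_cong:
  assumes st: "is_prestate p U V R w W b"
    and c: "c \<in> coeff_box p k (insert w (U \<union> V \<union> R \<union> W)) b (type_exp U W)"
    and ij: "ij \<in> upairs (insert w (U \<union> V \<union> R \<union> W))" "type_exp U W ij \<noteq> 0"
  shows "[c ij = b ij] (mod int p)"
  using coeff_boxD[OF c ij(1)] cong_dvd_modulus[of "c ij" "b ij" "int p ^ type_exp U W ij" "int p"] ij(2)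
  by (simp add: dvd_power)

lemma prestate_smooth:
  assumes p: "prime p" and st: "is_prestate p U V R w W b"
    and x: "int p dvd qf (insert w V) b x" "\<not> int p dvd polar (insert w V) b x y"
  shows "aniso_frac p k (insert w (U \<union> V \<union> R \<union> W)) b (type_exp U W) = 0"
proof (rule aniso_frac_eq_0)
  let ?I = "insert w (U \<union> V \<union> R \<union> W)"
  fix c assume c: "c \<in> coeff_box p k ?I b (type_exp U W)"
  have cong: "[c ij = b ij] (mod int p)" if "ij \<in> upairs (insert w V)" for ij
    using that st by (intro prestate_coeff_cong[OF st c]) (auto simp: is_prestate_def upairs_def type_exp_def)
  show "\<not> aniso_mod p k ?I c"
  proof (rule smooth_zero_restrict_not_aniso[OF p])
    show "int p dvd qf (insert w V) c x"
      using x(1) cong_dvd_iff[OF qf_cong_mod[OF cong cong_refl]] by simp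
    show "\<not> int p dvd polar (insert w V) c x y"
      using x(2) cong_dvd_iff[OF polar_cong_mod[OF cong cong_refl cong_refl]] by simp
  qed (use st in \<open>auto simp: is_prestate_def\<close>)
qed

text \<open>The unimodular shear moving \<open>e_w\<close> to the singular vector clears, modulo
  \<open>p\<close>, the coefficients of \<open>w\<close> with itself and with \<open>V\<close>,
  which is what membership in \<open>R\<close> requires. It maps the box injectively to one with the
  same exponents, so the proportion is preserved.\<close>

lemma prestate_degenerate:
  assumes p: "prime p" and st: "is_prestate p U V R w W b" and deg: "degenerate_ext p V w b" and k: "k \<ge> 2"
  defines "b0 \<equiv> (\<lambda>ij. if ij \<in> upair w ` insert w V then 0 else b ij)"
  shows "is_state p U V (insert w R) W b0"
    and "aniso_frac p k (insert w (U \<union> V \<union> R \<union> W)) b (type_exp U W) =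
      aniso_frac p k (insert w (U \<union> V \<union> R \<union> W)) b0 (type_exp U W)"
proof -
  have p0: "p > 0" using p prime_gt_0_nat by blast
  let ?I = "insert w (U \<union> V \<union> R \<union> W)" and ?e = "type_exp U W"
  have fin: "finite ?I" and wI: "w \<in> ?I" and wn: "w \<notin> U" "w \<notin> V" "w \<notin> R" "w \<notin> W"
    using st by (auto simp: is_prestate_def)
  have disj: "U \<inter> V = {}" "U \<inter> R = {}" "U \<inter> W = {}" "V \<inter> R = {}" "V \<inter> W = {}" "R \<inter> W = {}"
    using st by (auto simp: is_prestate_def)
  have b0_eq: "b0 ij = b ij" if "ij \<in> upairs A" "w \<notin> A" for ij A
  proof -
    have "ij \<notin> upair w ` insert w V" using that by (auto simp: upair_in_upairs_iff)
    then show ?thesis by (simp only: b0_def if_False)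
  qed
  have "aniso_mod p 2 U b0 \<longleftrightarrow> aniso_mod p 2 U b" "aniso_mod p 1 V b0 \<longleftrightarrow> aniso_mod p 1 V b"
    using wn by (auto intro!: aniso_mod_cong simp: b0_eq)
  moreover have "int p dvd b0 ij" if "ij \<in> upairs ?I - upairs V" "?e ij \<noteq> 0" for ij
  proof (cases "ij \<in> upair w ` insert w V")
    case True
    then show ?thesis by (simp only: b0_def if_True dvd_0_right)
  next
    case False
    then have "ij \<in> upairs ?I - upairs (insert w V)" using that by (auto simp: upairs_insert)
    then have "int p dvd b ij" using st that unfolding is_prestate_def by blast
    then show ?thesis using False by (simp only: b0_def if_False)
  qed
  moreover have "U \<union> V \<union> insert w R \<union> W = ?I" by auto
  ultimately show "is_state p U V (insert w R) W b0"
    using st unfolding is_prestate_def is_state_def by auto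
  obtain x where x: "x w = 1" "int p dvd qf (insert w V) b x" "\<And>i. i \<in> V \<Longrightarrow> int p dvd polar (insert w V) b x (unit_vec i)"
    using deg by (auto simp: degenerate_ext_def)
  \<comment> \<open>The part of the singular vector on \<open>V\<close>; its entry 1 at
    \<open>w\<close> is supplied by \<open>unit_vec w\<close>, so \<open>unit_vec w + L\<close>
    agrees with \<open>x\<close> on \<open>insert w V\<close>.\<close>
  define L where "L = (\<lambda>i. if i \<in> V then x i else 0)"
  have Lw: "L w = 0" using wn by (simp add: L_def)
  define \<phi> where "\<phi> = (\<lambda>c. \<lambda>ij\<in>upairs ?I. shear ?I w L c ij mod int p ^ k)"
  have ek: "?e ij \<le> k" for ij using type_exp_le_2[of U W ij] k by simp
  have notin: "i \<in> V \<Longrightarrow> i \<notin> U \<and> i \<notin> R \<and> i \<notin> W" "i \<in> R \<Longrightarrow> i \<notin> U \<and> i \<notin> W"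
    "i \<in> W \<Longrightarrow> i \<notin> U" for i
    using disj by blast+
  show "aniso_frac p k ?I b ?e = aniso_frac p k ?I b0 ?e"
  proof (rule aniso_frac_transfer[OF p0 fin, where \<phi> = \<phi>])
    show "?e ij \<le> k" for ij by (rule ek)
  next
    fix c assume c: "c \<in> coeff_box p k ?I b ?e"
    note cong = prestate_coeff_cong[OF st c]
    have shear_w: "[shear ?I w L c (upair w i) = b0 (upair w i)] (mod int p ^ ?e (upair w i))"
      if i: "i \<in> ?I" for i
    proof -
      have sub: "insert w V \<subseteq> ?I" by auto
      have congV: "[c ij = b ij] (mod int p)" if "ij \<in> upairs (insert w V)" for ij
        using that wn disj by (intro cong) (auto simp: upairs_def type_exp_def)
      have evL: "polar ?I c y (\<lambda>k. unit_vec w k + 1 * L k) = polar (insert w V) c y x"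
        if "\<And>k. k \<in> ?I - insert w V \<Longrightarrow> y k = 0" for y
      proof -
        have "polar ?I c y (\<lambda>k. unit_vec w k + 1 * L k) = polar (insert w V) c y (\<lambda>k. unit_vec w k + 1 * L k)"
          using that fin by (intro polar_supported) (auto simp: unit_vec_def L_def)
        also have "\<dots> = polar (insert w V) c y x"
          unfolding polar_def using x(1) wn by (intro sum.cong refl) (auto simp: upairs_def unit_vec_def L_def)
        finally show ?thesis .
      qed
      \<comment> \<open>The new coefficient is the value at \<open>x\<close> for
        \<open>i = w\<close> and the pairing of \<open>x\<close> with \<open>e_i\<close> for
        \<open>i\<close> in \<open>V\<close>; both vanish modulo \<open>p\<close> by degeneracy. For
        \<open>i\<close> in \<open>U\<close> or \<open>R\<close> the correction uses only
        coefficients between \<open>V\<close> and \<open>i\<close>, which are divisible by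
        \<open>p\<close>. For \<open>i\<close> in \<open>W\<close> nothing is prescribed.\<close>
      consider "i = w" | "i \<in> V" | "i \<in> U \<union> R" | "i \<in> W" using i by blast
      then show ?thesis
      proof cases
        case 1
        have "shear ?I w L c (upair w w) = qf ?I c (\<lambda>k. unit_vec w k + 1 * L k)"
          unfolding qf_line using fin shear_upair(1)[of ?I w L c] by (simp add: qf_unit_vec upair_def)
        also have "\<dots> = qf (insert w V) c (\<lambda>k. unit_vec w k + 1 * L k)"
          using fin by (intro qf_supported) (auto simp: unit_vec_def L_def)
        also have "\<dots> = qf (insert w V) c x"
          using x(1) wn by (intro qf_cong_args) (auto simp: unit_vec_def L_def)
        finally have "int p dvd shear ?I w L c (upair w w)"
          using x(2) cong_dvd_iff[OF qf_cong_mod[OF congV cong_refl]] by simp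
        moreover have "?e (upair w w) = 1" using wn by (simp add: type_exp_def upair_def)
        moreover have "b0 (upair w w) = 0" by (simp add: b0_def)
        ultimately show ?thesis using 1 by (simp add: cong_0_iff)
      next
        case 2
        then have iw: "i \<noteq> w" using wn by blast
        have "shear ?I w L c (upair w i) = polar ?I c (unit_vec w) (unit_vec i) + polar ?I c L (unit_vec i)"
          using iw 2 fin by (simp add: shear_upair polar_unit_vecs polar_commute[of _ _ L])
        also have "\<dots> = polar ?I c (unit_vec i) (\<lambda>k. unit_vec w k + 1 * L k)"
          by (subst polar_commute[of _ _ "unit_vec i"], subst polar_lin) simp
        also have "\<dots> = polar (insert w V) c x (unit_vec i)"
          using 2 by (subst evL) (auto simp: unit_vec_def polar_commute)
        finally have "int p dvd shear ?I w L c (upair w i)"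
          using x(3)[OF 2] cong_dvd_iff[OF polar_cong_mod[OF congV cong_refl cong_refl]] by simp
        moreover have "?e (upair w i) = 1"
          using wn notin(1)[OF 2] by (simp add: type_exp_upair)
        moreover have "b0 (upair w i) = 0" using 2 by (simp add: b0_def)
        ultimately show ?thesis by (simp add: cong_0_iff)
      next
        case 3
        then have iw: "i \<noteq> w" and iV: "i \<notin> V" using wn disj by auto
        have "i \<notin> W" using 3 disj by blast
        then have e1: "?e (upair w i) = 1" using wn by (simp add: type_exp_upair)
        have "int p dvd c (upair v i)" if "v \<in> V" for v
        proof -
          have e: "?e (upair v i) \<noteq> 0" using notin(1)[OF that] \<open>i \<notin> W\<close> by (simp add: type_exp_upair)
          have m: "upair v i \<in> upairs ?I - upairs (insert w V)"
            using that 3 iw iV by (auto simp: upair_in_upairs_iff)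
          then have "int p dvd b (upair v i)" using st e unfolding is_prestate_def by blast
          then show ?thesis using cong[of "upair v i"] e m cong_dvd_iff by blast
        qed
        have "int p dvd L v * polar ?I c (unit_vec v) (unit_vec i)" if "v \<in> ?I" for v
        proof (cases "v \<in> V")
          case True
          then have "polar ?I c (unit_vec v) (unit_vec i) = c (upair v i)"
            using iV i that by (intro polar_unit_vecs[OF fin]) auto
          then show ?thesis using \<open>\<And>v. v \<in> V \<Longrightarrow> int p dvd c (upair v i)\<close>[OF True] by simp
        qed (simp add: L_def)
        then have "int p dvd polar ?I c L (unit_vec i)"
          unfolding polar_unit_vec_sum[OF fin, of c L] by (rule dvd_sum)
        then have "int p dvd polar ?I c (unit_vec i) L" by (simp only: polar_commute)
        moreover have "[c (upair w i) = b (upair w i)] (mod int p)"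
          using e1 i by (intro cong) (auto simp: upair_in_upairs_iff)
        ultimately have "[shear ?I w L c (upair w i) = b (upair w i) + 0] (mod int p)"
          unfolding shear_upair(2)[OF iw] by (intro cong_add) (simp_all add: cong_0_iff)
        moreover have "b0 (upair w i) = b (upair w i)"
          using iw iV by (simp add: b0_def upair_in_image_iff del: image_insert)
        ultimately show ?thesis using e1 by simp
      next
        case 4
        then have "?e (upair w i) = 0" using wn notin(3) by (simp add: type_exp_upair)
        then show ?thesis by simp
      qed
    qed
    have "[shear ?I w L c ij = b0 ij] (mod int p ^ ?e ij)" if ij: "ij \<in> upairs ?I" for ij
    proof (cases "fst ij = w \<or> snd ij = w")
      case True
      then obtain i where i: "ij = upair w i" "i \<in> ?I" by (rule upairs_meet_cases[OF ij])
      show ?thesis unfolding i(1) by (rule shear_w[OF i(2)])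
    next
      case False
      then have "b0 ij = b ij" using ij by (intro b0_eq[of _ "?I - {w}"]) (auto simp: upairs_def)
      then show ?thesis using coeff_boxD[OF c ij] False by (simp add: shear_other)
    qed
    then show "\<phi> c \<in> coeff_box p k ?I b0 ?e"
      unfolding coeff_box_def \<phi>_def
      by (intro restrict_PiE_iff[THEN iffD2] ballI mod_in_res_class p0 ek)
    have "aniso_mod p k ?I (\<phi> c) \<longleftrightarrow> aniso_mod p k ?I (shear ?I w L c)"
      unfolding \<phi>_def by (rule aniso_mod_cong) (simp add: cong_def)
    then show "aniso_mod p k ?I (\<phi> c) \<longleftrightarrow> aniso_mod p k ?I c"
      using aniso_mod_shear[OF fin wI, of L] Lw by simp
  next
    show "inj_on \<phi> (coeff_box p k ?I b ?e)"
    proof (rule inj_onI)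
      fix c d assume cd: "c \<in> coeff_box p k ?I b ?e" "d \<in> coeff_box p k ?I b ?e" "\<phi> c = \<phi> d"
      have "[shear ?I w L c ij = shear ?I w L d ij] (mod int p ^ k)" if "ij \<in> upairs ?I" for ij
      proof -
        have "shear ?I w L c ij mod int p ^ k = shear ?I w L d ij mod int p ^ k"
          using fun_cong[OF cd(3), of ij] unfolding \<phi>_def restrict_apply if_P[OF that] .
        then show ?thesis unfolding cong_def .
      qed
      note sh = this
      have "c ij = d ij" if ij: "ij \<in> upairs ?I" for ij
      proof -
        have "[c ij = d ij] (mod int p ^ k)"
          by (rule shear_inj_mod[where L = L, OF fin wI _ ij sh]) (rule Lw)
        then show ?thesis
          using PiE_mem[OF cd(1)[unfolded coeff_box_def] ij] PiE_mem[OF cd(2)[unfolded coeff_box_def] ij]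
          by (simp add: res_class_def cong_def)
      qed
      then show "c = d"
        using cd(1,2) unfolding coeff_box_def by (rule PiE_ext[rotated 2])
    qed
  qed
qed

lemma qf_eq_0: "(\<And>i. i \<in> I \<Longrightarrow> x i = 0) \<Longrightarrow> qf I c x = 0"
  unfolding qf_def by (intro sum.neutral) (auto simp: upairs_def)

text \<open>The row of \<open>w\<close> is exposed in two portions. The diagonal coefficient of each
  \<open>r\<close> in \<open>R\<close> is divisible by \<open>p\<close>, so \<open>e_r\<close> is a
  zero modulo \<open>p\<close>; a nonzero coefficient of \<open>w\<close> with \<open>r\<close>
  makes it smooth. Only the zero row on \<open>R\<close> survives, whence the factor
  \<open>1 / p^|R|\<close>. Averaging over the coefficients of \<open>w\<close> with itself and
  \<open>V\<close> gives the sum and the power \<open>|V| + 1\<close>.\<close>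

lemma state_frac_step:
  assumes p: "prime p" and st: "is_state p U V R (insert w W) b" and w: "w \<notin> W" and k: "k \<ge> 2"
  defines "bz \<equiv> (\<lambda>z ij. if ij \<in> upair w ` insert w V then z ij else if ij \<in> upair w ` R then 0 else b ij)"
  shows "state_frac p k U V R (insert w W) b =
      (\<Sum>z\<in>upair w ` insert w V \<rightarrow>\<^sub>E {0..<int p}. aniso_frac p k (insert w (U \<union> V \<union> R \<union> W)) (bz z) (type_exp U W))
      / real p ^ Suc (card V) / real p ^ card R" (is ?eq)
    and "is_prestate p U V R w W (bz z)"
proof -
  have p0: "p > 0" using p prime_gt_0_nat by blast
  let ?I = "insert w (U \<union> V \<union> R \<union> W)"
  let ?e = "type_exp U (insert w W)" and ?J = "upair w ` R" and ?J' = "upair w ` insert w V"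
  have I: "U \<union> V \<union> R \<union> insert w W = ?I" by auto
  have fin: "finite ?I" and wn: "w \<notin> U" "w \<notin> V" "w \<notin> R" using st by (auto simp: is_state_def)
  have disj: "U \<inter> V = {}" "U \<inter> R = {}" "U \<inter> W = {}" "V \<inter> R = {}" "V \<inter> W = {}" "R \<inter> W = {}"
    using st by (auto simp: is_state_def)
  have e0: "?e (upair w i) = 0" if "i \<notin> U" for i
    using that wn by (auto simp: type_exp_def upair_def min_def max_def)
  have e2: "?e ij \<le> k" for ij using type_exp_le_2[of U "insert w W" ij] k by simp
  let ?e1 = "\<lambda>ij. if ij \<in> ?J then 1 else ?e ij" and ?b1 = "\<lambda>z ij. if ij \<in> ?J then z ij else b ij"
  let ?z0 = "\<lambda>ij\<in>?J. 0::int"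
  have zero: "aniso_frac p k ?I (?b1 z) ?e1 = 0" if z: "z \<in> ?J \<rightarrow>\<^sub>E {0..<int p}" "z \<noteq> ?z0" for z
  proof (rule aniso_frac_eq_0)
    fix c assume c: "c \<in> coeff_box p k ?I (?b1 z) ?e1"
    have "\<exists>ij\<in>?J. z ij \<noteq> 0"
      using z by (metis (mono_tags, lifting) PiE_restrict restrict_ext)
    then obtain r where r: "r \<in> R" "z (upair w r) \<noteq> 0" by blast
    have rw: "r \<noteq> w" using r wn by blast
    have "[c (r, r) = ?b1 z (r, r)] (mod int p ^ ?e1 (r, r))"
      using r by (intro coeff_boxD[OF c]) (auto simp: upairs_def)
    moreover have rr: "(r, r) \<notin> ?J" using rw by (auto simp: upair_def min_def max_def split: if_splits)
    moreover have err: "?e (r, r) = 1" using r disj rw by (auto simp: type_exp_def)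
    moreover have "int p dvd b (r, r)"
    proof -
      have "(r, r) \<in> upairs (U \<union> V \<union> R \<union> insert w W) - upairs V" using r disj by (auto simp: upairs_def)
      then show ?thesis using st err unfolding is_state_def by (metis one_neq_zero)
    qed
    ultimately have "int p dvd c (r, r)" using cong_dvd_iff[of "c (r, r)" "b (r, r)" "int p"] by simp
    then have "int p dvd qf ?I c (unit_vec r)" using r fin by (simp add: qf_unit_vec)
    moreover have "\<not> int p dvd polar ?I c (unit_vec r) (unit_vec w)"
    proof -
      have pol: "polar ?I c (unit_vec r) (unit_vec w) = c (upair w r)"
        using r fin rw by (subst polar_unit_vecs) (auto simp: upair_commute)
      have "[c (upair w r) = ?b1 z (upair w r)] (mod int p ^ ?e1 (upair w r))"
        using r by (intro coeff_boxD[OF c]) (auto simp: upair_in_upairs_iff)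
      then have "[c (upair w r) = z (upair w r)] (mod int p)" using r by (simp add: upair_in_image_iff)
      moreover have "z (upair w r) \<in> {0..<int p}" using z(1) r by blast
      then have "\<not> int p dvd z (upair w r)" using r(2) zdvd_imp_le by fastforce
      ultimately show ?thesis using cong_dvd_iff pol by metis
    qed
    ultimately show "\<not> aniso_mod p k ?I c" by (rule smooth_zero_not_aniso[OF p fin])
  qed
  have finJ: "finite ?J" "finite ?J'" using fin by auto
  have cards: "card ?J = card R" "card ?J' = Suc (card V)"
    unfolding card_image[OF inj_on_subset[OF inj_upair subset_UNIV]] using fin wn by auto
  have "aniso_frac p k ?I b ?e =
     (\<Sum>z\<in>?J \<rightarrow>\<^sub>E {0..<int p}. aniso_frac p k ?I (?b1 z) ?e1) / real p ^ card ?J"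
  proof (rule aniso_frac_split[OF p0 fin])
    show "?J \<subseteq> upairs ?I" by (auto simp: upair_in_upairs_iff)
    show "?e ij = 0" if "ij \<in> ?J" for ij using that e0 disj by auto
  qed (use k e2 in auto)
  also have "(\<Sum>z\<in>?J \<rightarrow>\<^sub>E {0..<int p}. aniso_frac p k ?I (?b1 z) ?e1) =
      (\<Sum>z\<in>{?z0}. aniso_frac p k ?I (?b1 z) ?e1)"
    using finJ zero p0 by (intro sum.mono_neutral_right) (auto intro!: finite_PiE)
  also have "\<dots> = aniso_frac p k ?I (?b1 ?z0) ?e1" by simp
  also have "\<dots> = (\<Sum>z\<in>?J' \<rightarrow>\<^sub>E {0..<int p}. aniso_frac p k ?I (\<lambda>ij. if ij \<in> ?J' then z ij else ?b1 ?z0 ij)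
      (\<lambda>ij. if ij \<in> ?J' then 1 else ?e1 ij)) / real p ^ card ?J'"
  proof (rule aniso_frac_split[OF p0 fin])
    show "?J' \<subseteq> upairs ?I" by (auto simp: upair_in_upairs_iff)
    show "?e1 ij = 0" if ij: "ij \<in> ?J'" for ij
    proof -
      obtain i where i: "ij = upair w i" "i \<in> insert w V" using ij by blast
      then have "i \<notin> R" "i \<notin> U" using wn disj by auto
      then show ?thesis using e0 i(1) by (simp add: upair_in_image_iff)
    qed
    show "?e1 ij \<le> k" for ij using e2 k by simp
  qed (use k in auto)
  also have "(\<Sum>z\<in>?J' \<rightarrow>\<^sub>E {0..<int p}. aniso_frac p k ?I (\<lambda>ij. if ij \<in> ?J' then z ij else ?b1 ?z0 ij)
      (\<lambda>ij. if ij \<in> ?J' then 1 else ?e1 ij)) =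
     (\<Sum>z\<in>?J' \<rightarrow>\<^sub>E {0..<int p}. aniso_frac p k ?I (bz z) (type_exp U W))"
  proof (intro sum.cong refl aniso_frac_cong)
    fix z ij assume ij: "ij \<in> upairs ?I"
    show "(if ij \<in> ?J' then 1 else ?e1 ij) = type_exp U W ij"
    proof (cases "fst ij = w \<or> snd ij = w")
      case True
      then obtain i where i: "ij = upair w i" "i \<in> ?I" by (rule upairs_meet_cases[OF ij])
      show ?thesis
        unfolding i(1) upair_in_image_iff using i(2) wn disj w
        by (auto simp: type_exp_def upair_def min_def max_def)
    next
      case False
      then have "ij \<notin> ?J'" "ij \<notin> ?J" by (auto simp: upair_def min_def max_def split: if_splits)
      then show ?thesis using False by (simp only: if_False) (auto simp: type_exp_def split: prod.split)
    qed
    show "[(if ij \<in> ?J' then z ij else ?b1 ?z0 ij) = bz z ij] (mod int p ^ type_exp U W ij)"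
      by (simp add: bz_def)
  qed
  finally show ?eq unfolding I cards .
  show "is_prestate p U V R w W (bz z)"
  proof -
    have out: "bz z ij = b ij" if "ij \<in> upairs A" "w \<notin> A" for ij A
    proof -
      have "ij \<notin> ?J'" "ij \<notin> ?J" using that by (auto simp: upair_in_upairs_iff)
      then show ?thesis by (simp only: bz_def if_False)
    qed
    have "aniso_mod p 2 U (bz z) \<longleftrightarrow> aniso_mod p 2 U b" "aniso_mod p 1 V (bz z) \<longleftrightarrow> aniso_mod p 1 V b"
      using wn by (auto intro!: aniso_mod_cong simp: out)
    moreover have "int p dvd bz z ij"
      if ij: "ij \<in> upairs ?I - upairs (insert w V)" "type_exp U W ij \<noteq> 0" for ij
    proof (cases "ij \<in> ?J")
      case True
      then have "ij \<notin> ?J'" using ij by (auto simp: upairs_insert)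
      then show ?thesis using True by (simp only: bz_def if_True if_False dvd_0_right)
    next
      case False
      have nJ': "ij \<notin> ?J'" using ij by (auto simp: upairs_insert)
      have "?e ij \<noteq> 0"
      proof (cases "fst ij = w \<or> snd ij = w")
        case True
        then obtain i where i: "ij = upair w i" "i \<in> ?I"
          using upairs_meet_cases[of ij ?I w thesis] ij(1) by blast
        then have "i \<in> U \<or> i \<in> W" using False nJ' by (auto simp: upair_in_image_iff)
        then have "i \<in> U" using ij(2) i(1) wn disj by (auto simp: type_exp_def upair_def min_def max_def split: if_splits)
        then show ?thesis using i(1) wn by (auto simp: type_exp_def upair_def min_def max_def)
      next
        case False
        then show ?thesis using ij(2) by (auto simp: type_exp_def split: prod.splits if_splits)
      qed
      moreover have "ij \<in> upairs (U \<union> V \<union> R \<union> insert w W) - upairs V"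
        unfolding I using ij(1) by (auto simp: upairs_insert)
      ultimately have "int p dvd b ij" using st unfolding is_state_def by blast
      then show ?thesis using False nJ' by (simp only: bz_def if_False)
    qed
    ultimately show ?thesis
      using st w wn unfolding is_prestate_def is_state_def by auto
  qed
qed

section \<open>Counting one-variable extensions over the residue field\<close>

definition ext_form :: "nat set \<Rightarrow> nat \<Rightarrow> (nat \<times> nat \<Rightarrow> int) \<Rightarrow> (nat \<times> nat \<Rightarrow> int) \<Rightarrow> nat \<times> nat \<Rightarrow> int" where
  "ext_form V w b z = (\<lambda>ij. if ij \<in> upair w ` insert w V then z ij else b ij)"

definition ext_coeffs :: "nat \<Rightarrow> nat set \<Rightarrow> nat \<Rightarrow> (nat \<times> nat \<Rightarrow> int) set" where
  "ext_coeffs p V w = upair w ` insert w V \<rightarrow>\<^sub>E {0..<int p}"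

lemma ext_form_simps:
  "i \<in> insert w V \<Longrightarrow> ext_form V w b z (upair w i) = z (upair w i)"
  "ij \<in> upairs V \<Longrightarrow> w \<notin> V \<Longrightarrow> ext_form V w b z ij = b ij"
proof -
  show "i \<in> insert w V \<Longrightarrow> ext_form V w b z (upair w i) = z (upair w i)"
    unfolding ext_form_def upair_in_image_iff by simp
  assume "ij \<in> upairs V" "w \<notin> V"
  then have "ij \<notin> upair w ` insert w V" by (auto simp: upair_in_upairs_iff)
  then show "ext_form V w b z ij = b ij" by (simp only: ext_form_def if_False)
qed

lemma aniso_mod_ext_form: "w \<notin> V \<Longrightarrow> aniso_mod p k V (ext_form V w b z) \<longleftrightarrow> aniso_mod p k V b"
  by (rule aniso_mod_cong) (simp add: ext_form_simps)

text \<open>The degenerate extensions are exactly the forms \<open>Q_V(x - x_w * L)\<close> modulo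
  \<open>p\<close>: pullbacks of the block along a projection with kernel spanned by
  \<open>e_w + L\<close>. Anisotropy of the block makes \<open>L\<close> unique modulo
  \<open>p\<close>, so they are counted by vectors \<open>L\<close> over the residue field.\<close>

lemma card_degenerate_ext:
  assumes p: "prime p" and V: "finite V" "w \<notin> V" and an: "aniso_mod p 1 V b"
  shows "card {z \<in> ext_coeffs p V w. degenerate_ext p V w (ext_form V w b z)} = p ^ card V"
proof -
  have p0: "p > 0" using p prime_gt_0_nat by blast
  let ?V = "insert w V"
  \<comment> \<open>\<open>shear\<close> adds its vector, whereas the projection subtracts
    \<open>L\<close>; hence the sign. The shear is applied to the extension \<open>b0\<close> of the
    block by a zero row.\<close>
  define M where "M = (\<lambda>L :: nat \<Rightarrow> int. \<lambda>i. if i \<in> V then - L i else 0)"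
  define b0 where "b0 = ext_form V w b (\<lambda>_. 0)"
  define \<zeta> where "\<zeta> = (\<lambda>L. \<lambda>ij\<in>upair w ` ?V. shear ?V w (M L) b0 ij mod int p)"
  let ?Q = "\<lambda>z. qf ?V (ext_form V w b z)"
  have qV: "qf V (ext_form V w b z) x = qf V b x" for z x
    unfolding qf_def using V(2) by (intro sum.cong refl) (auto simp: ext_form_simps)
  have key: "[?Q (\<zeta> L) x = qf V b (\<lambda>i. x i - x w * L i)] (mod int p)" for L x
  proof -
    have "[?Q (\<zeta> L) x = qf ?V (shear ?V w (M L) b0) x] (mod int p)"
    proof (rule qf_cong_mod[OF _ cong_refl])
      fix ij assume "ij \<in> upairs ?V"
      then consider "ij \<in> upairs V" | i where "ij = upair w i" "i \<in> ?V"
        unfolding upairs_insert by blast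
      then show "[ext_form V w b (\<zeta> L) ij = shear ?V w (M L) b0 ij] (mod int p)"
      proof cases
        case 1
        then have "fst ij \<noteq> w" "snd ij \<noteq> w" using V by (auto simp: upairs_def)
        then show ?thesis using 1 V by (simp add: ext_form_simps shear_other b0_def)
      next
        case 2
        then have "ext_form V w b (\<zeta> L) ij = shear ?V w (M L) b0 ij mod int p"
          unfolding 2(1) ext_form_simps(1)[OF 2(2)] \<zeta>_def using 2(2) by (simp only: restrict_apply imageI if_True)
        then show ?thesis by (simp add: cong_def)
      qed
    qed
    also have "qf ?V (shear ?V w (M L) b0) x = qf ?V b0 (\<lambda>i. x i + x w * M L i)"
      using V by (intro qf_shear) auto
    also have "\<dots> = qf V b (\<lambda>i. x i + x w * M L i)"
    proof -
      have "b0 (upair w i) = 0" if "i \<in> ?V" for i using that by (simp only: b0_def ext_form_simps)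
      then show ?thesis using V qV by (simp add: qf_insert b0_def)
    qed
    also have "\<dots> = qf V b (\<lambda>i. x i - x w * L i)"
      by (intro qf_cong_args) (simp add: M_def)
    finally show ?thesis .
  qed
  have mem: "\<zeta> L \<in> ext_coeffs p V w" for L
    unfolding ext_coeffs_def \<zeta>_def using p0 by (intro restrict_PiE_iff[THEN iffD2]) auto
  \<comment> \<open>With the polar form written as a difference of three values, \<open>key\<close>,
    which speaks only of values, also settles singularity.\<close>
  have polar_eq: "polar ?V c x y = qf ?V c (\<lambda>i. x i + 1 * y i) - qf ?V c x - qf ?V c y" for c x y
    unfolding qf_line by simp
  have degen: "degenerate_ext p V w (ext_form V w b (\<zeta> L))" for L
    unfolding degenerate_ext_def
  proof (intro exI[of _ "\<lambda>i. if i = w then 1 else L i"] conjI ballI)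
    let ?x = "\<lambda>i. if i = w then 1 else L i"
    show "?x w = 1" by simp
    have van: "qf V b (\<lambda>i. ?x i - ?x w * L i) = 0"
      using V(2) by (intro qf_eq_0) auto
    then show d: "int p dvd ?Q (\<zeta> L) ?x"
      using key[of L ?x] by (simp only: cong_0_iff)
    fix i assume i: "i \<in> V"
    then have iw: "i \<noteq> w" using V by blast
    have "[?Q (\<zeta> L) (\<lambda>j. ?x j + 1 * unit_vec i j) - ?Q (\<zeta> L) ?x - ?Q (\<zeta> L) (unit_vec i) =
        qf V b (unit_vec i) - 0 - qf V b (unit_vec i)] (mod int p)"
    proof (intro cong_diff)
      have "qf V b (\<lambda>j. (?x j + 1 * unit_vec i j) - (?x w + 1 * unit_vec i w) * L j) = qf V b (unit_vec i)"
        using V(2) iw by (intro qf_cong_args) (auto simp: unit_vec_def)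
      then show "[?Q (\<zeta> L) (\<lambda>j. ?x j + 1 * unit_vec i j) = qf V b (unit_vec i)] (mod int p)"
        using key[of L "\<lambda>j. ?x j + 1 * unit_vec i j"] by (simp only:)
      show "[?Q (\<zeta> L) ?x = 0] (mod int p)" using d by (simp add: cong_0_iff)
      show "[?Q (\<zeta> L) (unit_vec i) = qf V b (unit_vec i)] (mod int p)"
      proof -
        have "qf V b (\<lambda>j. unit_vec i j - unit_vec i w * L j) = qf V b (unit_vec i)"
          using iw by (intro qf_cong_args) (simp add: unit_vec_def)
        then show ?thesis using key[of L "unit_vec i"] by (simp only:)
      qed
    qed
    then show "int p dvd polar ?V (ext_form V w b (\<zeta> L)) ?x (unit_vec i)"
      unfolding polar_eq by (simp only: cong_0_iff diff_zero diff_self)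
  qed
  have "bij_betw \<zeta> (V \<rightarrow>\<^sub>E {0..<int p}) {z \<in> ext_coeffs p V w. degenerate_ext p V w (ext_form V w b z)}"
  proof (rule bij_betw_imageI)
    show "inj_on \<zeta> (V \<rightarrow>\<^sub>E {0..<int p})"
    proof (rule inj_onI)
      fix L N assume L: "L \<in> V \<rightarrow>\<^sub>E {0..<int p}" and N: "N \<in> V \<rightarrow>\<^sub>E {0..<int p}" and eq: "\<zeta> L = \<zeta> N"
      \<comment> \<open>The vector \<open>e_w + L\<close> is a zero of the extension belonging to
        \<open>L\<close>. Evaluated in the extension belonging to \<open>N\<close> it gives
        \<open>Q_V(L - N)\<close>, so anisotropy yields \<open>L = N\<close>.\<close>
      let ?x = "\<lambda>i. if i = w then 1 else L i"
      have "qf V b (\<lambda>i. ?x i - ?x w * L i) = 0"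
        using V(2) by (intro qf_eq_0) auto
      then have "[?Q (\<zeta> N) ?x = 0] (mod int p)"
        using key[of L ?x] unfolding eq by (simp only:)
      then have "[qf V b (\<lambda>i. ?x i - ?x w * N i) = 0] (mod int p)"
        by (rule cong_trans[OF cong_sym[OF key[of N ?x]]])
      then have d: "\<forall>i\<in>V. int p dvd ?x i - ?x w * N i"
        using spec[OF an[unfolded aniso_mod_def], of "\<lambda>i. ?x i - ?x w * N i"]
        by (simp only: cong_0_iff power_one_right simp_thms)
      have "L i = N i" if "i \<in> V" for i
      proof -
        have "int p dvd L i - N i" using bspec[OF d that] that V(2) by (auto split: if_splits)
        then have "L i mod int p = N i mod int p" by (simp add: mod_eq_dvd_iff)
        then show ?thesis using PiE_mem[OF L that] PiE_mem[OF N that] by simp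
      qed
      then show "L = N" using PiE_ext[OF L N] by blast
    qed
    show "\<zeta> ` (V \<rightarrow>\<^sub>E {0..<int p}) = {z \<in> ext_coeffs p V w. degenerate_ext p V w (ext_form V w b z)}"
    proof (intro equalityI subsetI)
      fix z assume "z \<in> {z \<in> ext_coeffs p V w. degenerate_ext p V w (ext_form V w b z)}"
      then obtain x where z: "z \<in> ext_coeffs p V w" and x: "x w = 1" "int p dvd ?Q z x"
        "\<And>i. i \<in> V \<Longrightarrow> int p dvd polar ?V (ext_form V w b z) x (unit_vec i)"
        unfolding degenerate_ext_def by blast
      define L where "L = (\<lambda>i\<in>V. x i mod int p)"
      \<comment> \<open>Decompose \<open>y\<close> as \<open>u + y_w * x\<close> with
        \<open>u_w = 0\<close>. The value at \<open>x\<close> and the polar term vanish modulo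
        \<open>p\<close> since \<open>x\<close> is singular, so the value at \<open>y\<close> is
        \<open>Q_V(u)\<close>; equality of the coefficients then follows from that of the
        values.\<close>
      have "[?Q z y = ?Q (\<zeta> L) y] (mod int p)" for y
      proof -
        let ?u = "\<lambda>i. y i - y w * x i"
        have uw: "?u w = 0" using x(1) by simp
        have pol: "int p dvd polar ?V (ext_form V w b z) ?u x"
        proof -
          have "int p dvd ?u k * polar ?V (ext_form V w b z) (unit_vec k) x" if "k \<in> ?V" for k
          proof (cases "k = w")
            case False
            then have "int p dvd polar ?V (ext_form V w b z) (unit_vec k) x"
              using that x(3)[of k] polar_commute[of ?V _ "unit_vec k" x] by simp
            then show ?thesis by (rule dvd_mult)
          qed (simp only: uw mult_zero_left dvd_0_right)
          then have "int p dvd (\<Sum>k\<in>?V. ?u k * polar ?V (ext_form V w b z) (unit_vec k) x)"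
            by (rule dvd_sum)
          then show ?thesis
            by (subst polar_unit_vec_sum[OF finite.insertI[OF V(1)]])
        qed
        have "?Q z (\<lambda>i. ?u i + y w * x i) =
            ?Q z ?u + y w * polar ?V (ext_form V w b z) ?u x + (y w)\<^sup>2 * ?Q z x"
          by (rule qf_line)
        note line = this
        have arg: "(\<lambda>i. ?u i + y w * x i) = y" by (rule ext) simp
        have red: "?Q z ?u = qf V b ?u"
        proof -
          have "?Q z ?u = qf V (ext_form V w b z) ?u"
          proof (rule qf_supported)
            show "?u i = 0" if "i \<in> ?V - V" for i using that uw by auto
          qed (use V in auto)
          then show ?thesis using qV by (rule trans)
        qed
        have eq: "?Q z y = qf V b ?u + y w * polar ?V (ext_form V w b z) ?u x + (y w)\<^sup>2 * ?Q z x"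
          using line unfolding arg red .
        have 1: "[?Q z y = qf V b ?u] (mod int p)"
          unfolding cong_iff_dvd_diff eq
          using dvd_add[OF dvd_mult[OF pol, of "y w"] dvd_mult[OF x(2), of "(y w)\<^sup>2"]] by (simp only: add_diff_cancel_left' add.assoc)
        have 2: "[qf V b ?u = qf V b (\<lambda>i. y i - y w * L i)] (mod int p)"
        proof (rule qf_cong_mod[OF cong_refl])
          show "[?u i = y i - y w * L i] (mod int p)" if "i \<in> V" for i
            using that by (intro cong_diff cong_mult cong_refl) (simp add: L_def cong_def)
        qed
        show ?thesis
          by (rule cong_trans[OF 1 cong_trans[OF 2 cong_sym[OF key[of L y]]]])
      qed
      then have cong: "[ext_form V w b z ij = ext_form V w b (\<zeta> L) ij] (mod int p)" if "ij \<in> upairs ?V" for ij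
        by (rule coeffs_cong_of_qf_cong[OF finite.insertI[OF V(1)] _ that])
      have "z = \<zeta> L"
      proof (rule PiE_ext)
        show "z \<in> upair w ` ?V \<rightarrow>\<^sub>E {0..<int p}" using z by (simp only: ext_coeffs_def)
        show "\<zeta> L \<in> upair w ` ?V \<rightarrow>\<^sub>E {0..<int p}" using mem by (simp only: ext_coeffs_def)
        fix ij assume ij: "ij \<in> upair w ` ?V"
        then obtain i where i: "ij = upair w i" "i \<in> ?V" by blast
        have "upair w i \<in> upairs ?V" using i(2) unfolding upair_in_upairs_iff by blast
        then have "[ext_form V w b z (upair w i) = ext_form V w b (\<zeta> L) (upair w i)] (mod int p)" by (rule cong)
        then have "[z ij = \<zeta> L ij] (mod int p)"
          unfolding i(1) ext_form_simps(1)[OF i(2)] .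
        moreover have "z ij \<in> {0..<int p}" "\<zeta> L ij \<in> {0..<int p}"
          using PiE_mem[OF z[unfolded ext_coeffs_def] ij] PiE_mem[OF mem[unfolded ext_coeffs_def] ij] .
        ultimately show "z ij = \<zeta> L ij" by (simp add: cong_def)
      qed
      moreover have "L \<in> V \<rightarrow>\<^sub>E {0..<int p}" using p0 by (auto simp: L_def)
      ultimately show "z \<in> \<zeta> ` (V \<rightarrow>\<^sub>E {0..<int p})" by (rule image_eqI)
    next
      fix z assume "z \<in> \<zeta> ` (V \<rightarrow>\<^sub>E {0..<int p})"
      then obtain L where "z = \<zeta> L" by blast
      then show "z \<in> {z \<in> ext_coeffs p V w. degenerate_ext p V w (ext_form V w b z)}"
        using mem degen by blast
    qed
  qed
  then have "card {z \<in> ext_coeffs p V w. degenerate_ext p V w (ext_form V w b z)} = card (V \<rightarrow>\<^sub>E {0..<int p})"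
    by (rule bij_betw_same_card[symmetric])
  also have "\<dots> = p ^ card V" using V by (simp add: card_PiE)
  finally show ?thesis .
qed

section \<open>Binary forms and quadratic polynomials over the residue field\<close>

lemma card_ordered_pairs:
  "2 * card {(s, t). s \<in> {0..<int p} \<and> t \<in> {0..<int p} \<and> s \<le> t} = p * (p + 1)"
proof -
  let ?R = "{0..<int p}"
  let ?A = "{(s, t). s \<in> ?R \<and> t \<in> ?R \<and> s \<le> t}" and ?B = "{(s, t). s \<in> ?R \<and> t \<in> ?R \<and> t \<le> s}"
  have fin: "finite ?A" "finite ?B" by (rule finite_subset[of _ "?R \<times> ?R"], auto)+
  \<comment> \<open>The triangle and its mirror image cover the square and meet in the
    diagonal.\<close>
  have "bij_betw prod.swap ?A ?B" by (intro bij_betwI[where g = prod.swap]) auto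
  then have "card ?B = card ?A" by (rule bij_betw_same_card[symmetric])
  moreover have "?A \<union> ?B = ?R \<times> ?R" by auto
  then have "card (?A \<union> ?B) = p * p" by simp
  moreover have "?A \<inter> ?B = (\<lambda>s. (s, s)) ` ?R" by auto
  then have "card (?A \<inter> ?B) = p" by (simp add: card_image inj_on_def)
  ultimately show ?thesis using card_Un_Int[OF fin] by simp
qed

text \<open>By Vieta, the polynomials \<open>a t\<^sup>2 + \<beta> t + \<gamma>\<close> with a root correspond to multisets of two roots.\<close>

lemma card_rootless_quadratics:
  fixes a :: int
  assumes p: "prime p" and a: "\<not> int p dvd a"
  shows "2 * card {(\<beta>, \<gamma>). \<beta> \<in> {0..<int p} \<and> \<gamma> \<in> {0..<int p} \<and>
      (\<forall>t. \<not> int p dvd a * t\<^sup>2 + \<beta> * t + \<gamma>)} = p * (p - 1)"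
proof -
  have p0: "p > 0" using p prime_gt_0_nat by blast
  have pi: "prime (int p)" using p by simp
  let ?R = "{0..<int p}"
  let ?S = "{(s, t). s \<in> ?R \<and> t \<in> ?R \<and> s \<le> t}"
  let ?Y = "{(\<beta>, \<gamma>). \<beta> \<in> ?R \<and> \<gamma> \<in> ?R \<and> (\<exists>t. int p dvd a * t\<^sup>2 + \<beta> * t + \<gamma>)}"
  let ?N = "{(\<beta>, \<gamma>). \<beta> \<in> ?R \<and> \<gamma> \<in> ?R \<and> (\<forall>t. \<not> int p dvd a * t\<^sup>2 + \<beta> * t + \<gamma>)}"
  define \<phi> where "\<phi> = (\<lambda>(s, t). ((- a * (s + t)) mod int p, (a * s * t) mod int p))"
  have fac: "[a * x\<^sup>2 + \<beta> * x + \<gamma> = a * (x - s) * (x - t)] (mod int p)"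
    if "\<phi> (s, t) = (\<beta>, \<gamma>)" for s t \<beta> \<gamma> x
  proof -
    have "[a * x\<^sup>2 + \<beta> * x + \<gamma> = a * x\<^sup>2 + (- a * (s + t)) * x + a * s * t] (mod int p)"
      using that by (intro cong_add cong_mult cong_refl) (auto simp: \<phi>_def cong_def)
    also have "a * x\<^sup>2 + (- a * (s + t)) * x + a * s * t = a * (x - s) * (x - t)"
      by (simp add: power2_eq_square algebra_simps)
    finally show ?thesis .
  qed
  have eq_mod: "x = y" if "x \<in> ?R" "y \<in> ?R" "int p dvd x - y" for x y
  proof -
    have "x mod int p = y mod int p" using that(3) by (simp add: mod_eq_dvd_iff)
    then show ?thesis using that by simp
  qed
  have "bij_betw \<phi> ?S ?Y"
  proof (rule bij_betw_imageI)
    show "inj_on \<phi> ?S"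
    proof (rule inj_onI, clarify)
      fix s t s' t' assume R: "s \<in> ?R" "t \<in> ?R" "s' \<in> ?R" "t' \<in> ?R" and le: "s \<le> t" "s' \<le> t'"
        and eq: "\<phi> (s, t) = \<phi> (s', t')"
      obtain \<beta> \<gamma> where \<beta>: "\<phi> (s, t) = (\<beta>, \<gamma>)" by (cases "\<phi> (s, t)")
      \<comment> \<open>Equal coefficients give congruent factorizations. Evaluating them at the
        four roots shows that both pairs have the same underlying set, and the ordering then
        identifies them, double roots included.\<close>
      have fe: "[a * (x - s) * (x - t) = a * (x - s') * (x - t')] (mod int p)" for x
        using cong_trans[OF cong_sym[OF fac[OF \<beta>]] fac] eq \<beta> by metis
      have one: "x = s' \<or> x = t'" if "x \<in> ?R" "x = s \<or> x = t" for x
      proof -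
        have "int p dvd a * (x - s') * (x - t')"
          using fe[of x] that(2) cong_dvd_iff[OF fe[of x]] by auto
        then have "int p dvd x - s' \<or> int p dvd x - t'" using a pi by (simp add: prime_dvd_mult_iff)
        then show ?thesis using eq_mod that R by blast
      qed
      have two: "x = s \<or> x = t" if "x \<in> ?R" "x = s' \<or> x = t'" for x
      proof -
        have "int p dvd a * (x - s) * (x - t)"
          using that(2) cong_dvd_iff[OF fe[of x]] by auto
        then have "int p dvd x - s \<or> int p dvd x - t" using a pi by (simp add: prime_dvd_mult_iff)
        then show ?thesis using eq_mod that R by blast
      qed
      show "s = s' \<and> t = t'"
        using one[OF R(1)] one[OF R(2)] two[OF R(3)] two[OF R(4)] le by auto
    qed
    show "\<phi> ` ?S = ?Y"
    proof (intro equalityI subsetI)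
      fix y assume "y \<in> \<phi> ` ?S"
      then obtain s t \<beta> \<gamma> where y: "\<phi> (s, t) = y" "y = (\<beta>, \<gamma>)" by (metis (no_types, lifting) imageE surj_pair)
      then have "int p dvd a * s\<^sup>2 + \<beta> * s + \<gamma>" using cong_dvd_iff[OF fac[of s t \<beta> \<gamma> s]] by simp
      moreover have "\<beta> \<in> ?R" "\<gamma> \<in> ?R" using y p0 by (auto simp: \<phi>_def)
      ultimately show "y \<in> ?Y" using y by auto
    next
      fix y assume "y \<in> ?Y"
      then obtain \<beta> \<gamma> t where y: "y = (\<beta>, \<gamma>)" "\<beta> \<in> ?R" "\<gamma> \<in> ?R" and t: "int p dvd a * t\<^sup>2 + \<beta> * t + \<gamma>"
        by auto
      have "coprime a (int p)" using prime_imp_coprime[OF pi a] by (simp add: coprime_commute)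
      then obtain u where u: "[a * u = 1] (mod int p)" using cong_solve_coprime_int[of a "int p"] by auto
      \<comment> \<open>The second root comes from Vieta's sum \<open>- \<beta> / a\<close>, with
        \<open>u\<close> as the inverse of \<open>a\<close>.\<close>
      define t1 t2 where "t1 = t mod int p" and "t2 = (- \<beta> * u - t) mod int p"
      have t12: "t1 \<in> ?R" "t2 \<in> ?R" using p0 by (auto simp: t1_def t2_def)
      have c1: "[- a * (t1 + t2) = \<beta>] (mod int p)"
      proof -
        have "[- a * (t1 + t2) = - a * (t + (- \<beta> * u - t))] (mod int p)"
          by (intro cong_mult cong_add cong_refl) (simp_all add: t1_def t2_def cong_def)
        also have "- a * (t + (- \<beta> * u - t)) = \<beta> * (a * u)" by (simp add: algebra_simps)
        also have "[\<dots> = \<beta> * 1] (mod int p)" using u by (intro cong_mult cong_refl)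
        finally show ?thesis by simp
      qed
      have c2: "[a * t1 * t2 = \<gamma>] (mod int p)"
      proof -
        have "[a * t1 * t2 = a * t * (- \<beta> * u - t)] (mod int p)"
          by (intro cong_mult cong_refl) (simp_all add: t1_def t2_def cong_def)
        also have "a * t * (- \<beta> * u - t) = - \<beta> * t * (a * u) - a * t\<^sup>2"
          by (simp add: algebra_simps power2_eq_square)
        also have "[\<dots> = - \<beta> * t * 1 - a * t\<^sup>2] (mod int p)" using u by (intro cong_mult cong_diff cong_refl)
        also have "[- \<beta> * t * 1 - a * t\<^sup>2 = \<gamma>] (mod int p)"
        proof -
          have "- \<beta> * t * 1 - a * t\<^sup>2 - \<gamma> = - (a * t\<^sup>2 + \<beta> * t + \<gamma>)" by simp
          then show ?thesis unfolding cong_iff_dvd_diff using t by (metis dvd_minus_iff)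
        qed
        finally show ?thesis .
      qed
      have \<phi>12: "\<phi> (t1, t2) = y"
        using c1 c2 y by (simp add: \<phi>_def cong_def)
      have \<phi>21: "\<phi> (t2, t1) = y"
        using \<phi>12 by (simp add: \<phi>_def add.commute[of t2 t1] mult.assoc mult.commute[of t2 t1])
      show "y \<in> \<phi> ` ?S"
      proof (cases "t1 \<le> t2")
        case True
        then have "(t1, t2) \<in> ?S" using t12 by simp
        then show ?thesis unfolding \<phi>12[symmetric] by (rule imageI)
      next
        case False
        then have "(t2, t1) \<in> ?S" using t12 by simp
        then show ?thesis unfolding \<phi>21[symmetric] by (rule imageI)
      qed
    qed
  qed
  then have "card ?S = card ?Y" by (rule bij_betw_same_card)
  then have "2 * card ?Y = p * (p + 1)"
    using card_ordered_pairs[of p] by (simp only:)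
  moreover have "card ?Y + card ?N = p * p"
  proof -
    have "finite ?Y" "finite ?N" by (rule finite_subset[of _ "?R \<times> ?R"], auto)+
    moreover have "?Y \<inter> ?N = {}" by auto
    moreover have "?Y \<union> ?N = ?R \<times> ?R" by auto
    ultimately have "card ?Y + card ?N = card (?R \<times> ?R)" by (metis (no_types, lifting) card_Un_disjoint)
    then show ?thesis by simp
  qed
  ultimately have "2 * card ?N + p * (p + 1) = 2 * (p * p)" by linarith
  then show ?thesis by (simp add: algebra_simps)
qed

text \<open>Pigeonhole: for distinct \<open>x, y\<close> in \<open>{0..m}\<close> with
  \<open>p = 2 * m + 1\<close>, both \<open>|x - y|\<close> and \<open>x + y\<close> lie strictly
  between 0 and \<open>p\<close>, so their squares differ modulo \<open>p\<close>. Each side thus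
  takes at least \<open>m + 1\<close> of the \<open>2 * m + 1\<close> residues.\<close>

lemma square_values_meet:
  fixes D H :: int
  assumes p: "prime p" "odd p" and D: "\<not> int p dvd D"
  shows "\<exists>X Y. int p dvd Y\<^sup>2 - (D * X\<^sup>2 + H)"
proof (rule ccontr)
  assume no: "\<not> ?thesis"
  have p0: "p > 0" using p prime_gt_0_nat by blast
  have pi: "prime (int p)" using p by simp
  obtain m where m: "p = 2 * m + 1" using p(2) by (elim oddE)
  let ?T = "{0..int m}"
  have sq: "x = y" if "x \<in> ?T" "y \<in> ?T" "int p dvd x\<^sup>2 - y\<^sup>2" for x y
  proof (rule ccontr)
    assume "x \<noteq> y"
    have "x\<^sup>2 - y\<^sup>2 = (x - y) * (x + y)" by (simp add: power2_eq_square algebra_simps)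
    then have "int p dvd x - y \<or> int p dvd x + y" using that(3) pi by (metis prime_dvd_mult_iff)
    then have "int p dvd \<bar>x - y\<bar> \<or> int p dvd x + y" by simp
    moreover have "0 < \<bar>x - y\<bar>" "\<bar>x - y\<bar> < int p" "0 < x + y" "x + y < int p"
      using \<open>x \<noteq> y\<close> that(1,2) m by auto
    ultimately show False using zdvd_not_zless by blast
  qed
  define F G where "F = (\<lambda>y. y\<^sup>2 mod int p)" and "G = (\<lambda>x. (D * x\<^sup>2 + H) mod int p)"
  have "inj_on F ?T" by (intro inj_onI sq) (auto simp: F_def mod_eq_dvd_iff)
  moreover have "inj_on G ?T"
  proof (intro inj_onI sq)
    fix x y assume "G x = G y"
    then have "int p dvd D * (x\<^sup>2 - y\<^sup>2)" by (simp add: G_def mod_eq_dvd_iff right_diff_distrib)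
    then show "int p dvd x\<^sup>2 - y\<^sup>2" using D pi by (simp add: prime_dvd_mult_iff)
  qed
  ultimately have "card (F ` ?T) = m + 1" "card (G ` ?T) = m + 1" by (simp_all add: card_image)
  moreover have "F ` ?T \<inter> G ` ?T = {}"
    using no by (auto simp: F_def G_def mod_eq_dvd_iff)
  then have "card (F ` ?T \<union> G ` ?T) = card (F ` ?T) + card (G ` ?T)" by (intro card_Un_disjoint) auto
  moreover have "card (F ` ?T \<union> G ` ?T) \<le> card {0..<int p}"
    using p0 by (intro card_mono) (auto simp: F_def G_def)
  ultimately show False using m by simp
qed

text \<open>
  After completing squares, solvability of the affine equation becomes the statement that two sets
  of \<open>(p + 1) / 2\<close> residues meet; \<open>p = 2\<close> is a parity check.
\<close>

lemma aniso_binary_affine_zero: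
  fixes a b c d e f :: int
  assumes p: "prime p" and an: "\<And>x y. int p dvd a * x\<^sup>2 + b * x * y + c * y\<^sup>2 \<Longrightarrow> int p dvd x \<and> int p dvd y"
  shows "\<exists>x y. int p dvd a * x\<^sup>2 + b * x * y + c * y\<^sup>2 + d * x + e * y + f"
proof (cases "p = 2")
  case True
  have "odd a" "odd c" "odd (a + b + c)"
    using an[of 1 0] an[of 0 1] an[of 1 1] True by auto
  then have "even (a * x\<^sup>2 + b * x * y + c * y\<^sup>2 + d * x + e * y + f)
     \<longleftrightarrow> even (x + x * y + y + d * x + e * y + f)" for x y
    by auto
  \<comment> \<open>If the values at \<open>(0,0)\<close>, \<open>(1,0)\<close> and
    \<open>(0,1)\<close> are odd, then \<open>f\<close>, \<open>d\<close> and \<open>e\<close> are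
    odd and the value at \<open>(1,1)\<close> is even.\<close>
  then have "\<exists>x\<in>{0, 1}. \<exists>y\<in>{0, 1}. even (a * x\<^sup>2 + b * x * y + c * y\<^sup>2 + d * x + e * y + f)"
    by (simp only:) auto
  then show ?thesis using True by auto
next
  case False
  then have odd: "odd p" using p prime_odd_nat by (metis primes_dvd_imp_eq two_is_prime_nat)
  have pi: "prime (int p)" using p by simp
  have p1: "\<not> int p dvd 1" using p prime_gt_1_nat[of p] by auto
  have "\<not> int p dvd 2" using odd False p pi
    by (metis int_dvd_int_iff of_nat_numeral primes_dvd_imp_eq two_is_prime_nat)
  moreover have a: "\<not> int p dvd a" using an[of 1 0] p1 by auto
  ultimately have a2: "\<not> int p dvd 2 * a" "\<not> int p dvd 4 * a"
    using pi prime_dvd_mult_iff[of "int p" 2 "2 * a"] by (auto simp: prime_dvd_mult_iff)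
  define D where "D = b\<^sup>2 - 4 * a * c"
  have D: "\<not> int p dvd D"
  proof
    assume "int p dvd D"
    \<comment> \<open>\<open>- a * D\<close> is the value of the form at
      \<open>(- b, 2 * a)\<close>, whose second entry is a unit.\<close>
    then have "int p dvd - a * D" by simp
    also have "- a * D = a * (- b)\<^sup>2 + b * (- b) * (2 * a) + c * (2 * a)\<^sup>2"
      by (simp add: D_def power2_eq_square algebra_simps)
    finally show False using an a2(1) by blast
  qed
  \<comment> \<open>Completing the square in \<open>x\<close> gives \<open>4 * a * F = (2 * a * x +
    b * y + d)^2 - (D * y^2 + 2 * E * y + G)\<close>. Multiplying by \<open>D\<close> and completing
    the square in \<open>y\<close> leaves the constant \<open>E^2 - D * G\<close>.\<close>
  define E G where "E = b * d - 2 * a * e" and "G = d\<^sup>2 - 4 * a * f"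
  obtain X Y where XY: "int p dvd Y\<^sup>2 - (D * X\<^sup>2 + (E\<^sup>2 - D * G))"
    using square_values_meet[OF p odd D] by blast
  have inv: "\<exists>u. [v * u = z] (mod int p)" if "\<not> int p dvd v" for v z
  proof -
    have "coprime v (int p)" using prime_imp_coprime[OF pi that] by (simp add: coprime_commute)
    then obtain u where "[v * u = 1] (mod int p)" using cong_solve_coprime_int[of v "int p"] by auto
    then have "[v * u * z = 1 * z] (mod int p)" by (intro cong_mult cong_refl)
    then show ?thesis by (metis mult.assoc mult_1)
  qed
  obtain y where y: "[D * y = Y - E] (mod int p)" using inv[OF D] by blast
  obtain x where x: "[2 * a * x = X - b * y - d] (mod int p)" using inv[OF a2(1)] by blast
  let ?F = "a * x\<^sup>2 + b * x * y + c * y\<^sup>2 + d * x + e * y + f"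
  have "4 * a * D * ?F = D * (2 * a * x + b * y + d)\<^sup>2 - ((D * y + E)\<^sup>2 - (E\<^sup>2 - D * G))"
    by (simp add: D_def E_def G_def power2_eq_square algebra_simps)
  also have "[\<dots> = D * X\<^sup>2 - (Y\<^sup>2 - (E\<^sup>2 - D * G))] (mod int p)"
  proof (intro cong_diff cong_mult cong_pow cong_refl)
    show "[2 * a * x + b * y + d = X] (mod int p)"
      using x by (simp add: cong_iff_dvd_diff algebra_simps)
    show "[D * y + E = Y] (mod int p)" using y by (simp add: cong_iff_dvd_diff algebra_simps)
  qed
  also have "[D * X\<^sup>2 - (Y\<^sup>2 - (E\<^sup>2 - D * G)) = 0] (mod int p)"
  proof -
    have "D * X\<^sup>2 - (Y\<^sup>2 - (E\<^sup>2 - D * G)) = - (Y\<^sup>2 - (D * X\<^sup>2 + (E\<^sup>2 - D * G)))" by simp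
    then show ?thesis unfolding cong_0_iff using XY by (metis dvd_minus_iff)
  qed
  finally have "int p dvd (4 * a) * (D * ?F)" by (simp only: cong_0_iff mult.assoc)
  then have "int p dvd ?F" using a2(2) D pi prime_dvd_mult_iff by blast
  then show ?thesis by blast
qed

definition ext_frac :: "nat \<Rightarrow> nat \<Rightarrow> real" where
  "ext_frac p s = (if s = 0 then 1 - 1 / p else if s = 1 then (real p - 1) / (2 * p) else 0)"

text \<open>As the block on \<open>V\<close> is anisotropic, only zeros with \<open>x w = 1\<close>
  matter, which dehomogenizes the question. For \<open>|V| = 0\<close> the new coefficient must be
  nonzero; for \<open>|V| = 1\<close> a quadratic polynomial with fixed leading coefficient must
  have no root; for \<open>|V| = 2\<close> an affine equation with anisotropic quadratic part always
  has a solution.\<close>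

lemma card_aniso_ext:
  assumes p: "prime p" and V: "finite V" "w \<notin> V" "card V \<le> 2" and an: "aniso_mod p 1 V b"
  shows "real (card {z \<in> ext_coeffs p V w. aniso_mod p 1 (insert w V) (ext_form V w b z)}) =
    ext_frac p (card V) * real p ^ Suc (card V)"
proof -
  have p0: "p > 0" and p1: "p > 1" using p prime_gt_0_nat prime_gt_1_nat by blast+
  have pi: "prime (int p)" using p by simp
  have iff: "aniso_mod p 1 (insert w V) c \<longleftrightarrow> (\<forall>x. x w = 1 \<longrightarrow> \<not> int p dvd qf (insert w V) c x)"
    if c: "aniso_mod p 1 V c" for c
  proof
    assume *: "aniso_mod p 1 (insert w V) c"
    show "\<forall>x. x w = 1 \<longrightarrow> \<not> int p dvd qf (insert w V) c x"
    proof (intro allI impI notI)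
      fix x assume x: "x w = 1" "int p dvd qf (insert w V) c x"
      have "int p dvd x w" using spec[OF *[unfolded aniso_mod_def], of x] x(2) by simp
      then show False using x(1) p1 by simp
    qed
  qed (use ext_zero[OF p V(1,2) c] in blast)
  note iff' = iff[OF iffD2[OF aniso_mod_ext_form[OF V(2)] an]]
  consider "card V = 0" | "card V = 1" | "card V = 2" using V(3) by linarith
  then show ?thesis
  proof cases
    case 1
    then have V0: "V = {}" using V by simp
    have "{z \<in> ext_coeffs p V w. aniso_mod p 1 (insert w V) (ext_form V w b z)} =
      {z \<in> {(w, w)} \<rightarrow>\<^sub>E {0..<int p}. z (w, w) \<noteq> 0}"
    proof -
      have "aniso_mod p 1 (insert w V) (ext_form V w b z) \<longleftrightarrow> z (w, w) \<noteq> 0"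
        if z: "z \<in> {(w, w)} \<rightarrow>\<^sub>E {0..<int p}" for z
      proof -
        have "qf (insert w V) (ext_form V w b z) x = z (w, w)" if "x w = 1" for x
          using that by (simp add: V0 qf_insert ext_form_def upair_def)
        note q = this
        have "aniso_mod p 1 (insert w V) (ext_form V w b z) \<longleftrightarrow> \<not> int p dvd z (w, w)"
          unfolding iff'
        proof
          assume "\<forall>x. x w = 1 \<longrightarrow> \<not> int p dvd qf (insert w V) (ext_form V w b z) x"
          from spec[OF this, of "\<lambda>_. 1"] show "\<not> int p dvd z (w, w)" by (simp add: q)
        qed (simp add: q)
        also have "\<dots> \<longleftrightarrow> z (w, w) \<noteq> 0"
        proof (cases "z (w, w) = 0")
          case False
          have "z (w, w) \<in> {0..<int p}" by (rule PiE_mem[OF z]) simp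
          then have "\<not> int p dvd z (w, w)" using False by (intro zdvd_not_zless) auto
          then show ?thesis using False by simp
        qed simp
        finally show ?thesis .
      qed
      note iff_nz = this
      have E: "ext_coeffs p V w = {(w, w)} \<rightarrow>\<^sub>E {0..<int p}"
        by (simp add: ext_coeffs_def V0 upair_def)
      show ?thesis unfolding E by (intro Collect_cong conj_cong refl iff_nz)
    qed
    also have "\<dots> = {(w, w)} \<rightarrow>\<^sub>E {1..<int p}"
    proof (intro equalityI subsetI)
      fix z assume "z \<in> {z \<in> {(w, w)} \<rightarrow>\<^sub>E {0..<int p}. z (w, w) \<noteq> 0}"
      then show "z \<in> {(w, w)} \<rightarrow>\<^sub>E {1..<int p}" by (simp add: PiE_iff)
    qed (simp add: PiE_iff)
    finally have "card {z \<in> ext_coeffs p V w. aniso_mod p 1 (insert w V) (ext_form V w b z)} = p - 1"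
      by (simp add: card_PiE nat_diff_distrib)
    then have "real (card {z \<in> ext_coeffs p V w. aniso_mod p 1 (insert w V) (ext_form V w b z)}) = real p - 1"
      using p0 by (simp add: of_nat_diff)
    moreover have "ext_frac p (card V) * real p ^ Suc (card V) = real p - 1"
      using p0 1 by (simp add: ext_frac_def left_diff_distrib)
    ultimately show ?thesis by (rule trans[OF _ sym])
  next
    case 2
    then obtain v where v: "V = {v}" by (auto simp: card_1_singleton_iff)
    have vw: "v \<noteq> w" using V v by auto
    define a where "a = b (v, v)"
    have a: "\<not> int p dvd a"
    proof
      assume "int p dvd a"
      then have "int p dvd qf V b (\<lambda>_. 1)" by (simp add: v qf_insert a_def upair_def)
      then show False using spec[OF an[unfolded aniso_mod_def], of "\<lambda>_. 1"] p1 v by simp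
    qed
    let ?N = "{(\<beta>, \<gamma>). \<beta> \<in> {0..<int p} \<and> \<gamma> \<in> {0..<int p} \<and> (\<forall>t. \<not> int p dvd a * t\<^sup>2 + \<beta> * t + \<gamma>)}"
    let ?C = "{z \<in> ext_coeffs p V w. aniso_mod p 1 (insert w V) (ext_form V w b z)}"
    have prne: "upair w w \<noteq> upair w v" using vw inj_upair[of w] by (auto simp: inj_eq)
    have idx: "upair w ` insert w V = {upair w w, upair w v}" using v by auto
    have an_iff: "aniso_mod p 1 (insert w V) (ext_form V w b z) \<longleftrightarrow>
       (\<forall>t. \<not> int p dvd a * t\<^sup>2 + z (upair w v) * t + z (upair w w))" for z
    proof -
      have zw: "ext_form V w b z (upair w w) = z (upair w w)" "ext_form V w b z (upair w v) = z (upair w v)"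
        by (rule ext_form_simps, simp add: v)+
      have "ext_form V w b z (v, v) = a"
        unfolding a_def using V v by (intro ext_form_simps) (auto simp: upairs_def)
      then have "qf (insert w V) (ext_form V w b z) x = a * (x v)\<^sup>2 + z (upair w v) * x v + z (upair w w)" if "x w = 1" for x
        using that vw zw unfolding v by (simp add: qf_insert) (simp add: upair_def)
      note q = this
      show ?thesis unfolding iff'
      proof (intro iffI allI impI)
        fix t assume "\<forall>x. x w = 1 \<longrightarrow> \<not> int p dvd qf (insert w V) (ext_form V w b z) x"
        from spec[OF this, of "\<lambda>i. if i = w then 1 else t"]
        have "\<not> int p dvd qf (insert w V) (ext_form V w b z) (\<lambda>i. if i = w then 1 else t)"
          by (simp only: refl if_True simp_thms)
        then show "\<not> int p dvd a * t\<^sup>2 + z (upair w v) * t + z (upair w w)"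
          using q[of "\<lambda>i. if i = w then 1 else t"] vw by simp
      qed (simp add: q)
    qed
    let ?f = "\<lambda>z. (z (upair w v), z (upair w w))"
    let ?g = "\<lambda>(\<beta>, \<gamma>). (\<lambda>ij\<in>{upair w w, upair w v}. if ij = upair w v then \<beta> else \<gamma>)"
    have C: "?C = {z \<in> {upair w w, upair w v} \<rightarrow>\<^sub>E {0..<int p}. \<forall>t. \<not> int p dvd a * t\<^sup>2 + z (upair w v) * t + z (upair w w)}"
      unfolding an_iff ext_coeffs_def idx ..
    have "bij_betw ?f ?C ?N"
      unfolding C
    proof (rule bij_betwI[where g = ?g])
      show "?f \<in> {z \<in> {upair w w, upair w v} \<rightarrow>\<^sub>E {0..<int p}. \<forall>t. \<not> int p dvd a * t\<^sup>2 + z (upair w v) * t + z (upair w w)} \<rightarrow> ?N"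
        by (rule Pi_I) (simp add: PiE_iff)
      show "?g \<in> ?N \<rightarrow> {z \<in> {upair w w, upair w v} \<rightarrow>\<^sub>E {0..<int p}. \<forall>t. \<not> int p dvd a * t\<^sup>2 + z (upair w v) * t + z (upair w w)}"
        using prne by (intro Pi_I) (simp add: PiE_iff split: prod.splits)
      show "?g (?f z) = z"
        if "z \<in> {z \<in> {upair w w, upair w v} \<rightarrow>\<^sub>E {0..<int p}. \<forall>t. \<not> int p dvd a * t\<^sup>2 + z (upair w v) * t + z (upair w w)}" for z
      proof -
        have "z \<in> extensional {upair w w, upair w v}" using that by (simp add: PiE_iff)
        then have "z ij = undefined" if "ij \<noteq> upair w w" "ij \<noteq> upair w v" for ij
          using that by (intro extensional_arb) auto
        then show ?thesis by (intro ext) (auto simp: restrict_def)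
      qed
      show "?f (?g y) = y" for y
        using prne by (simp split: prod.split)
    qed
    then have "card ?C = card ?N" by (rule bij_betw_same_card)
    have real_p: "real (p - 1) = real p - 1" using p0 by (simp add: of_nat_diff)
    from \<open>card ?C = card ?N\<close> have "2 * card ?C = p * (p - 1)" by (simp only: card_rootless_quadratics[OF p a])
    then have "real (2 * card ?C) = real (p * (p - 1))" by (simp only:)
    then have "2 * real (card ?C) = real p * (real p - 1)"
      unfolding of_nat_mult of_nat_numeral real_p .
    then have "real (card ?C) = real p * (real p - 1) / 2" by simp
    also have "\<dots> = ext_frac p (card V) * real p ^ Suc (card V)"
      using p0 2 by (simp add: ext_frac_def)
    finally show ?thesis .
  next
    case 3
    then obtain u v where uv: "V = {u, v}" "u \<noteq> v" by (auto simp: card_2_iff)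
    have ne: "u \<noteq> w" "v \<noteq> w" using V uv by auto
    have qV: "qf V c x = c (v, v) * (x v)\<^sup>2 + c (upair u v) * x v * x u + c (u, u) * (x u)\<^sup>2" for c x
      using uv by (simp add: qf_insert upair_def[of u u] upair_def[of v v] algebra_simps)
    have "\<not> aniso_mod p 1 (insert w V) (ext_form V w b z)" for z
    proof -
      let ?c = "ext_form V w b z"
      have "int p dvd x \<and> int p dvd y" if "int p dvd ?c (v, v) * x\<^sup>2 + ?c (upair u v) * x * y + ?c (u, u) * y\<^sup>2" for x y
      proof -
        let ?y = "\<lambda>i. if i = v then x else y"
        have "qf V ?c ?y = ?c (v, v) * x\<^sup>2 + ?c (upair u v) * x * y + ?c (u, u) * y\<^sup>2"
          unfolding qV using uv(2) by simp
        with that have "int p ^ 1 dvd qf V ?c ?y" by simp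
        then have *: "\<forall>i\<in>V. int p dvd ?y i"
          by (rule spec[OF iffD2[OF aniso_mod_ext_form[OF V(2)] an, unfolded aniso_mod_def], THEN mp])
        show ?thesis using bspec[OF *, of v] bspec[OF *, of u] uv by simp
      qed
      then obtain x y where xy: "int p dvd ?c (v, v) * x\<^sup>2 + ?c (upair u v) * x * y + ?c (u, u) * y\<^sup>2 + ?c (upair w v) * x + ?c (upair w u) * y + ?c (upair w w)"
        using aniso_binary_affine_zero[OF p, of "?c (v, v)" "?c (upair u v)" "?c (u, u)"] by blast
      let ?x = "\<lambda>i. if i = w then 1 else if i = v then x else y"
      have "qf (insert w V) ?c ?x = ?c (v, v) * x\<^sup>2 + ?c (upair u v) * x * y + ?c (u, u) * y\<^sup>2 + ?c (upair w v) * x + ?c (upair w u) * y + ?c (upair w w)"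
      proof -
        have "(\<Sum>i\<in>V. ?c (upair w i) * ?x w * ?x i) = ?c (upair w v) * x + ?c (upair w u) * y"
          unfolding uv(1) using uv(2) ne by simp
        then show ?thesis
          unfolding qf_insert[OF V(1,2)] qV using uv(2) ne by simp
      qed
      then have "int p dvd qf (insert w V) ?c ?x" using xy by (simp only:)
      then show ?thesis unfolding iff' by (intro notI) (drule spec[of _ ?x], simp)
    qed
    then show ?thesis using 3 by (simp add: ext_frac_def)
  qed
qed

section \<open>Limits and uniqueness\<close>

definition aniso_limit :: "nat \<Rightarrow> nat set \<Rightarrow> (nat \<times> nat \<Rightarrow> int) \<Rightarrow> (nat \<times> nat \<Rightarrow> nat) \<Rightarrow> real" where
  "aniso_limit p I b e = lim (\<lambda>k. aniso_frac p k I b e)"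

text \<open>The proportions are bounded by 1 and increase once \<open>k\<close> has reached all
  prescribed exponents, hence the shift by 2.\<close>

lemma aniso_frac_tendsto:
  assumes "p > 0" "finite I" "\<And>ij. e ij \<le> 2"
  shows "(\<lambda>k. aniso_frac p k I b e) \<longlonglongrightarrow> aniso_limit p I b e"
proof -
  have "e ij \<le> k + 2" for ij k using assms(3)[of ij] by simp
  then have "aniso_frac p (k + 2) I b e \<le> aniso_frac p (Suc (k + 2)) I b e" for k
    by (intro aniso_frac_Suc_ge assms(1,2))
  then have "incseq (\<lambda>k. aniso_frac p (k + 2) I b e)" by (intro incseq_SucI) simp
  then obtain L where "(\<lambda>k. aniso_frac p (k + 2) I b e) \<longlonglongrightarrow> L"
    by (rule incseq_convergent[of _ 1]) (simp_all add: aniso_frac_le_1[OF assms(2)])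
  then have "(\<lambda>k. aniso_frac p k I b e) \<longlonglongrightarrow> L" by (rule LIMSEQ_offset)
  then have "convergent (\<lambda>k. aniso_frac p k I b e)" by (rule convergentI)
  then show ?thesis unfolding aniso_limit_def by (simp only: convergent_LIMSEQ_iff)
qed

lemma aniso_limit_eqI:
  assumes "p > 0" "finite I" "\<And>ij. e ij \<le> 2" "X \<longlonglongrightarrow> l" "\<And>k. k \<ge> 2 \<Longrightarrow> aniso_frac p k I b e = X k"
  shows "aniso_limit p I b e = l"
proof -
  have "eventually (\<lambda>k. aniso_frac p k I b e = X k) sequentially"
    using assms(5) unfolding eventually_sequentially by blast
  then have "(\<lambda>k. aniso_frac p k I b e) \<longlonglongrightarrow> l"
    by (rule iffD2[OF tendsto_cong assms(4)])
  with aniso_frac_tendsto[OF assms(1-3)] show ?thesis by (rule LIMSEQ_unique)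
qed

abbreviation state_limit :: "nat \<Rightarrow> nat set \<Rightarrow> nat set \<Rightarrow> nat set \<Rightarrow> nat set \<Rightarrow> (nat \<times> nat \<Rightarrow> int) \<Rightarrow> real" where
  "state_limit p U V R W b \<equiv> aniso_limit p (U \<union> V \<union> R \<union> W) b (type_exp U W)"

lemma state_limit_terminal:
  assumes "p > 0" "is_state p U V {} {} b"
  shows "state_limit p U V {} {} b = 1"
proof (rule aniso_limit_eqI[OF assms(1)])
  show "finite (U \<union> V \<union> {} \<union> {})" using assms(2) by (simp add: is_state_def)
  show "(\<lambda>k. 1 :: real) \<longlonglongrightarrow> 1" by simp
qed (rule type_exp_le_2, rule state_frac_terminal[OF assms])

text \<open>Passing to the limit absorbs the digit lost in
  \<open>state_frac_rescale\<close>.\<close>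

lemma state_limit_rescale:
  assumes p: "prime p" and st: "is_state p U V R {} b"
  shows "state_limit p U V R {} b = state_limit p V U {} R (rescale p V b)"
proof -
  have p0: "p > 0" using p prime_gt_0_nat by blast
  have fin: "finite (U \<union> V \<union> R \<union> {})" using st by (simp add: is_state_def)
  have "(\<lambda>k. state_frac p (Suc k) U V R {} b) \<longlonglongrightarrow> state_limit p U V R {} b"
    by (rule LIMSEQ_Suc) (rule aniso_frac_tendsto[OF p0 fin type_exp_le_2])
  moreover have "eventually (\<lambda>k. state_frac p (Suc k) U V R {} b = state_frac p k V U {} R (rescale p V b)) sequentially"
    using state_frac_rescale[OF p st] unfolding eventually_sequentially by blast
  then have "(\<lambda>k. state_frac p (Suc k) U V R {} b) \<longlonglongrightarrow> state_limit p U V R {} b \<longleftrightarrow>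
      (\<lambda>k. state_frac p k V U {} R (rescale p V b)) \<longlonglongrightarrow> state_limit p U V R {} b"
    by (rule tendsto_cong)
  ultimately have "(\<lambda>k. state_frac p k V U {} R (rescale p V b)) \<longlonglongrightarrow> state_limit p U V R {} b"
    by (simp only:)
  moreover have "(\<lambda>k. state_frac p k V U {} R (rescale p V b)) \<longlonglongrightarrow> state_limit p V U {} R (rescale p V b)"
    using fin by (intro aniso_frac_tendsto p0 type_exp_le_2) auto
  ultimately show ?thesis by (rule LIMSEQ_unique)
qed

lemma state_limit_step:
  assumes p: "prime p" and st: "is_state p U V R (insert w W) b" and w: "w \<notin> W"
  defines "b' \<equiv> (\<lambda>ij. if ij \<in> upair w ` R then 0 else b ij)"
  shows "state_limit p U V R (insert w W) b =
      (\<Sum>z\<in>ext_coeffs p V w. aniso_limit p (insert w (U \<union> V \<union> R \<union> W)) (ext_form V w b' z) (type_exp U W))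
      / real p ^ Suc (card V) / real p ^ card R"
    and "is_prestate p U V R w W (ext_form V w b' z)"
proof -
  have p0: "p > 0" using p prime_gt_0_nat by blast
  have eq: "ext_form V w b' = (\<lambda>z ij. if ij \<in> upair w ` insert w V then z ij else if ij \<in> upair w ` R then 0 else b ij)"
    unfolding ext_form_def b'_def by (rule refl)
  show "is_prestate p U V R w W (ext_form V w b' z)"
    unfolding eq by (rule state_frac_step(2)[OF p st w order_refl])
  have fin: "finite (insert w (U \<union> V \<union> R \<union> W))" using st by (simp add: is_state_def)
  show "state_limit p U V R (insert w W) b =
      (\<Sum>z\<in>ext_coeffs p V w. aniso_limit p (insert w (U \<union> V \<union> R \<union> W)) (ext_form V w b' z) (type_exp U W))
      / real p ^ Suc (card V) / real p ^ card R"
  proof (rule aniso_limit_eqI[OF p0])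
    show "(\<lambda>k. (\<Sum>z\<in>ext_coeffs p V w. aniso_frac p k (insert w (U \<union> V \<union> R \<union> W)) (ext_form V w b' z) (type_exp U W))
        / real p ^ Suc (card V) / real p ^ card R) \<longlonglongrightarrow>
      (\<Sum>z\<in>ext_coeffs p V w. aniso_limit p (insert w (U \<union> V \<union> R \<union> W)) (ext_form V w b' z) (type_exp U W))
        / real p ^ Suc (card V) / real p ^ card R"
      using p0 by (intro tendsto_divide tendsto_const tendsto_sum aniso_frac_tendsto[OF p0 fin type_exp_le_2]) simp_all
    show "state_frac p k U V R (insert w W) b =
      (\<Sum>z\<in>ext_coeffs p V w. aniso_frac p k (insert w (U \<union> V \<union> R \<union> W)) (ext_form V w b' z) (type_exp U W))
        / real p ^ Suc (card V) / real p ^ card R" if "k \<ge> 2" for k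
      unfolding ext_coeffs_def eq by (rule state_frac_step(1)[OF p st w that])
  qed (use fin in \<open>simp_all add: type_exp_le_2\<close>)
qed

lemma prestate_limit_smooth:
  assumes p: "prime p" and st: "is_prestate p U V R w W b"
    and "int p dvd qf (insert w V) b x" "\<not> int p dvd polar (insert w V) b x y"
  shows "aniso_limit p (insert w (U \<union> V \<union> R \<union> W)) b (type_exp U W) = 0"
proof (rule aniso_limit_eqI)
  show "(\<lambda>k. 0 :: real) \<longlonglongrightarrow> 0" by simp
qed (use p st prestate_smooth[OF assms] in \<open>simp_all add: type_exp_le_2 is_prestate_def prime_gt_0_nat\<close>)

lemma prestate_limit_degenerate:
  assumes p: "prime p" and st: "is_prestate p U V R w W b" and deg: "degenerate_ext p V w b"
  shows "\<exists>b0. is_state p U V (insert w R) W b0 \<and>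
    aniso_limit p (insert w (U \<union> V \<union> R \<union> W)) b (type_exp U W) = state_limit p U V (insert w R) W b0"
proof -
  let ?b0 = "\<lambda>ij. if ij \<in> upair w ` insert w V then 0 else b ij"
  have p0: "p > 0" using p prime_gt_0_nat by blast
  have fin: "finite (insert w (U \<union> V \<union> R \<union> W))" using st by (simp add: is_prestate_def)
  have I: "U \<union> V \<union> insert w R \<union> W = insert w (U \<union> V \<union> R \<union> W)" by auto
  have "aniso_limit p (insert w (U \<union> V \<union> R \<union> W)) b (type_exp U W) =
      aniso_limit p (insert w (U \<union> V \<union> R \<union> W)) ?b0 (type_exp U W)"
    by (rule aniso_limit_eqI[OF p0 fin type_exp_le_2 aniso_frac_tendsto[OF p0 fin type_exp_le_2]])
       (rule prestate_degenerate(2)[OF p st deg])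
  then show ?thesis
    using prestate_degenerate(1)[OF p st deg order_refl] unfolding I by blast
qed

text \<open>
  Among the steps that keep \<open>|R| + |W|\<close>, moving a variable from \<open>W\<close> to \<open>R\<close> has probability at
  most \<open>1 / p\<close>, so the recursion contracts and determines its bounded solution.
\<close>

lemma state_limit_eq:
  fixes g :: "nat \<Rightarrow> nat \<Rightarrow> nat \<Rightarrow> nat \<Rightarrow> real"
  assumes p: "prime p"
    and g_terminal: "\<And>r s. r \<le> 2 \<Longrightarrow> s \<le> 2 \<Longrightarrow> r + s = n \<Longrightarrow> g r s 0 0 = 1"
    and g_rescale: "\<And>r s \<rho>. r \<le> 2 \<Longrightarrow> s \<le> 2 \<Longrightarrow> r + s + \<rho> = n \<Longrightarrow> g r s \<rho> 0 = g s r 0 \<rho>"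
    and g_step: "\<And>r s \<rho> m. r \<le> 2 \<Longrightarrow> s \<le> 2 \<Longrightarrow> r + s + \<rho> + Suc m = n \<Longrightarrow>
      g r s \<rho> (Suc m) = (g r s (Suc \<rho>) m / p + ext_frac p s * g r (Suc s) \<rho> m) / real p ^ \<rho>"
    and "is_state p U V R W b" "card U \<le> 2" "card V \<le> 2" "card U + card V + card R + card W = n"
  shows "state_limit p U V R W b = g (card U) (card V) (card R) (card W)"
  using assms(5-8)
proof (induction "card R + card W" arbitrary: U V R W b rule: less_induct)
  case less
  define t where "t = card R + card W"
  have p0: "p > 0" and p1: "real p > 1" using p prime_gt_0_nat prime_gt_1_nat by auto
  \<comment> \<open>States with the current value of \<open>|R| + |W|\<close>; smaller values are
    covered by the outer induction. \<open>D\<close> is the error of the claimed value, and the aim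
    is to contract a common bound for it to 0.\<close>
  define Q where "Q = (\<lambda>U V R W b. is_state p U V R W b \<and> card U \<le> 2 \<and> card V \<le> 2 \<and>
    card U + card V + card R + card W = n \<and> card R + card W = t)"
  define D where "D = (\<lambda>U V R W b. \<bar>state_limit p U V R W b - g (card U) (card V) (card R) (card W)\<bar>)"
  have IH: "state_limit p U V R W b = g (card U) (card V) (card R) (card W)"
    if "is_state p U V R W b" "card U \<le> 2" "card V \<le> 2" "card U + card V + card R + card W = n"
      "card R + card W < t" for U V R W b
    using less.hyps[of R W U V b] that by (simp add: t_def)
  show ?case
  proof (cases "t = 0")
    case True
    then have "R = {}" "W = {}"
      using less.prems(1) by (auto simp: t_def is_state_def)
    then show ?thesis using state_limit_terminal[OF p0, of U V b] less.prems g_terminal[of "card U" "card V"] by simp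
  next
    case False
    \<comment> \<open>Smooth extensions contribute 0 and anisotropic ones lower
      \<open>|R| + |W|\<close>, so they carry no error. Only the degenerate extensions do, and they
      make up \<open>p^s\<close> of the \<open>p^(s+1)\<close> possibilities.\<close>
    have step: "D U V R W b \<le> B / p"
      if B: "\<And>U V R W b. Q U V R W b \<Longrightarrow> D U V R W b \<le> B" and q: "Q U V R W b" "W \<noteq> {}" for U V R W b B
    proof -
      obtain w W' where w: "W = insert w W'" "w \<notin> W'" using q(2) by (meson mk_disjoint_insert ex_in_conv)
      define b' where "b' = (\<lambda>ij. if ij \<in> upair w ` R then 0 else b ij)"
      have st: "is_state p U V R (insert w W') b" using q(1) w by (simp add: Q_def)
      then have fin: "finite U" "finite V" "finite R" "finite W'" and wn: "w \<notin> U" "w \<notin> V" "w \<notin> R"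
        by (auto simp: is_state_def)
      let ?r = "card U" and ?s = "card V" and ?\<rho> = "card R" and ?m = "card W'"
      have rs: "?r \<le> 2" "?s \<le> 2" "?r + ?s + ?\<rho> + Suc ?m = n" "?\<rho> + Suc ?m = t"
        using q(1) w fin by (auto simp: Q_def)
      let ?a = "\<lambda>z. aniso_limit p (insert w (U \<union> V \<union> R \<union> W')) (ext_form V w b' z) (type_exp U W')"
      let ?Z = "ext_coeffs p V w"
      let ?A = "{z \<in> ?Z. aniso_mod p 1 (insert w V) (ext_form V w b' z)}"
      let ?E = "{z \<in> ?Z. degenerate_ext p V w (ext_form V w b' z)}"
      let ?g1 = "g ?r ?s (Suc ?\<rho>) ?m" and ?g2 = "g ?r (Suc ?s) ?\<rho> ?m"
      note pre = state_limit_step(2)[OF p st w(2), folded b'_def]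
      have an: "aniso_mod p 1 V b'"
        using pre[of undefined] aniso_mod_ext_form[OF wn(2)] unfolding is_prestate_def by blast
      have cA: "real (card ?A) = ext_frac p ?s * real p ^ Suc ?s"
        by (rule card_aniso_ext[OF p fin(2) wn(2) rs(2) an])
      have cE: "real (card ?E) = real p ^ ?s"
        unfolding card_degenerate_ext[OF p fin(2) wn(2) an] by simp
      have finZ: "finite ?Z" unfolding ext_coeffs_def using fin by (intro finite_PiE) auto
      have a_A: "?a z = ?g2" if z: "z \<in> ?A" for z
      proof -
        \<comment> \<open>The existence of an anisotropic extension excludes \<open>|V| = 2\<close>,
          because \<open>ext_frac\<close> vanishes there. The enlarged block thus still has at most
          two variables, as the induction hypothesis requires.\<close>
        have "card ?A > 0" using z finZ by (auto simp: card_gt_0_iff)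
        then have "ext_frac p ?s \<noteq> 0" using cA by auto
        then have "?s \<noteq> 2" by (auto simp: ext_frac_def)
        then have s: "Suc ?s \<le> 2" using rs by simp
        have st': "is_state p U (insert w V) R W' (ext_form V w b' z)"
          using is_prestate_aniso[OF pre] z by blast
        have I: "U \<union> insert w V \<union> R \<union> W' = insert w (U \<union> V \<union> R \<union> W')" by auto
        have cV: "card (insert w V) = Suc ?s" using fin wn by simp
        show ?thesis using IH[OF st', unfolded I cV] s rs by simp
      qed
      have a_E: "\<bar>?a z - ?g1\<bar> \<le> B" if z: "z \<in> ?E" for z
      proof -
        obtain b0 where b0: "is_state p U V (insert w R) W' b0" "?a z = state_limit p U V (insert w R) W' b0"
          using prestate_limit_degenerate[OF p pre] z by blast
        have cR: "card (insert w R) = Suc ?\<rho>" using fin wn by simp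
        have "Q U V (insert w R) W' b0" using b0(1) rs cR by (simp add: Q_def)
        from B[OF this] show ?thesis unfolding D_def b0(2) cR .
      qed
      have a_0: "?a z = 0" if "z \<in> ?Z - (?A \<union> ?E)" for z
      proof -
        have "\<not> aniso_mod p 1 (insert w V) (ext_form V w b' z)" "\<not> degenerate_ext p V w (ext_form V w b' z)"
          using that by auto
        then obtain x y where "int p dvd qf (insert w V) (ext_form V w b' z) x"
          "\<not> int p dvd polar (insert w V) (ext_form V w b' z) x y"
          using ext_cases[OF p fin(2) wn(2) iffD2[OF aniso_mod_ext_form[OF wn(2)] an]] by metis
        then show ?thesis by (rule prestate_limit_smooth[OF p pre])
      qed
      have "(\<Sum>z\<in>?Z. ?a z) = (\<Sum>z\<in>?A \<union> ?E. ?a z)"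
        using finZ a_0 by (intro sum.mono_neutral_right) auto
      also have "\<dots> = (\<Sum>z\<in>?A. ?a z) + (\<Sum>z\<in>?E. ?a z)"
        using finZ aniso_not_degenerate_ext[OF p] by (intro sum.union_disjoint) auto
      also have "(\<Sum>z\<in>?A. ?a z) = real (card ?A) * ?g2" using a_A by simp
      finally have sum: "(\<Sum>z\<in>?Z. ?a z) = real (card ?A) * ?g2 + (\<Sum>z\<in>?E. ?a z)" .
      have "\<bar>(\<Sum>z\<in>?E. ?a z) - real (card ?E) * ?g1\<bar> = \<bar>\<Sum>z\<in>?E. ?a z - ?g1\<bar>"
        by (simp add: sum_subtractf)
      also have "\<dots> \<le> (\<Sum>z\<in>?E. \<bar>?a z - ?g1\<bar>)" by (rule sum_abs)
      also have "\<dots> \<le> real (card ?E) * B" using sum_bounded_above[of ?E "\<lambda>z. \<bar>?a z - ?g1\<bar>" B] a_E by simp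
      finally have bound: "\<bar>(\<Sum>z\<in>?E. ?a z) - real p ^ ?s * ?g1\<bar> \<le> real p ^ ?s * B" unfolding cE .
      let ?S = "\<Sum>z\<in>?E. ?a z" and ?P = "real p ^ Suc ?s * real p ^ ?\<rho>"
      have lim: "state_limit p U V R (insert w W') b = (ext_frac p ?s * real p ^ Suc ?s * ?g2 + ?S) / ?P"
        unfolding state_limit_step(1)[OF p st w(2), folded b'_def] sum cA by simp
      have gg: "g ?r ?s ?\<rho> (Suc ?m) = (real p ^ ?s * ?g1 + ext_frac p ?s * real p ^ Suc ?s * ?g2) / ?P"
        unfolding g_step[OF rs(1,2,3)] using p0 by (simp add: field_simps)
      have cW: "card W = Suc ?m" using w fin by simp
      have "D U V R W b = \<bar>(?S - real p ^ ?s * ?g1) / ?P\<bar>"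
        unfolding D_def cW unfolding w(1) lim gg diff_divide_distrib[symmetric] by simp
      also have "\<dots> = \<bar>?S - real p ^ ?s * ?g1\<bar> / ?P" using p0 by (simp add: abs_mult)
      also have "\<dots> \<le> real p ^ ?s * B / ?P" using bound p0 by (intro divide_right_mono) auto
      also have "\<dots> = B / p / real p ^ ?\<rho>" using p0 by simp
      also have "\<dots> \<le> B / p / 1"
      proof (rule divide_left_mono)
        show "1 \<le> real p ^ ?\<rho>" using p1 by (simp add: one_le_power)
        have "0 \<le> D U V R W b" by (simp add: D_def)
        then have "0 \<le> B" using B[OF q(1)] by simp
        then show "0 \<le> B / p" by simp
      qed (use p0 in simp)
      finally show ?thesis by simp
    qed
    define F where "F = {..n} \<times> {..n} \<times> {..n} \<times> {..n}"
    \<comment> \<open>A bound for the error uniform over all states: the limits lie between 0 and 1,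
      and \<open>g\<close> is only evaluated at sizes up to \<open>n\<close>.\<close>
    define C where "C = 1 + (\<Sum>(r, s, \<rho>, m)\<in>F. \<bar>g r s \<rho> m\<bar>)"
    have bound0: "D U V R W b \<le> C" if q: "Q U V R W b" for U V R W b
    proof -
      have fin: "finite (U \<union> V \<union> R \<union> W)" using q by (simp add: Q_def is_state_def)
      have lim: "(\<lambda>k. state_frac p k U V R W b) \<longlonglongrightarrow> state_limit p U V R W b"
        by (rule aniso_frac_tendsto[OF p0 fin type_exp_le_2])
      have "0 \<le> state_limit p U V R W b"
        by (rule LIMSEQ_le_const[OF lim]) (simp add: aniso_frac_nonneg)
      moreover have "state_limit p U V R W b \<le> 1"
        by (rule LIMSEQ_le_const2[OF lim]) (simp add: aniso_frac_le_1[OF fin])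
      ultimately have "\<bar>state_limit p U V R W b\<bar> \<le> 1" by simp
      moreover have "\<bar>g (card U) (card V) (card R) (card W)\<bar> \<le> (\<Sum>(r, s, \<rho>, m)\<in>F. \<bar>g r s \<rho> m\<bar>)"
      proof -
        have "(card U, card V, card R, card W) \<in> F" using q by (auto simp: F_def Q_def)
        then show ?thesis
          using member_le_sum[of "(card U, card V, card R, card W)" F "\<lambda>(r, s, \<rho>, m). \<bar>g r s \<rho> m\<bar>"]
          by (auto simp: F_def)
      qed
      ultimately show ?thesis unfolding D_def C_def by linarith
    qed
    have iter: "D U V R W b \<le> C * (1 / p) ^ N" if "Q U V R W b" for U V R W b N
      using that
    proof (induction N arbitrary: U V R W b)
      case 0
      then show ?case using bound0 by simp
    next
      case (Suc N)
      have *: "D U V R W b \<le> C * (1 / p) ^ Suc N" if q: "Q U V R W b" "W \<noteq> {}" for U V R W b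
        using step[OF Suc.IH q] by simp
      show ?case
      proof (cases "W = {}")
        case True
        have st: "is_state p U V R {} b" using Suc.prems True by (simp add: Q_def)
        \<comment> \<open>With \<open>W\<close> empty, rescaling keeps the error by
          \<open>g_rescale\<close> and makes \<open>R\<close> the set of unexposed variables,
          nonempty since \<open>t\<close> is positive; there the contraction applies.\<close>
        have q: "Q V U {} R (rescale p V b)"
          using is_state_rescale[OF p0 st] Suc.prems True by (simp add: Q_def)
        have "D V U {} R (rescale p V b) \<le> C * (1 / p) ^ Suc N"
          using \<open>t \<noteq> 0\<close> Suc.prems True by (intro *[OF q]) (auto simp: Q_def)
        moreover have "D U V R W b = D V U {} R (rescale p V b)"
          unfolding D_def True state_limit_rescale[OF p st]
          using g_rescale[of "card U" "card V" "card R"] Suc.prems True by (simp add: Q_def)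
        ultimately show ?thesis by simp
      qed (rule *[OF Suc.prems])
    qed
    have q: "Q U V R W b" using less.prems by (simp add: Q_def t_def)
    have "(\<lambda>N. C * (1 / real p) ^ N) \<longlonglongrightarrow> C * 0"
      using p1 by (intro tendsto_mult tendsto_const LIMSEQ_power_zero) simp
    then have "D U V R W b \<le> C * 0"
      by (rule LIMSEQ_le_const) (use iter[OF q] in blast)
    then show ?thesis by (simp add: D_def)
  qed
qed

section \<open>Haar measure of the isotropic forms\<close>

lemma padic_qf_zero_iff:
  assumes "p > 0" "c \<in> quadratic_forms p n" "x \<in> {1..n} \<rightarrow>\<^sub>E carrier (Zp p)"
  shows "form_eval p n c x = \<zero>\<^bsub>Zp p\<^esub> \<longleftrightarrow>
    (\<forall>k. int p ^ k dvd qf {1..n} (\<lambda>ij. c ij k) (\<lambda>i. x i k))"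
  unfolding form_eval_eq[OF assms] qf_def form_index_upairs
  by (simp add: fun_eq_iff dvd_eq_mod_eq_0)

text \<open>A p-adic zero becomes primitive after division by the power of \<open>p\<close> common
  to its entries. At finite precision this division costs digits, so the zero is read off at a
  precision larger than \<open>k\<close>.\<close>

lemma isotropic_imp_not_aniso_mod:
  assumes p: "prime p" and c: "c \<in> quadratic_forms p n" and iso: "isotropic p n c"
  shows "\<not> aniso_mod p k {1..n} (\<lambda>ij. c ij k)"
proof -
  have p0: "p > 0" using p prime_gt_0_nat by blast
  let ?I = "{1..n}"
  obtain x where x: "x \<in> ?I \<rightarrow>\<^sub>E carrier (Zp p)" "x \<noteq> (\<lambda>i\<in>?I. \<zero>\<^bsub>Zp p\<^esub>)" "form_eval p n c x = \<zero>\<^bsub>Zp p\<^esub>"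
    using iso unfolding isotropic_def by blast
  have xc: "x i \<in> carrier (Zp p)" if "i \<in> ?I" for i using x(1) that by blast
  have zero: "int p ^ m dvd qf ?I (\<lambda>ij. c ij m) (\<lambda>i. x i m)" for m
    using x(3) padic_qf_zero_iff[OF p0 c x(1)] by blast
  have "\<exists>i\<in>?I. \<exists>m. x i m \<noteq> 0"
  proof (rule ccontr)
    assume "\<not> ?thesis"
    then have "x i = (\<lambda>m. 0)" if "i \<in> ?I" for i using that by (intro ext) blast
    then have "x = (\<lambda>i\<in>?I. \<zero>\<^bsub>Zp p\<^esub>)"
      using p0 by (intro PiE_ext[OF x(1)]) (auto simp: Zp_carrier_iff)
    then show False using x(2) by blast
  qed
  then obtain m0 where "\<exists>i\<in>?I. x i m0 \<noteq> 0" by blast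
  \<comment> \<open>The first precision at which \<open>x\<close> is nonzero. Residues modulo
    \<open>p^0\<close> are all 0, so \<open>m = v + 1\<close>, where \<open>p^v\<close> is the exact
    power of \<open>p\<close> dividing \<open>x\<close>.\<close>
  define m where "m = (LEAST m. \<exists>i\<in>?I. x i m \<noteq> 0)"
  have m: "\<exists>i\<in>?I. x i m \<noteq> 0" unfolding m_def by (rule LeastI) fact
  have x0: "x i 0 = 0" if "i \<in> ?I" for i using Zp_mod_self[OF xc[OF that], of 0] by simp
  obtain v where v: "m = Suc v" using m x0 by (cases m) auto
  have xv: "x i v = 0" if "i \<in> ?I" for i
    using not_less_Least[of v "\<lambda>m. \<exists>i\<in>?I. x i m \<noteq> 0"] that v unfolding m_def by force
  \<comment> \<open>Dividing the vector by \<open>p^v\<close> costs \<open>2 * v\<close> digits of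
    the value of the form; the extra 1 ensures \<open>m \<le> K\<close>, so that primitivity is
    visible.\<close>
  define K where "K = k + 2 * v + 1"
  have dv: "int p ^ v dvd x i K" if "i \<in> ?I" for i
    using Zp_mod_le[OF xc[OF that], of v K] xv[OF that] by (simp add: K_def dvd_eq_mod_eq_0)
  define y where "y = (\<lambda>i. x i K div int p ^ v)"
  have y: "x i K = int p ^ v * y i" if "i \<in> ?I" for i using dv[OF that] by (simp add: y_def)
  have "qf ?I (\<lambda>ij. c ij K) (\<lambda>i. x i K) = qf ?I (\<lambda>ij. c ij K) (\<lambda>i. int p ^ v * y i)"
    by (rule qf_cong_args) (rule y)
  also have "\<dots> = (int p ^ v)\<^sup>2 * qf ?I (\<lambda>ij. c ij K) y" by (rule qf_scale)
  finally have "int p ^ K dvd (int p ^ v)\<^sup>2 * qf ?I (\<lambda>ij. c ij K) y" using zero[of K] by (simp only:)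
  moreover have "int p ^ K = (int p ^ v)\<^sup>2 * int p ^ Suc k"
    by (simp add: K_def power_add power_mult mult_ac power2_eq_square)
  ultimately have "int p ^ Suc k dvd qf ?I (\<lambda>ij. c ij K) y" using p0 by simp
  then have K: "int p ^ k dvd qf ?I (\<lambda>ij. c ij K) y" by (meson dvd_trans le_imp_power_dvd lessI less_imp_le)
  have "[c ij K = c ij k] (mod int p ^ k)" if "ij \<in> upairs ?I" for ij
  proof -
    have "c ij \<in> carrier (Zp p)" using c that unfolding quadratic_forms_def form_index_upairs by blast
    from Zp_mod_le[OF this, of k K] Zp_mod_self[OF this, of k] show ?thesis by (simp add: K_def cong_def)
  qed
  then have "[qf ?I (\<lambda>ij. c ij K) y = qf ?I (\<lambda>ij. c ij k) y] (mod int p ^ k)"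
    by (rule qf_cong_mod[OF _ cong_refl])
  then have "int p ^ k dvd qf ?I (\<lambda>ij. c ij k) y"
    using K cong_dvd_iff by blast
  moreover have "\<exists>i\<in>?I. \<not> int p dvd y i"
  proof -
    obtain i where i: "i \<in> ?I" "x i m \<noteq> 0" using m by blast
    have "x i K mod int p ^ m \<noteq> 0" using Zp_mod_le[OF xc[OF i(1)], of m K] i(2) by (simp add: K_def v)
    then have "\<not> int p ^ v * int p dvd int p ^ v * y i"
      unfolding y[OF i(1), symmetric] by (simp add: v dvd_eq_mod_eq_0 mult.commute)
    then show ?thesis using i(1) by (meson mult_dvd_mono dvd_refl)
  qed
  ultimately show ?thesis unfolding aniso_mod_def by blast
qed

text \<open>Compactness turns a compatible choice of primitive zeros modulo all powers of \<open>p\<close> into a zero.\<close>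

lemma not_aniso_mod_imp_isotropic:
  assumes p: "prime p" and c: "c \<in> quadratic_forms p n"
    and nan: "\<And>k. \<not> aniso_mod p k {1..n} (\<lambda>ij. c ij k)"
  shows "isotropic p n c"
proof -
  have p0: "p > 0" using p prime_gt_0_nat by blast
  let ?I = "{1..n}"
  let ?X = "Zp_power_topology p ?I"
  let ?q = "\<lambda>k x. \<Sum>ij\<in>upairs ?I. c ij k * x (fst ij) k * x (snd ij) k"
  have q: "?q k x = qf ?I (\<lambda>ij. c ij k) (\<lambda>i. x i k)" for k and x :: "nat \<Rightarrow> nat \<Rightarrow> int"
    by (simp add: qf_def case_prod_unfold)
  have cont_q: "continuous_map ?X (discrete_topology UNIV) (?q k)" for k
  proof (intro continuous_map_discrete_sum)
    fix ij assume "ij \<in> upairs ?I"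
    then have "fst ij \<in> ?I" "snd ij \<in> ?I" by (auto simp: upairs_def)
    then show "continuous_map ?X (discrete_topology UNIV) (\<lambda>x. c ij k * x (fst ij) k * x (snd ij) k)"
      by (intro continuous_map_discrete_op[where h = "\<lambda>a b. c ij k * a * b"] continuous_map_Zp_component_UNIV)
  qed simp
  \<comment> \<open>Being nonzero at precision 1 in some entry expresses primitivity. Without this
    closed condition the intersection could contain only the zero vector.\<close>
  define C where "C = (\<lambda>k. {x \<in> topspace ?X. int p ^ k dvd ?q k x} \<inter>
     (\<Union>i\<in>?I. {x \<in> topspace ?X. x i 1 \<noteq> 0}))"
  have C_iff: "x \<in> C k \<longleftrightarrow> x \<in> ?I \<rightarrow>\<^sub>E carrier (Zp p) \<and>
      int p ^ k dvd qf ?I (\<lambda>ij. c ij k) (\<lambda>i. x i k) \<and> (\<exists>i\<in>?I. x i 1 \<noteq> 0)" for x k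
    unfolding C_def q topspace_Zp_power_topology by blast
  have sing: "closedin ?X {x \<in> topspace ?X. x i 1 \<noteq> 0}" if "i \<in> ?I" for i
    by (rule closedin_discrete_preimage[OF continuous_map_Zp_component_UNIV[OF that], where P = "\<lambda>a. a \<noteq> 0"])
  have "closedin ?X (\<Union>i\<in>?I. {x \<in> topspace ?X. x i 1 \<noteq> 0})"
  proof (rule closedin_Union)
    fix S assume "S \<in> (\<lambda>i. {x \<in> topspace ?X. x i 1 \<noteq> 0}) ` ?I"
    then obtain i where "i \<in> ?I" "S = {x \<in> topspace ?X. x i 1 \<noteq> 0}" by blast
    then show "closedin ?X S" using sing by (simp only:)
  qed simp
  then have closed: "closedin ?X (C k)" for k
    unfolding C_def by (intro closedin_Int closedin_discrete_preimage[OF cont_q])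
  have nonempty: "C k \<noteq> {}" for k
  proof -
    obtain y where y: "int p ^ k dvd qf ?I (\<lambda>ij. c ij k) y" "\<exists>i\<in>?I. \<not> int p dvd y i"
      using nan[of k] unfolding aniso_mod_def by blast
    \<comment> \<open>The integers \<open>y i\<close> are embedded into the p-adic integers by their
      residues.\<close>
    define x where "x = (\<lambda>i\<in>?I. \<lambda>m. y i mod int p ^ m)"
    have "x \<in> ?I \<rightarrow>\<^sub>E carrier (Zp p)"
      unfolding x_def using Zp_mod_carrierI[OF p0, of "\<lambda>_. y _"] by auto
    moreover have "[qf ?I (\<lambda>ij. c ij k) y = qf ?I (\<lambda>ij. c ij k) (\<lambda>i. x i k)] (mod int p ^ k)"
      by (rule qf_cong_mod[OF cong_refl]) (simp add: x_def cong_def)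
    then have "int p ^ k dvd qf ?I (\<lambda>ij. c ij k) (\<lambda>i. x i k)" using y(1) cong_dvd_iff by blast
    moreover have "\<exists>i\<in>?I. x i 1 \<noteq> 0" using y(2) by (auto simp: x_def dvd_eq_mod_eq_0)
    ultimately show ?thesis using C_iff by blast
  qed
  have "C (Suc k) \<subseteq> C k" for k
  proof
    fix x assume "x \<in> C (Suc k)"
    then have x: "x \<in> ?I \<rightarrow>\<^sub>E carrier (Zp p)" "\<exists>i\<in>?I. x i 1 \<noteq> 0"
      "int p ^ Suc k dvd qf ?I (\<lambda>ij. c ij (Suc k)) (\<lambda>i. x i (Suc k))" unfolding C_iff by blast+
    have "[qf ?I (\<lambda>ij. c ij (Suc k)) (\<lambda>i. x i (Suc k)) = qf ?I (\<lambda>ij. c ij k) (\<lambda>i. x i k)] (mod int p ^ k)"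
    proof (rule qf_cong_mod)
      fix ij assume "ij \<in> upairs ?I"
      then have "c ij \<in> carrier (Zp p)" using c unfolding quadratic_forms_def form_index_upairs by blast
      then show "[c ij (Suc k) = c ij k] (mod int p ^ k)" using Zp_Suc Zp_mod_self by (simp add: cong_def)
    next
      fix i assume "i \<in> ?I"
      then have "x i \<in> carrier (Zp p)" using x(1) by blast
      then show "[x i (Suc k) = x i k] (mod int p ^ k)" using Zp_Suc Zp_mod_self by (simp add: cong_def)
    qed
    moreover have "int p ^ k dvd qf ?I (\<lambda>ij. c ij (Suc k)) (\<lambda>i. x i (Suc k))"
      using x(3) by (metis dvd_mult_right power_Suc)
    ultimately have "int p ^ k dvd qf ?I (\<lambda>ij. c ij k) (\<lambda>i. x i k)" using cong_dvd_iff by blast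
    then show "x \<in> C k" using x C_iff by blast
  qed
  then have "decseq C" by (rule decseq_SucI)
  with compact_Zp_power_topology closed nonempty have "(\<Inter>k. C k) \<noteq> {}"
    by (rule compact_space_imp_nest)
  then obtain x where x: "\<And>k. x \<in> C k" by blast
  then have xI: "x \<in> ?I \<rightarrow>\<^sub>E carrier (Zp p)" using C_iff by blast
  have "x \<noteq> (\<lambda>i\<in>?I. \<zero>\<^bsub>Zp p\<^esub>)" using x[of 0] unfolding C_iff by auto
  moreover have "form_eval p n c x = \<zero>\<^bsub>Zp p\<^esub>"
    using x padic_qf_zero_iff[OF p0 c xI] C_iff by blast
  ultimately show ?thesis unfolding isotropic_def using xI by blast
qed

text \<open>The anisotropic forms are the increasing union of the sets \<open>A k\<close>, each a
  finite union of cylinders of equal measure, so continuity from below turns counting into Haar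
  measure. In the initial state all variables lie in \<open>W\<close>, every exponent is 0, and the
  box consists of all residues.\<close>

lemma isotropic_prob_eq:
  assumes p: "prime p"
  shows "isotropic_prob p n = 1 - state_limit p {} {} {} {1..n} (\<lambda>_. 0)"
proof -
  have p0: "p > 0" using p prime_gt_0_nat by blast
  let ?I = "{1..n}" and ?J = "form_index n" and ?e = "type_exp {} {1..n}"
  let ?M = "Zp_haar p ?J"
  interpret prob_space ?M by (rule prob_space_Zp_haar) (simp_all add: p0)
  have haar: "normalized_haar_measure (Zp_power p ?J) (Zp_power_topology p ?J) ?M"
    by (rule normalized_haar_Zp_haar) (simp_all add: p0)
  have space: "space ?M = quadratic_forms p n" by (rule space_Zp_haar_forms[OF p0])
  have cyl_sets: "cylinder p ?J k f \<in> sets ?M" if "f \<in> residues p ?J k" for k f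
    using openin_cylinder[OF finite_form_index p0 that] haar unfolding normalized_haar_measure_def by auto
  have cyl_meas: "measure ?M (cylinder p ?J k f) = 1 / real p ^ (k * card ?J)" if "f \<in> residues p ?J k" for k f
    using normalized_haar_cylinder[OF finite_form_index p0 that haar] by (simp add: measure_def)
  define A where "A = (\<lambda>k. {c \<in> quadratic_forms p n. aniso_mod p k ?I (\<lambda>ij. c ij k)})"
  define F where "F = (\<lambda>k. {f \<in> residues p ?J k. aniso_mod p k ?I f})"
  have finF: "finite (F k)" for k
    unfolding F_def using finite_residues[OF finite_form_index] by (rule finite_subset[rotated]) auto
  have A_eq: "A k = (\<Union>f\<in>F k. cylinder p ?J k f)" for k
  proof (intro equalityI subsetI)
    fix c assume "c \<in> A k"
    then have c: "c \<in> ?J \<rightarrow>\<^sub>E carrier (Zp p)" "aniso_mod p k ?I (\<lambda>ij. c ij k)"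
      by (auto simp: A_def quadratic_forms_def)
    let ?f = "\<lambda>ij\<in>?J. c ij k"
    have "aniso_mod p k ?I ?f \<longleftrightarrow> aniso_mod p k ?I (\<lambda>ij. c ij k)"
      by (rule aniso_mod_cong) (simp add: form_index_upairs)
    then have "?f \<in> F k" using residue_of_mem[OF c(1)] c(2) by (simp add: F_def)
    then show "c \<in> (\<Union>f\<in>F k. cylinder p ?J k f)" using cylinder_of_mem(2)[OF c(1)] by blast
  next
    fix c assume "c \<in> (\<Union>f\<in>F k. cylinder p ?J k f)"
    then obtain f where f: "f \<in> F k" "c \<in> cylinder p ?J k f" by blast
    have "aniso_mod p k ?I (\<lambda>ij. c ij k) \<longleftrightarrow> aniso_mod p k ?I f"
      using f(2) by (intro aniso_mod_cong) (simp add: form_index_upairs cylinder_def)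
    then show "c \<in> A k" using f by (simp add: A_def F_def quadratic_forms_def cylinder_def)
  qed
  have A_sets: "A k \<in> sets ?M" for k
    unfolding A_eq using finF cyl_sets by (intro sets.finite_UN) (auto simp: F_def)
  have measA: "measure ?M (A k) = state_frac p k {} {} {} ?I (\<lambda>_. 0)" for k
  proof -
    have "disjoint_family_on (cylinder p ?J k) (F k)"
      unfolding disjoint_family_on_def
    proof (intro ballI impI)
      fix f g assume fg: "f \<in> F k" "g \<in> F k" "f \<noteq> g"
      show "cylinder p ?J k f \<inter> cylinder p ?J k g = {}"
      proof (rule ccontr)
        assume "cylinder p ?J k f \<inter> cylinder p ?J k g \<noteq> {}"
        then obtain c where c: "c \<in> cylinder p ?J k f" "c \<in> cylinder p ?J k g" by blast
        have "f = g"
        proof (rule PiE_ext)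
          show "f \<in> ?J \<rightarrow>\<^sub>E {0..<int p ^ k}" "g \<in> ?J \<rightarrow>\<^sub>E {0..<int p ^ k}"
            using fg by (simp_all add: F_def residues_def)
          show "f ij = g ij" if "ij \<in> ?J" for ij
          proof -
            have "c ij k = f ij" "c ij k = g ij" using c that by (simp_all add: cylinder_def)
            then show ?thesis by (rule trans[OF sym])
          qed
        qed
        with fg(3) show False by contradiction
      qed
    qed
    then have "measure ?M (A k) = (\<Sum>f\<in>F k. measure ?M (cylinder p ?J k f))"
      unfolding A_eq using finF cyl_sets by (intro finite_measure_finite_Union) (auto simp: F_def)
    also have "\<dots> = real (card (F k)) / real p ^ (k * card ?J)"
      using cyl_meas by (simp add: F_def)
    also have "\<dots> = aniso_frac p k ?I (\<lambda>_. 0) ?e"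
    proof -
      have e0: "?e ij = 0" if "ij \<in> upairs ?I" for ij using that by (auto simp: type_exp_def upairs_def)
      have box: "coeff_box p k ?I (\<lambda>_. 0) ?e = residues p ?J k"
        unfolding coeff_box_def residues_def form_index_upairs
        by (intro PiE_cong) (simp only: e0 res_class_0)
      have card: "card (residues p ?J k) = p ^ (k * card ?J)"
        by (simp add: residues_def card_PiE[OF finite_form_index] nat_power_eq power_mult)
      show ?thesis unfolding aniso_frac_def box F_def card of_nat_power ..
    qed
    finally show ?thesis by simp
  qed
  have "A k \<subseteq> A (Suc k)" for k
  proof
    fix c assume "c \<in> A k"
    then have c: "c \<in> quadratic_forms p n" "aniso_mod p k ?I (\<lambda>ij. c ij k)" by (simp_all add: A_def)
    have "aniso_mod p k ?I (\<lambda>ij. c ij (Suc k)) \<longleftrightarrow> aniso_mod p k ?I (\<lambda>ij. c ij k)"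
    proof (rule aniso_mod_cong)
      fix ij assume "ij \<in> upairs ?I"
      then have "c ij \<in> carrier (Zp p)" using c(1) unfolding quadratic_forms_def form_index_upairs by blast
      then show "[c ij (Suc k) = c ij k] (mod int p ^ k)" using Zp_Suc Zp_mod_self by (simp add: cong_def)
    qed
    then have "aniso_mod p (Suc k) ?I (\<lambda>ij. c ij (Suc k))" using c(2) aniso_mod_mono by (metis le_SucI order_refl)
    then show "c \<in> A (Suc k)" using c(1) by (simp add: A_def)
  qed
  then have "(\<lambda>k. measure ?M (A k)) \<longlonglongrightarrow> measure ?M (\<Union>k. A k)"
    using A_sets by (intro finite_Lim_measure_incseq incseq_SucI) auto
  moreover have "(\<lambda>k. measure ?M (A k)) \<longlonglongrightarrow> state_limit p {} {} {} ?I (\<lambda>_. 0)"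
    unfolding measA by (intro aniso_frac_tendsto p0 type_exp_le_2) simp
  ultimately have lim: "measure ?M (\<Union>k. A k) = state_limit p {} {} {} ?I (\<lambda>_. 0)"
    by (rule LIMSEQ_unique)
  have iff: "isotropic p n c \<longleftrightarrow> (\<forall>k. c \<notin> A k)" if "c \<in> quadratic_forms p n" for c
  proof
    show "\<forall>k. c \<notin> A k" if "isotropic p n c"
      using isotropic_imp_not_aniso_mod[OF p \<open>c \<in> _\<close> that] by (simp add: A_def)
    show "isotropic p n c" if "\<forall>k. c \<notin> A k"
      using that \<open>c \<in> _\<close> by (intro not_aniso_mod_imp_isotropic[OF p]) (simp_all add: A_def)
  qed
  have eq: "{c \<in> quadratic_forms p n. isotropic p n c} = space ?M - (\<Union>k. A k)"
  proof (rule Set.set_eqI)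
    fix c
    show "c \<in> {c \<in> quadratic_forms p n. isotropic p n c} \<longleftrightarrow> c \<in> space ?M - (\<Union>k. A k)"
      unfolding space by (cases "c \<in> quadratic_forms p n") (simp_all add: iff)
  qed
  have "(\<Union>k. A k) \<in> sets ?M" using A_sets by (intro sets.countable_UN) auto
  then have "measure ?M (space ?M - (\<Union>k. A k)) = 1 - measure ?M (\<Union>k. A k)" by (rule prob_compl)
  then show ?thesis unfolding isotropic_prob_def eq lim .
qed

lemma is_state_initial: "is_state p {} {} {} {1..n} (\<lambda>_. 0)"
  by (auto simp: is_state_def aniso_mod_def)

section \<open>The explicit values\<close>

text \<open>
  The value at a state with \<open>R\<close> empty, as a function of \<open>|U|\<close>, \<open>|V|\<close> and \<open>|W|\<close>; the closed forms
  were found by solving the linear system of the recursion for at most four variables.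
\<close>

definition base_prob :: "real \<Rightarrow> nat \<Rightarrow> nat \<Rightarrow> nat \<Rightarrow> real" where
  "base_prob x r s m =
    (if m = 0 then 1
     else if (r, s, m) = (0, 0, 1) then 1
     else if (r, s, m) = (0, 0, 2) then 1 / 2
     else if (r, s, m) = (0, 1, 1) then (x + 2) / (2 * (x + 1))
     else if (r, s, m) = (1, 0, 1) then (2 * x + 1) / (2 * (x + 1))
     else if (r, s, m) = (0, 0, 3) then x / (2 * (x + 1) ^ 2)
     else if (r, s, m) = (0, 1, 2) then 1 / (2 * (x + 1))
     else if (r, s, m) = (0, 2, 1) then 1 / (x + 1)
     else if (r, s, m) = (1, 0, 2) then x / (2 * (x + 1))
     else if (r, s, m) = (1, 1, 1) then 1 / 2
     else if (r, s, m) = (2, 0, 1) then x / (x + 1)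
     else if (r, s, m) = (0, 0, 4) then x ^ 3 / (4 * (x + 1) ^ 2 * (x ^ 4 + x ^ 3 + x ^ 2 + x + 1))
     else if (r, s, m) = (0, 1, 3) then x / (4 * (x + 1) ^ 2 * (x ^ 2 + 1))
     else if (r, s, m) = (0, 2, 2) then 1 / (2 * (x + 1) * (x ^ 2 + x + 1))
     else if (r, s, m) = (1, 0, 3) then x ^ 3 / (4 * (x + 1) ^ 2 * (x ^ 2 + 1))
     else if (r, s, m) = (1, 1, 2) then x / (4 * (x ^ 2 + x + 1))
     else if (r, s, m) = (1, 2, 1) then 1 / (2 * (x + 1))
     else if (r, s, m) = (2, 0, 2) then x ^ 3 / (2 * (x + 1) * (x ^ 2 + x + 1))
     else if (r, s, m) = (2, 1, 1) then x / (2 * (x + 1))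
     else 0)"

text \<open>When no variable is unexposed, the rescaled state is looked up in the table, with the
  blocks swapped. Recursing there instead would not terminate, since the same state can
  recur.\<close>

fun state_prob :: "nat \<Rightarrow> nat \<Rightarrow> nat \<Rightarrow> nat \<Rightarrow> nat \<Rightarrow> real" where
  "state_prob p r s \<rho> 0 = base_prob (real p) s r \<rho>"
| "state_prob p r s \<rho> (Suc m) =
     (state_prob p r s (Suc \<rho>) m / p + ext_frac p s * state_prob p r (Suc s) \<rho> m) / real p ^ \<rho>"

lemma base_prob_simps:
  "base_prob x r s 0 = 1"
  "base_prob x 0 0 (Suc 0) = 1"
  "base_prob x 0 0 (Suc (Suc 0)) = 1 / 2"
  "base_prob x 0 (Suc 0) (Suc 0) = (x + 2) / (2 * (x + 1))"
  "base_prob x (Suc 0) 0 (Suc 0) = (2 * x + 1) / (2 * (x + 1))"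
  "base_prob x 0 0 (Suc (Suc (Suc 0))) = x / (2 * (x + 1) ^ 2)"
  "base_prob x 0 (Suc 0) (Suc (Suc 0)) = 1 / (2 * (x + 1))"
  "base_prob x 0 (Suc (Suc 0)) (Suc 0) = 1 / (x + 1)"
  "base_prob x (Suc 0) 0 (Suc (Suc 0)) = x / (2 * (x + 1))"
  "base_prob x (Suc 0) (Suc 0) (Suc 0) = 1 / 2"
  "base_prob x (Suc (Suc 0)) 0 (Suc 0) = x / (x + 1)"
  "base_prob x 0 0 (Suc (Suc (Suc (Suc 0)))) = x ^ 3 / (4 * (x + 1) ^ 2 * (x ^ 4 + x ^ 3 + x ^ 2 + x + 1))"
  "base_prob x 0 (Suc 0) (Suc (Suc (Suc 0))) = x / (4 * (x + 1) ^ 2 * (x ^ 2 + 1))"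
  "base_prob x 0 (Suc (Suc 0)) (Suc (Suc 0)) = 1 / (2 * (x + 1) * (x ^ 2 + x + 1))"
  "base_prob x (Suc 0) 0 (Suc (Suc (Suc 0))) = x ^ 3 / (4 * (x + 1) ^ 2 * (x ^ 2 + 1))"
  "base_prob x (Suc 0) (Suc 0) (Suc (Suc 0)) = x / (4 * (x ^ 2 + x + 1))"
  "base_prob x (Suc 0) (Suc (Suc 0)) (Suc 0) = 1 / (2 * (x + 1))"
  "base_prob x (Suc (Suc 0)) 0 (Suc (Suc 0)) = x ^ 3 / (2 * (x + 1) * (x ^ 2 + x + 1))"
  "base_prob x (Suc (Suc 0)) (Suc 0) (Suc 0) = x / (2 * (x + 1))"
  by (simp_all add: base_prob_def numeral_eq_Suc)

lemma ext_frac_simps: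
  "ext_frac p 0 = 1 - 1 / p"
  "ext_frac p (Suc 0) = (real p - 1) / (2 * p)"
  "ext_frac p (Suc (Suc 0)) = 0"
  by (simp_all add: ext_frac_def)

text \<open>Consistency of the table with the recursion: unfolding one round of exposures expresses
  each entry through entries of the table again, and what remains is an identity of rational
  functions in \<open>p\<close>.\<close>

lemma state_prob_base_cases:
  assumes "p > 1"
  shows
    "state_prob p 0 0 0 (Suc 0) = base_prob (real p) 0 0 (Suc 0)"
    "state_prob p 0 0 0 (Suc (Suc 0)) = base_prob (real p) 0 0 (Suc (Suc 0))"
    "state_prob p 0 (Suc 0) 0 (Suc 0) = base_prob (real p) 0 (Suc 0) (Suc 0)"
    "state_prob p (Suc 0) 0 0 (Suc 0) = base_prob (real p) (Suc 0) 0 (Suc 0)"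
    "state_prob p 0 0 0 (Suc (Suc (Suc 0))) = base_prob (real p) 0 0 (Suc (Suc (Suc 0)))"
    "state_prob p 0 (Suc 0) 0 (Suc (Suc 0)) = base_prob (real p) 0 (Suc 0) (Suc (Suc 0))"
    "state_prob p 0 (Suc (Suc 0)) 0 (Suc 0) = base_prob (real p) 0 (Suc (Suc 0)) (Suc 0)"
    "state_prob p (Suc 0) 0 0 (Suc (Suc 0)) = base_prob (real p) (Suc 0) 0 (Suc (Suc 0))"
    "state_prob p (Suc 0) (Suc 0) 0 (Suc 0) = base_prob (real p) (Suc 0) (Suc 0) (Suc 0)"
    "state_prob p (Suc (Suc 0)) 0 0 (Suc 0) = base_prob (real p) (Suc (Suc 0)) 0 (Suc 0)"
    "state_prob p 0 0 0 (Suc (Suc (Suc (Suc 0)))) = base_prob (real p) 0 0 (Suc (Suc (Suc (Suc 0))))"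
    "state_prob p 0 (Suc 0) 0 (Suc (Suc (Suc 0))) = base_prob (real p) 0 (Suc 0) (Suc (Suc (Suc 0)))"
    "state_prob p 0 (Suc (Suc 0)) 0 (Suc (Suc 0)) = base_prob (real p) 0 (Suc (Suc 0)) (Suc (Suc 0))"
    "state_prob p (Suc 0) 0 0 (Suc (Suc (Suc 0))) = base_prob (real p) (Suc 0) 0 (Suc (Suc (Suc 0)))"
    "state_prob p (Suc 0) (Suc 0) 0 (Suc (Suc 0)) = base_prob (real p) (Suc 0) (Suc 0) (Suc (Suc 0))"
    "state_prob p (Suc 0) (Suc (Suc 0)) 0 (Suc 0) = base_prob (real p) (Suc 0) (Suc (Suc 0)) (Suc 0)"
    "state_prob p (Suc (Suc 0)) 0 0 (Suc (Suc 0)) = base_prob (real p) (Suc (Suc 0)) 0 (Suc (Suc 0))"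
    "state_prob p (Suc (Suc 0)) (Suc 0) 0 (Suc 0) = base_prob (real p) (Suc (Suc 0)) (Suc 0) (Suc 0)"
proof -
  define x where "x = real p"
  have "x > 1" using assms by (simp add: x_def)
  then have "x > 0" "x + 1 > 0" "x ^ 2 + x + 1 > 0" "x ^ 2 + 1 > 0" "x ^ 4 + x ^ 3 + x ^ 2 + x + 1 > 0"
    by (simp_all add: add_pos_pos)
  note nz = this[THEN less_imp_neq, symmetric]
  show
    "state_prob p 0 0 0 (Suc 0) = base_prob (real p) 0 0 (Suc 0)"
    "state_prob p 0 0 0 (Suc (Suc 0)) = base_prob (real p) 0 0 (Suc (Suc 0))"
    "state_prob p 0 (Suc 0) 0 (Suc 0) = base_prob (real p) 0 (Suc 0) (Suc 0)"
    "state_prob p (Suc 0) 0 0 (Suc 0) = base_prob (real p) (Suc 0) 0 (Suc 0)"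
    "state_prob p 0 0 0 (Suc (Suc (Suc 0))) = base_prob (real p) 0 0 (Suc (Suc (Suc 0)))"
    "state_prob p 0 (Suc 0) 0 (Suc (Suc 0)) = base_prob (real p) 0 (Suc 0) (Suc (Suc 0))"
    "state_prob p 0 (Suc (Suc 0)) 0 (Suc 0) = base_prob (real p) 0 (Suc (Suc 0)) (Suc 0)"
    "state_prob p (Suc 0) 0 0 (Suc (Suc 0)) = base_prob (real p) (Suc 0) 0 (Suc (Suc 0))"
    "state_prob p (Suc 0) (Suc 0) 0 (Suc 0) = base_prob (real p) (Suc 0) (Suc 0) (Suc 0)"
    "state_prob p (Suc (Suc 0)) 0 0 (Suc 0) = base_prob (real p) (Suc (Suc 0)) 0 (Suc 0)"
    "state_prob p 0 0 0 (Suc (Suc (Suc (Suc 0)))) = base_prob (real p) 0 0 (Suc (Suc (Suc (Suc 0))))"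
    "state_prob p 0 (Suc 0) 0 (Suc (Suc (Suc 0))) = base_prob (real p) 0 (Suc 0) (Suc (Suc (Suc 0)))"
    "state_prob p 0 (Suc (Suc 0)) 0 (Suc (Suc 0)) = base_prob (real p) 0 (Suc (Suc 0)) (Suc (Suc 0))"
    "state_prob p (Suc 0) 0 0 (Suc (Suc (Suc 0))) = base_prob (real p) (Suc 0) 0 (Suc (Suc (Suc 0)))"
    "state_prob p (Suc 0) (Suc 0) 0 (Suc (Suc 0)) = base_prob (real p) (Suc 0) (Suc 0) (Suc (Suc 0))"
    "state_prob p (Suc 0) (Suc (Suc 0)) 0 (Suc 0) = base_prob (real p) (Suc 0) (Suc (Suc 0)) (Suc 0)"
    "state_prob p (Suc (Suc 0)) 0 0 (Suc (Suc 0)) = base_prob (real p) (Suc (Suc 0)) 0 (Suc (Suc 0))"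
    "state_prob p (Suc (Suc 0)) (Suc 0) 0 (Suc 0) = base_prob (real p) (Suc (Suc 0)) (Suc 0) (Suc 0)"
    unfolding state_prob.simps base_prob_simps ext_frac_simps x_def[symmetric]
    using nz
    by (simp_all add: divide_simps)
       (simp_all add: algebra_simps power2_eq_square power3_eq_cube power4_eq_xxxx)
qed

lemma state_prob_base:
  assumes "p > 1" "r \<le> 2" "s \<le> 2" "r + s + m \<le> 4"
  shows "state_prob p r s 0 m = base_prob (real p) r s m"
proof -
  have "r = 0 \<or> r = Suc 0 \<or> r = Suc (Suc 0)" "s = 0 \<or> s = Suc 0 \<or> s = Suc (Suc 0)"
    "m = 0 \<or> m = Suc 0 \<or> m = Suc (Suc 0) \<or> m = Suc (Suc (Suc 0)) \<or> m = Suc (Suc (Suc (Suc 0)))"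
    using assms(2-4) by linarith+
  then show ?thesis
    using assms(4)
    by (elim disjE; hypsubst)
       (simp_all only: state_prob_base_cases[OF assms(1)], simp_all add: base_prob_simps(1))
qed

theorem theorem2:
  fixes p :: nat
  assumes "prime p"
  shows "isotropic_prob p 1 = 0 \<and>
         isotropic_prob p 2 = 1 / 2 \<and>
         isotropic_prob p 3 = 1 - real p / (2 * (real p + 1) ^ 2) \<and>
         isotropic_prob p 4 =
           1 - real p ^ 3 / (4 * (real p + 1) ^ 2 *
                 (real p ^ 4 + real p ^ 3 + real p ^ 2 + real p + 1)) \<and>
         (\<forall>n\<ge>5. isotropic_prob p n = 1)"
proof -
  have p: "p > 1" by (rule prime_gt_1_nat[OF assms])
  have small: "isotropic_prob p n = 1 - base_prob (real p) 0 0 n" if n: "n \<le> 4" for n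
  proof -
    have "state_limit p {} {} {} {1..n} (\<lambda>_. 0) =
        state_prob p (card ({} :: nat set)) (card ({} :: nat set)) (card ({} :: nat set)) (card {1..n})"
    proof (rule state_limit_eq[OF assms _ _ _ is_state_initial, where n = n and g = "state_prob p"])
      show "state_prob p r s 0 0 = 1" for r s by (simp add: base_prob_simps(1))
      \<comment> \<open>The left side is by definition the table entry of the rescaled state; the
        right side is its value by the recursion.\<close>
      show "state_prob p r s \<rho> 0 = state_prob p s r 0 \<rho>" if "r \<le> 2" "s \<le> 2" "r + s + \<rho> = n" for r s \<rho>
        using that n state_prob_base[OF p, of s r \<rho>] by simp
    qed simp_all
    also have "\<dots> = base_prob (real p) 0 0 n" using state_prob_base[OF p, of 0 0 n] n by simp
    finally show ?thesis using isotropic_prob_eq[OF assms] by simp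
  qed
  have large: "isotropic_prob p n = 1" if n: "n \<ge> 5" for n
  proof -
    \<comment> \<open>A terminal state would need \<open>r + s = n\<close> with
      \<open>r, s \<le> 2\<close>, which is impossible for \<open>n \<ge> 5\<close>. The remaining
      equations are homogeneous, so the zero function solves the system.\<close>
    have "state_limit p {} {} {} {1..n} (\<lambda>_. 0) = 0"
      by (rule state_limit_eq[OF assms _ _ _ is_state_initial, where n = n and g = "\<lambda>_ _ _ _. 0"]) (use n in simp_all)
    then show ?thesis using isotropic_prob_eq[OF assms] by simp
  qed
  show ?thesis
    using small[of 1] small[of 2] small[of 3] small[of 4] large by (simp add: base_prob_def)
qed

end
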